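(* Let $(R,\mathfrak m)$ be a Noetherian quasi-unmixed local ring of dimension $n$. Let $I$ and $J$ be proper ideals of $R$ of finite colength. Then $$\frac{e_i(I,J)}{e(J)}\le\mathcal L_J^{(1)}(I)\cdots\mathcal L_J^{(i)}(I)$$ for all $i=1,\dots,n$, and the following conditions are equivalent: (a) $I$ is Hickel with respect to $J$, that is, $\frac{e(I)}{e(J)}=\mathcal L_J^{(1)}(I)\cdots\mathcal L_J^{(n)}(I)$; (b) $\frac{e_i(I,J)}{e(J)}=\mathcal L_J^{(1)}(I)\cdots\mathcal L_J^{(i)}(I)$ for all $i=1,\dots,n$; (c) $\mathcal L_J^{(i)}(I)=\frac{e_i(I,J)}{e_{i-1}(I,J)}$ for all $i=1,\dots,n$.
   Context: Quasi-unmixed means formally equidimensional. $e(I)$ denotes the Samuel multiplicity. For ideals $I_1,\dots,I_n$ of $R$ of finite colength, $e(I_1,\dots,I_n)$ denotes their mixed multiplicity (Teissier–Risler), and $e_i(I,J)=e(I,\dots,I,J,\dots,J)$ with $I$ repeated $i$ times and $J$ repeated $n-i$ times; thus $e_0(I,J)=e(J)$ and $e_n(I,J)=e(I)$. For ideals $I_1,\dots,I_n,J$ of finite colength, $\mathcal L_J(I_1,\dots,I_n)=\inf\{\frac rs:r,s\in\mathbb Z_{\ge1},\ e(I_1^s,\dots,I_n^s)=e(I_1^s+J^r,\dots,I_n^s+J^r)\}$, and $\mathcal L_J^{(i)}(I)=\mathcal L_J(I,\dots,I,J,\dots,J)$ with $I$ repeated $i$ times and $J$ repeated $n-i$ times.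 *)

theory Defs
  imports Complex_Main "HOL-Library.Extended_Nat" "HOL-Algebra.Algebra"
begin

section \<open>Dimension and length\<close>

text \<open>Supremum of the lengths \<open>k\<close> of the strict chains \<open>C\<^sub>0 \<subset> \<dots> \<subset> C\<^sub>k\<close> in a family of sets.\<close>

definition chain_height :: "'a set set \<Rightarrow> enat" where
  "chain_height \<S> =
     (SUP k \<in> {k. \<exists>C. (\<forall>i\<le>k. C i \<in> \<S>) \<and> (\<forall>i<k. C i \<subset> C (Suc i))}. enat k)"

definition krull_dim :: "('a, 'b) ring_scheme \<Rightarrow> enat" where
  "krull_dim R = chain_height {P. primeideal P R}"

definition ring_length :: "('a, 'b) ring_scheme \<Rightarrow> enat" where
  "ring_length R = chain_height {I. ideal I R}"

text \<open>The length of \<open>R/I\<close>: its \<open>R\<close>-submodules are exactly the ideals of the ring \<open>R Quot I\<close>.\<close>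

definition colength :: "('a, 'b) ring_scheme \<Rightarrow> 'a set \<Rightarrow> enat" where
  "colength R I = ring_length (R Quot I)"

definition finite_colength :: "('a, 'b) ring_scheme \<Rightarrow> 'a set \<Rightarrow> bool" where
  "finite_colength R I \<longleftrightarrow> ideal I R \<and> colength R I \<noteq> \<infinity>"

section \<open>Quasi-unmixed local rings\<close>

definition local_ring :: "('a, 'b) ring_scheme \<Rightarrow> 'a set \<Rightarrow> bool" where
  "local_ring R m \<longleftrightarrow> cring R \<and> maximalideal m R \<and> (\<forall>M. maximalideal M R \<longrightarrow> M = m)"

abbreviation ideal_pow :: "('a, 'b) ring_scheme \<Rightarrow> 'a set \<Rightarrow> nat \<Rightarrow> 'a set" where
  "ideal_pow R I k \<equiv> I [^]\<^bsub>ideals_set R\<^esub> k"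

text \<open>
  The inverse limit of the rings \<open>R/I\<^sup>k\<close>. The transition map \<open>R/I\<^sup>k\<^sup>+\<^sup>1 \<rightarrow> R/I\<^sup>k\<close> sends a coset of
  \<open>I\<^sup>k\<^sup>+\<^sup>1\<close> to the unique coset of \<open>I\<^sup>k\<close> containing it, so compatibility of a sequence of cosets
  means that the sequence is decreasing.
\<close>

definition adic_completion :: "('a, 'b) ring_scheme \<Rightarrow> 'a set \<Rightarrow> (nat \<Rightarrow> 'a set) ring" where
  "adic_completion R I =
     \<lparr>carrier = {f. (\<forall>k. f k \<in> carrier (R Quot ideal_pow R I k)) \<and> (\<forall>k. f (Suc k) \<subseteq> f k)},
      monoid.mult = (\<lambda>f g k. f k \<otimes>\<^bsub>R Quot ideal_pow R I k\<^esub> g k),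
      one = (\<lambda>k. \<one>\<^bsub>R Quot ideal_pow R I k\<^esub>),
      ring.zero = (\<lambda>k. \<zero>\<^bsub>R Quot ideal_pow R I k\<^esub>),
      ring.add = (\<lambda>f g k. f k \<oplus>\<^bsub>R Quot ideal_pow R I k\<^esub> g k)\<rparr>"

definition minimal_prime :: "'a set \<Rightarrow> ('a, 'b) ring_scheme \<Rightarrow> bool" where
  "minimal_prime P R \<longleftrightarrow> primeideal P R \<and> (\<forall>Q. primeideal Q R \<longrightarrow> Q \<subseteq> P \<longrightarrow> Q = P)"

definition equidimensional :: "('a, 'b) ring_scheme \<Rightarrow> bool" where
  "equidimensional R \<longleftrightarrow> (\<forall>P. minimal_prime P R \<longrightarrow> krull_dim (R Quot P) = krull_dim R)"

definition quasi_unmixed :: "('a, 'b) ring_scheme \<Rightarrow> 'a set \<Rightarrow> bool" where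
  "quasi_unmixed R m \<longleftrightarrow> equidimensional (adic_completion R m)"

section \<open>Samuel and mixed multiplicities\<close>

text \<open>
  Lengths and the dimension are read as natural numbers by \<open>the_enat\<close>. This is only meaningful for
  ideals of finite colength in a ring of finite dimension.
\<close>

definition samuel_mult :: "('a, 'b) ring_scheme \<Rightarrow> 'a set \<Rightarrow> real" where
  "samuel_mult R I =
     (let d = the_enat (krull_dim R)
      in lim (\<lambda>k. fact d * real (the_enat (colength R (ideal_pow R I k))) / real k ^ d))"

text \<open>
  For ideals \<open>I\<^sub>1, \<dots>, I\<^sub>n\<close> of finite colength in a Noetherian local ring of dimension \<open>n \<ge> 1\<close>, the
  length of the quotient of \<open>R\<close> by the product of the powers of \<open>I\<^sub>j\<close> with exponent \<open>r\<^sub>j\<close> is, for all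
  large \<open>r\<^sub>1, \<dots>, r\<^sub>n\<close>, a polynomial in these exponents of total degree at most \<open>n\<close>. Its part of
  degree \<open>n\<close> is the sum of \<open>e(I\<^sub>1[d\<^sub>1], \<dots>, I\<^sub>n[d\<^sub>n])\<close> times the product of the
  \<open>r\<^sub>j ^ d\<^sub>j / fact d\<^sub>j\<close>, over \<open>d\<^sub>1 + \<dots> + d\<^sub>n = n\<close>, where \<open>[d]\<close> means repeated \<open>d\<close> times. So
  \<open>e(I\<^sub>1, \<dots>, I\<^sub>n)\<close> is the coefficient of \<open>r\<^sub>1 \<cdots> r\<^sub>n\<close>.

  In the definitions the ideals form a list, numbered from \<open>0\<close>, whose length has to be the dimension
  of \<open>R\<close>. A polynomial is given by its coefficients \<open>c \<alpha>\<close>, where the multi-exponents \<open>\<alpha>\<close> are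
  extensional functions on \<open>{..<n}\<close>; they are determined by its values at all large \<open>r\<close>.
\<close>

definition hilbert_coeffs :: "('a, 'b) ring_scheme \<Rightarrow> 'a set list \<Rightarrow> ((nat \<Rightarrow> nat) \<Rightarrow> real) \<Rightarrow> bool" where
  "hilbert_coeffs R Is c \<longleftrightarrow>
     (let n = length Is in
      \<exists>N. \<forall>r. (\<forall>j<n. N \<le> r j) \<longrightarrow>
        real (the_enat (colength R (\<Otimes>\<^bsub>ideals_set R\<^esub>j\<in>{..<n}. ideal_pow R (Is ! j) (r j)))) =
        (\<Sum>\<alpha> | \<alpha> \<in> extensional {..<n} \<and> (\<Sum>j<n. \<alpha> j) \<le> n. c \<alpha> * (\<Prod>j<n. real (r j) ^ \<alpha> j)))"

definition mixed_mult :: "('a, 'b) ring_scheme \<Rightarrow> 'a set list \<Rightarrow> real" where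
  "mixed_mult R Is =
     (THE e. \<exists>c. hilbert_coeffs R Is c \<and> e = c (restrict (\<lambda>_. 1) {..<length Is}))"

definition repeated_pair :: "nat \<Rightarrow> nat \<Rightarrow> 'a set \<Rightarrow> 'a set \<Rightarrow> 'a set list" where
  "repeated_pair n i I J = replicate i I @ replicate (n - i) J"

definition mixed_mult_pair ::
  "('a, 'b) ring_scheme \<Rightarrow> nat \<Rightarrow> nat \<Rightarrow> 'a set \<Rightarrow> 'a set \<Rightarrow> real" where
  "mixed_mult_pair R n i I J = mixed_mult R (repeated_pair n i I J)"

section \<open>Lojasiewicz exponents\<close>

definition lojasiewicz :: "('a, 'b) ring_scheme \<Rightarrow> 'a set \<Rightarrow> 'a set list \<Rightarrow> real" where
  "lojasiewicz R J Is =
     Inf {real r / real s | r s. 1 \<le> r \<and> 1 \<le> s \<and>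
       mixed_mult R (map (\<lambda>I. ideal_pow R I s) Is) =
       mixed_mult R (map (\<lambda>I. ideal_pow R I s <+>\<^bsub>R\<^esub> ideal_pow R J r) Is)}"

definition lojasiewicz_pair ::
  "('a, 'b) ring_scheme \<Rightarrow> nat \<Rightarrow> nat \<Rightarrow> 'a set \<Rightarrow> 'a set \<Rightarrow> real" where
  "lojasiewicz_pair R n i I J = lojasiewicz R J (repeated_pair n i I J)"

definition hickel :: "('a, 'b) ring_scheme \<Rightarrow> nat \<Rightarrow> 'a set \<Rightarrow> 'a set \<Rightarrow> bool" where
  "hickel R n I J \<longleftrightarrow>
     samuel_mult R I / samuel_mult R J = (\<Prod>j=1..n. lojasiewicz_pair R n j I J)"

end

theory Submission
  imports Defs "HOL-Computational_Algebra.Polynomial"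
begin

text \<open>
  Write \<open>e\<^sub>i\<close> for \<open>e\<^sub>i(I,J)\<close>. If \<open>r/s\<close> is admissible for the \<open>i\<close>-th Lojasiewicz exponent, then
  multilinearity of mixed multiplicities and their monotonicity, applied to
  \<open>I\<^sup>s \<subseteq> I\<^sup>s + J\<^sup>r\<close> and \<open>J\<^sup>r \<subseteq> I\<^sup>s + J\<^sup>r\<close>, give \<open>s e\<^sub>i \<le> r e\<^sub>i\<^sub>-\<^sub>1\<close>. So the exponent is at least the ratio
  \<open>e\<^sub>i / e\<^sub>i\<^sub>-\<^sub>1\<close>; these ratios are positive and telescope, whence the inequality and the equivalences.

  Mixed multiplicities are treated without graded rings. A module over a polynomial ring is a
  quotient of two families of ideals of \<open>R\<close> indexed by multidegrees and stable under certain
  multiplications, and Hilbert's basis theorem is an ascending chain condition on such families. A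
  Hilbert function is a finite sum of products of nonnegative functions of one variable that are
  eventually polynomial, so its top coefficients are nonnegative. To compare ideals \<open>A \<subseteq> B\<close> in
  one slot, this is applied to the quotients of \<open>B\<^sup>u\<close> by \<open>A\<^sup>u\<close>, multiplied by products of powers of the other
  ideals: since some power of \<open>B\<close> lies in \<open>A\<close>, their lengths grow more slowly than the \<open>n\<close>-th power,
  and letting \<open>u\<close> tend to infinity gives monotonicity.

  That the Samuel function of \<open>R\<close> grows exactly like the \<open>n\<close>-th power is proved by Noetherian
  induction (upper bound) and along a chain of primes with the Artin-Rees lemma (lower bound).
\<close>

no_notation Sum_Type.Plus (infixr \<open><+>\<close> 65)

section \<open>Lengths of quotients of ideals\<close>

text \<open>Coefficients are reached by finite differences: the difference of a Hilbert function in
  all \<open>n\<close> variables is eventually constant, equal to the mixed multiplicity. Leaving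
  out one slot gives a function eventually affine in the exponent of that slot, with the mixed
  multiplicity as slope.

  The obstacle in comparing \<open>A \<subseteq> B\<close> is that an inequality between lengths
  says nothing about their differences. But the length of a quotient of powers is a Hilbert function
  of its own, and once its total degree is below \<open>n\<close>, its \<open>(n-1)\<close>-fold
  difference is a nonnegative constant. This is why Hilbert functions are kept as sums of products
  of nonnegative factors and degrees are bounded summand by summand.

  In the main estimate an admissible \<open>r/s\<close> makes \<open>s^n e_i\<close> the mixed
  multiplicity of the sums \<open>I^s + J^r\<close> and \<open>J^s + J^r\<close>. Taking
  \<open>J^r\<close> in one slot that held \<open>I\<close> and s-th powers in the others gives
  smaller ideals, of mixed multiplicity \<open>r s^(n-1) e_(i-1)\<close>. Dimension 0 is treated
  apart, since the empty list does not see \<open>I\<close> or \<open>J\<close>.\<close>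

definition strict_chain :: "'a set set \<Rightarrow> nat \<Rightarrow> (nat \<Rightarrow> 'a set) \<Rightarrow> bool" where
  "strict_chain S k C \<longleftrightarrow> (\<forall>i\<le>k. C i \<in> S) \<and> (\<forall>i<k. C i \<subset> C (Suc i))"

lemma chain_height_leI:
  assumes "\<And>k C. strict_chain S k C \<Longrightarrow> enat k \<le> b"
  shows "chain_height S \<le> b"
  unfolding chain_height_def
  by (rule SUP_least) (use assms in \<open>auto simp: strict_chain_def\<close>)

lemma strict_chain_le_chain_height:
  assumes "strict_chain S k C"
  shows "enat k \<le> chain_height S"
  unfolding chain_height_def
  by (rule SUP_upper) (use assms in \<open>auto simp: strict_chain_def\<close>)

lemma strict_chain_truncate: "strict_chain S k C \<Longrightarrow> l \<le> k \<Longrightarrow> strict_chain S l C"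
  unfolding strict_chain_def by auto

text \<open>Truncation makes the set of chain lengths downward closed, so a missing length
  \<open>k\<close> bounds all lengths by \<open>k - 1\<close>. The empty family has height 0 but no
  chain of length 0, hence \<open>S \<noteq> {}\<close>.\<close>

lemma strict_chain_exists_iff:
  assumes "S \<noteq> {}"
  shows "enat k \<le> chain_height S \<longleftrightarrow> (\<exists>C. strict_chain S k C)"
proof
  assume k: "enat k \<le> chain_height S"
  show "\<exists>C. strict_chain S k C"
  proof (rule ccontr)
    assume none: "\<not> ?thesis"
    obtain x where "x \<in> S" using assms by blast
    then have "strict_chain S 0 (\<lambda>_. x)" by (auto simp: strict_chain_def)
    then have k0: "k > 0" using none by (cases k) auto
    have "chain_height S \<le> enat (k - 1)"
    proof (rule chain_height_leI)
      fix l C assume "strict_chain S l C"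
      then have "\<not> k \<le> l" using none strict_chain_truncate by blast
      then show "enat l \<le> enat (k - 1)" by simp
    qed
    with k have "enat k \<le> enat (k - 1)" by (rule order_trans)
    then show False using k0 by simp
  qed
qed (auto intro: strict_chain_le_chain_height)

lemma chain_height_le_map:
  assumes "\<And>Z. Z \<in> S \<Longrightarrow> f Z \<in> T"
    and "\<And>Z Y. Z \<in> S \<Longrightarrow> Y \<in> S \<Longrightarrow> Z \<subset> Y \<Longrightarrow> f Z \<subset> f Y"
  shows "chain_height S \<le> chain_height T"
proof (rule chain_height_leI)
  fix k C assume "strict_chain S k C"
  then have "strict_chain T k (f \<circ> C)"
    using assms by (auto simp: strict_chain_def)
  then show "enat k \<le> chain_height T" by (rule strict_chain_le_chain_height)
qed

lemma chain_height_mono: "S \<subseteq> T \<Longrightarrow> chain_height S \<le> chain_height T"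
  by (rule chain_height_le_map[where f = id]) auto

text \<open>Reduces a bound on a sum of two suprema to finite chains. An infinite summand is
  excluded by testing \<open>Suc n\<close>, where \<open>c = enat n\<close>, against 0.\<close>

lemma enat_add_leI:
  assumes "\<And>k l. enat k \<le> a \<Longrightarrow> enat l \<le> b \<Longrightarrow> enat k + enat l \<le> c"
  shows "a + b \<le> c"
proof (cases c)
  case (enat n)
  have "a \<noteq> \<infinity>"
  proof
    assume "a = \<infinity>"
    then show False using assms[of "Suc n" 0] enat by (simp add: zero_enat_def[symmetric])
  qed
  moreover have "b \<noteq> \<infinity>"
  proof
    assume "b = \<infinity>"
    then show False using assms[of 0 "Suc n"] enat by (simp add: zero_enat_def[symmetric])
  qed
  ultimately obtain k l where "a = enat k" "b = enat l" by (metis enat.exhaust)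
  then show ?thesis using assms[of k l] by simp
qed simp

text \<open>For ideals \<open>V \<subseteq> U\<close> this is the length of the module
  \<open>U/V\<close>, whose submodules are the ideals in between; no module structure has to be
  built.\<close>

definition quot_length :: "('a, 'b) ring_scheme \<Rightarrow> 'a set \<Rightarrow> 'a set \<Rightarrow> enat" where
  "quot_length R U V = chain_height {W. ideal W R \<and> V \<subseteq> W \<and> W \<subseteq> U}"

lemma quot_length_mono:
  assumes "V' \<subseteq> V" "U \<subseteq> U'"
  shows "quot_length R U V \<le> quot_length R U' V'"
  unfolding quot_length_def using assms by (intro chain_height_mono) blast

lemma quot_length_self [simp]: "quot_length R U U = 0"
proof -
  have "quot_length R U U \<le> 0"
    unfolding quot_length_def
  proof (rule chain_height_leI)
    fix k C assume "strict_chain {W. ideal W R \<and> U \<subseteq> W \<and> W \<subseteq> U} k C"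
    then have *: "\<And>i. i \<le> k \<Longrightarrow> C i = U" and **: "\<And>i. i < k \<Longrightarrow> C i \<subset> C (Suc i)"
      by (auto simp: strict_chain_def)
    have "k = 0" using *[of 0] *[of 1] **[of 0] by (cases k) auto
    then show "enat k \<le> 0" by (simp add: zero_enat_def)
  qed
  then show ?thesis by simp
qed

lemma quot_length_extend:
  assumes "ideal V R" "ideal Z R" "ideal Y R" "V \<subseteq> Z" "Z \<subset> Y"
  shows "quot_length R Z V + 1 \<le> quot_length R Y V"
proof (cases "quot_length R Y V")
  case (enat l)
  have "quot_length R Z V \<le> quot_length R Y V"
    using assms by (intro quot_length_mono) auto
  then obtain k where k: "quot_length R Z V = enat k" using enat by (cases "quot_length R Z V") auto
  let ?S = "{W. ideal W R \<and> V \<subseteq> W \<and> W \<subseteq> Z}"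
  have "V \<in> ?S" using assms by auto
  then have "?S \<noteq> {}" by blast
  then obtain C where C: "strict_chain ?S k C"
    using k strict_chain_exists_iff unfolding quot_length_def by (metis order_refl)
  have Ci: "ideal (C i) R \<and> V \<subseteq> C i \<and> C i \<subseteq> Z" if "i \<le> k" for i
    using C that by (simp add: strict_chain_def)
  have Cs: "C i \<subset> C (Suc i)" if "i < k" for i
    using C that by (simp add: strict_chain_def)
  have "strict_chain {W. ideal W R \<and> V \<subseteq> W \<and> W \<subseteq> Y} (Suc k) (\<lambda>i. if i \<le> k then C i else Y)"
    unfolding strict_chain_def
  proof (intro conjI allI impI)
    fix i assume "i \<le> Suc k"
    show "(if i \<le> k then C i else Y) \<in> {W. ideal W R \<and> V \<subseteq> W \<and> W \<subseteq> Y}"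
      using Ci[of i] assms by (cases "i \<le> k") auto
  next
    fix i assume "i < Suc k"
    then consider "i < k" | "i = k" by linarith
    then show "(if i \<le> k then C i else Y) \<subset> (if Suc i \<le> k then C (Suc i) else Y)"
      using Cs[of i] Ci[of k] assms(5) by cases auto
  qed
  then have "enat (Suc k) \<le> quot_length R Y V"
    unfolding quot_length_def by (rule strict_chain_le_chain_height)
  then show ?thesis using k by (simp add: one_enat_def)
qed auto

lemma quot_length_eq_0D:
  assumes "ideal V R" "ideal U R" "V \<subseteq> U" "quot_length R U V = 0"
  shows "U = V"
  using quot_length_extend[OF assms(1,1,2)] assms by (cases "U = V") auto

section \<open>Sums of ideals and additivity of length\<close>

lemma (in cring) set_add_memI: "v \<in> V \<Longrightarrow> w \<in> W \<Longrightarrow> v \<oplus> w \<in> V <+> W"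
  by (auto simp: set_add_def')

lemma (in cring) set_add_memE:
  assumes "x \<in> V <+> W"
  obtains v w where "v \<in> V" "w \<in> W" "x = v \<oplus> w"
  using assms by (auto simp: set_add_def')

lemma (in ring) ideal_closed:
  assumes "ideal V R"
  shows "V \<subseteq> carrier R" "\<zero> \<in> V"
    and "\<And>x y. x \<in> V \<Longrightarrow> y \<in> V \<Longrightarrow> x \<oplus> y \<in> V"
    and "\<And>x y. x \<in> V \<Longrightarrow> y \<in> V \<Longrightarrow> x \<ominus> y \<in> V"
    and "\<And>x. x \<in> V \<Longrightarrow> \<ominus> x \<in> V"
    and "\<And>a x. x \<in> V \<Longrightarrow> a \<in> carrier R \<Longrightarrow> a \<otimes> x \<in> V"
    and "\<And>a x. x \<in> V \<Longrightarrow> a \<in> carrier R \<Longrightarrow> x \<otimes> a \<in> V"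
    and "\<And>x. x \<in> V \<Longrightarrow> x \<in> carrier R"
proof -
  interpret ideal V R by fact
  show "V \<subseteq> carrier R" "\<zero> \<in> V" by auto
  show "\<And>x y. x \<in> V \<Longrightarrow> y \<in> V \<Longrightarrow> x \<oplus> y \<in> V" by auto
  show "\<And>x. x \<in> V \<Longrightarrow> \<ominus> x \<in> V" by auto
  show "\<And>x y. x \<in> V \<Longrightarrow> y \<in> V \<Longrightarrow> x \<ominus> y \<in> V" by (auto simp: minus_eq)
  show "\<And>a x. x \<in> V \<Longrightarrow> a \<in> carrier R \<Longrightarrow> a \<otimes> x \<in> V" by (rule I_l_closed)
  show "\<And>a x. x \<in> V \<Longrightarrow> a \<in> carrier R \<Longrightarrow> x \<otimes> a \<in> V" by (rule I_r_closed)
  show "\<And>x. x \<in> V \<Longrightarrow> x \<in> carrier R" by auto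
qed

lemma (in cring) idealI':
  assumes "V \<subseteq> carrier R" "\<zero> \<in> V"
    and "\<And>x y. x \<in> V \<Longrightarrow> y \<in> V \<Longrightarrow> x \<oplus> y \<in> V"
    and "\<And>a x. x \<in> V \<Longrightarrow> a \<in> carrier R \<Longrightarrow> a \<otimes> x \<in> V"
  shows "ideal V R"
proof (rule idealI)
  have "\<ominus> x \<in> V" if "x \<in> V" for x
  proof -
    have "(\<ominus> \<one>) \<otimes> x \<in> V" using assms(4)[OF that, of "\<ominus> \<one>"] by simp
    then show ?thesis using that assms(1) by (simp add: l_minus subset_iff)
  qed
  then show "subgroup V (add_monoid R)"
    using assms by (intro add.subgroupI) (auto simp: a_inv_def)
  show "\<And>a x. a \<in> V \<Longrightarrow> x \<in> carrier R \<Longrightarrow> a \<otimes> x \<in> V"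
    using assms by (metis m_comm subsetD)
qed (use assms ring_axioms in auto)

lemma (in cring) set_add_subset_l:
  assumes "ideal V R" "ideal W R" shows "V \<subseteq> V <+> W"
proof
  fix v assume "v \<in> V"
  then have "v \<oplus> \<zero> \<in> V <+> W" using ideal_closed(2)[OF assms(2)] by (rule set_add_memI)
  then show "v \<in> V <+> W" using \<open>v \<in> V\<close> ideal_closed(1)[OF assms(1)] by auto
qed

lemma (in cring) set_add_subset_r:
  assumes "ideal V R" "ideal W R" shows "W \<subseteq> V <+> W"
proof
  fix v assume "v \<in> W"
  then have "\<zero> \<oplus> v \<in> V <+> W" using ideal_closed(2)[OF assms(1)] by (intro set_add_memI)
  then show "v \<in> V <+> W" using \<open>v \<in> W\<close> ideal_closed(1)[OF assms(2)] by auto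
qed

lemma (in cring) set_add_least:
  assumes "ideal U R" "V \<subseteq> U" "W \<subseteq> U" shows "V <+> W \<subseteq> U"
  using ideal_closed(3)[OF assms(1)] assms(2,3) by (auto elim!: set_add_memE)

lemma set_add_mono: "V \<subseteq> V' \<Longrightarrow> W \<subseteq> W' \<Longrightarrow> V <+>\<^bsub>R\<^esub> W \<subseteq> V' <+>\<^bsub>R\<^esub> W'"
  by (auto simp: set_add_def')

lemma (in cring) set_add_absorb:
  assumes "ideal V R" "ideal W R" "W \<subseteq> V" shows "V <+> W = V"
  using set_add_subset_l[OF assms(1,2)] set_add_least[OF assms(1) order_refl assms(3)] by blast

lemma (in cring) set_add_minusD:
  assumes "ideal V R" "v \<in> V" "w \<in> carrier R" "x = v \<oplus> w"
  shows "x \<ominus> v = w" "x \<ominus> w = v"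
proof -
  have "v \<in> carrier R" using assms ideal_closed(1) by blast
  then show "x \<ominus> v = w" "x \<ominus> w = v" using assms(3,4) by algebra+
qed

text \<open>The modular law: if \<open>y\<close> in \<open>Y\<close> were \<open>x + w\<close> with
  \<open>x\<close> in \<open>Z\<close> and \<open>w\<close> in \<open>W\<close>, then
  \<open>w = y - x\<close> would lie in \<open>Y\<close> and in \<open>W\<close>, hence in
  \<open>Z\<close>, and so would \<open>y\<close>.\<close>

lemma (in cring) modular_strict:
  assumes W: "ideal W R" and Z: "ideal Z R" and Y: "ideal Y R" and "Z \<subset> Y"
    and "Z \<inter> W = Y \<inter> W"
  shows "Z <+> W \<subset> Y <+> W"
proof -
  obtain y where y: "y \<in> Y" "y \<notin> Z" using assms by blast
  have "y \<notin> Z <+> W"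
  proof
    assume "y \<in> Z <+> W"
    then obtain x w where xw: "x \<in> Z" "w \<in> W" "y = x \<oplus> w" by (rule set_add_memE)
    have c: "w \<in> carrier R" using xw W ideal_closed(1) by blast
    have "w = y \<ominus> x" using set_add_minusD(1)[OF Z xw(1) c xw(3)] by simp
    then have "w \<in> Y" using ideal_closed(4)[OF Y] y xw assms(4) by blast
    then have "w \<in> Z" using xw assms(5) by blast
    then show False using xw y ideal_closed(3)[OF Z] by blast
  qed
  moreover have "y \<in> Y <+> W" using y set_add_subset_l[OF Y W] by blast
  moreover have "Z <+> W \<subseteq> Y <+> W" using assms by (intro set_add_mono) auto
  ultimately show ?thesis by blast
qed

text \<open>Each strict step of a chain enlarges its sum with \<open>W\<close> or its intersection
  with \<open>W\<close>, which gives one inequality; concatenating chains gives the other.\<close>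

lemma (in cring) quot_length_add:
  assumes V: "ideal V R" and W: "ideal W R" and U: "ideal U R" and "V \<subseteq> W" "W \<subseteq> U"
  shows "quot_length R U V = quot_length R U W + quot_length R W V"
proof (rule antisym)
  show "quot_length R U V \<le> quot_length R U W + quot_length R W V"
    unfolding quot_length_def[of R U V]
  proof (rule chain_height_leI)
    fix k E assume E: "strict_chain {Z. ideal Z R \<and> V \<subseteq> Z \<and> Z \<subseteq> U} k E"
    have id: "ideal (E i) R" "V \<subseteq> E i" "E i \<subseteq> U" if "i \<le> k" for i
      using E that by (auto simp: strict_chain_def)
    \<comment> \<open>The two terms measure the image of \<open>E i\<close> in \<open>U/W\<close>
      and its trace in \<open>W/V\<close>.\<close>
    have "enat i \<le> quot_length R (E i <+> W) W + quot_length R (E i \<inter> W) V" if "i \<le> k" for i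
      using that
    proof (induction i)
      case 0
      then show ?case by (simp add: zero_enat_def[symmetric])
    next
      case (Suc i)
      have i: "i \<le> k" "Suc i \<le> k" using Suc.prems by auto
      have st: "E i \<subset> E (Suc i)" using E i by (auto simp: strict_chain_def)
      have ids: "ideal (E i <+> W) R" "ideal (E (Suc i) <+> W) R" "ideal (E i \<inter> W) R" "ideal (E (Suc i) \<inter> W) R"
        using id i W by (auto intro: add_ideals i_intersect)
      have sub: "W \<subseteq> E i <+> W" "V \<subseteq> E i \<inter> W"
        using set_add_subset_r id i W assms by auto
      have IH: "enat i + 1 \<le> quot_length R (E i <+> W) W + quot_length R (E i \<inter> W) V + 1"
        using Suc.IH i by (auto intro: add_right_mono)
      show ?case
      proof (cases "E i \<inter> W = E (Suc i) \<inter> W")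
        case True
        have "E i <+> W \<subset> E (Suc i) <+> W"
          using modular_strict[OF W id(1)[OF i(1)] id(1)[OF i(2)] st True] .
        then have "quot_length R (E i <+> W) W + 1 \<le> quot_length R (E (Suc i) <+> W) W"
          using quot_length_extend[OF W ids(1,2) sub(1)] by blast
        then have "quot_length R (E i <+> W) W + 1 + quot_length R (E i \<inter> W) V
            \<le> quot_length R (E (Suc i) <+> W) W + quot_length R (E i \<inter> W) V"
          by (rule add_right_mono)
        moreover have "quot_length R (E i <+> W) W + quot_length R (E i \<inter> W) V + 1
            = quot_length R (E i <+> W) W + 1 + quot_length R (E i \<inter> W) V"
          by (simp only: add.assoc add.commute[of _ 1])
        ultimately have "enat i + 1 \<le> quot_length R (E (Suc i) <+> W) W + quot_length R (E (Suc i) \<inter> W) V"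
          using order_trans[OF IH] unfolding True by metis
        then show ?thesis by (simp add: one_enat_def)
      next
        case False
        then have "E i \<inter> W \<subset> E (Suc i) \<inter> W" using st by blast
        then have a: "quot_length R (E i \<inter> W) V + 1 \<le> quot_length R (E (Suc i) \<inter> W) V"
          using quot_length_extend[OF V ids(3,4) sub(2)] by blast
        have b: "quot_length R (E i <+> W) W \<le> quot_length R (E (Suc i) <+> W) W"
          using st by (intro quot_length_mono set_add_mono) auto
        have "enat i + 1 \<le> quot_length R (E (Suc i) <+> W) W + quot_length R (E (Suc i) \<inter> W) V"
          using order_trans[OF IH[unfolded add.assoc] add_mono[OF b a]] .
        then show ?thesis by (simp add: one_enat_def)
      qed
    qed
    then have "enat k \<le> quot_length R (E k <+> W) W + quot_length R (E k \<inter> W) V" by blast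
    also have "\<dots> \<le> quot_length R U W + quot_length R W V"
      using id[of k] assms by (intro add_mono quot_length_mono set_add_least) auto
    finally show "enat k \<le> quot_length R U W + quot_length R W V" .
  qed
next
  let ?A = "{Z. ideal Z R \<and> V \<subseteq> Z \<and> Z \<subseteq> W}" and ?B = "{Z. ideal Z R \<and> W \<subseteq> Z \<and> Z \<subseteq> U}"
  have key: "enat l + enat k \<le> quot_length R U V" if "enat l \<le> quot_length R U W" "enat k \<le> quot_length R W V" for k l
  proof -
    have "V \<in> ?A" "W \<in> ?B" using assms by simp_all
    then have ne: "?A \<noteq> {}" "?B \<noteq> {}" by auto
    have "\<exists>C. strict_chain ?A k C"
      by (rule strict_chain_exists_iff[THEN iffD1, OF ne(1)]) (use that(2) in \<open>simp only: quot_length_def\<close>)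
    then obtain C where C: "strict_chain ?A k C" ..
    have "\<exists>D. strict_chain ?B l D"
      by (rule strict_chain_exists_iff[THEN iffD1, OF ne(2)]) (use that(1) in \<open>simp only: quot_length_def\<close>)
    then obtain D where D: "strict_chain ?B l D" ..
    \<comment> \<open>The lower chain is used up to index \<open>k\<close>, the upper one from index
      1 on: its bottom may coincide with \<open>C k\<close>, and
      \<open>C k \<subseteq> W \<subseteq> D 0 \<subset> D 1\<close> keeps the junction
      strict.\<close>
    define E where "E i = (if i \<le> k then C i else D (i - k))" for i
    have st: "E i \<subset> E (Suc i)" if "i < k + l" for i
    proof -
      consider "i < k" | "i = k" | "i > k" by linarith
      then show ?thesis
      proof cases
        case 1
        then show ?thesis using C by (auto simp: E_def strict_chain_def)
      next
        case 2
        then have "C k \<subseteq> W" "W \<subseteq> D 0" "D 0 \<subset> D (Suc 0)"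
          using C D that by (auto simp: strict_chain_def)
        then show ?thesis using 2 by (auto simp: E_def)
      next
        case 3
        then have "D (i - k) \<subset> D (Suc (i - k))" using D that by (auto simp: strict_chain_def)
        then show ?thesis using 3 by (simp add: E_def Suc_diff_le)
      qed
    qed
    have mem: "E i \<in> {Z. ideal Z R \<and> V \<subseteq> Z \<and> Z \<subseteq> U}" if "i \<le> k + l" for i
    proof (cases "i \<le> k")
      case True
      then have "C i \<in> ?A" using C by (simp add: strict_chain_def)
      then show ?thesis using True assms by (auto simp: E_def)
    next
      case False
      then have "D (i - k) \<in> ?B" using D that by (simp add: strict_chain_def)
      then show ?thesis using False assms by (auto simp: E_def)
    qed
    have "strict_chain {Z. ideal Z R \<and> V \<subseteq> Z \<and> Z \<subseteq> U} (k + l) E"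
      unfolding strict_chain_def using st mem by simp
    from strict_chain_le_chain_height[OF this] show ?thesis
      unfolding quot_length_def by (simp add: add.commute)
  qed
  show "quot_length R U W + quot_length R W V \<le> quot_length R U V"
    by (rule enat_add_leI[OF key])
qed

text \<open>Ideals of the quotient ring correspond to ideals containing \<open>I\<close>; a set of
  cosets is pulled back by taking its union.\<close>

lemma (in cring) colength_eq_quot_length:
  assumes "ideal I R"
  shows "colength R I = quot_length R (carrier R) I"
proof -
  let ?S = "{J. ideal J R \<and> I \<subseteq> J}" and ?T = "{J. ideal J (R Quot I)}"
  have eq: "{W. ideal W R \<and> I \<subseteq> W \<and> W \<subseteq> carrier R} = ?S"
    using ideal_closed(1) by blast
  have bij: "bij_betw (\<lambda>J. (+>) I ` J) ?S ?T" by (rule quot_ideal_correspondence[OF assms])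
  have preim: thesis if "Z \<in> ?T" "\<And>J. J \<in> ?S \<Longrightarrow> Z = (+>) I ` J \<Longrightarrow> thesis" for Z thesis
  proof -
    have "Z \<in> (\<lambda>J. (+>) I ` J) ` ?S" using that(1) bij by (simp only: bij_betw_def)
    then show thesis using that(2) by (elim imageE)
  qed
  have "chain_height ?S \<le> chain_height ?T"
  proof (rule chain_height_le_map[where f = "\<lambda>J. (+>) I ` J"])
    fix Z Y assume "Z \<in> ?S" "Y \<in> ?S" "Z \<subset> Y"
    then have "(+>) I ` Z \<noteq> (+>) I ` Y"
      using bij unfolding bij_betw_def inj_on_def by blast
    then show "(+>) I ` Z \<subset> (+>) I ` Y" using \<open>Z \<subset> Y\<close> by blast
  next
    fix W assume "W \<in> ?S"
    then show "(+>) I ` W \<in> ?T" using bij unfolding bij_betw_def by blast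
  qed
  moreover have "chain_height ?T \<le> chain_height ?S"
  proof (rule chain_height_le_map[where f = "\<lambda>Z. \<Union> Z"])
    fix Z assume "Z \<in> ?T"
    from preim[OF this] obtain J where J: "J \<in> ?S" "Z = (+>) I ` J" .
    then have "\<Union> Z = J" using ideal_incl_iff[OF assms, of J] by simp
    then show "\<Union> Z \<in> ?S" using J(1) by (simp only:)
  next
    fix Z Y assume Z: "Z \<in> ?T" and Y: "Y \<in> ?T" and "Z \<subset> Y"
    from preim[OF Z] obtain J where J: "J \<in> ?S" "Z = (+>) I ` J" .
    from preim[OF Y] obtain K where K: "K \<in> ?S" "Y = (+>) I ` K" .
    have eqs: "\<Union> Z = J" "\<Union> Y = K"
      unfolding J(2) K(2) using J(1) K(1) ideal_incl_iff[OF assms, of J] ideal_incl_iff[OF assms, of K] by simp_all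
    have "J \<noteq> K" using J(2) K(2) \<open>Z \<subset> Y\<close> by blast
    then show "\<Union> Z \<subset> \<Union> Y" using eqs \<open>Z \<subset> Y\<close> by blast
  qed
  ultimately show ?thesis
    unfolding colength_def ring_length_def quot_length_def eq by (rule antisym[rotated])
qed

text \<open>With \<open>U = carrier R\<close> it is the principal ideal generated by
  \<open>a\<close>.\<close>

definition scaled :: "('a, 'b) ring_scheme \<Rightarrow> 'a \<Rightarrow> 'a set \<Rightarrow> 'a set" where
  "scaled R a U = (\<lambda>u. a \<otimes>\<^bsub>R\<^esub> u) ` U"

lemma (in cring) scaled_ideal:
  assumes "ideal U R" "a \<in> carrier R" shows "ideal (scaled R a U) R"
proof (rule idealI')
  note cl = ideal_closed[OF assms(1)]
  show "scaled R a U \<subseteq> carrier R" using assms cl(1) by (auto simp: scaled_def)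
  have "a \<otimes> \<zero> \<in> scaled R a U" unfolding scaled_def using cl(2) by blast
  then show "\<zero> \<in> scaled R a U" using assms by simp
next
  note cl = ideal_closed[OF assms(1)]
  fix x y assume "x \<in> scaled R a U" "y \<in> scaled R a U"
  then obtain u v where "u \<in> U" "v \<in> U" "x = a \<otimes> u" "y = a \<otimes> v" by (auto simp: scaled_def)
  then have "x \<oplus> y = a \<otimes> (u \<oplus> v)" "u \<oplus> v \<in> U" using cl assms by (auto simp: r_distr)
  then show "x \<oplus> y \<in> scaled R a U" by (auto simp: scaled_def)
next
  note cl = ideal_closed[OF assms(1)]
  fix b x assume "x \<in> scaled R a U" "b \<in> carrier R"
  then obtain u where u: "u \<in> U" "x = a \<otimes> u" by (auto simp: scaled_def)
  then have "b \<otimes> x = a \<otimes> (b \<otimes> u)" using cl(8)[of u] assms \<open>b \<in> carrier R\<close> by (simp add: m_lcomm)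
  moreover have "b \<otimes> u \<in> U" using u cl(6) \<open>b \<in> carrier R\<close> by blast
  ultimately show "b \<otimes> x \<in> scaled R a U" by (auto simp: scaled_def)
qed

definition colon :: "('a, 'b) ring_scheme \<Rightarrow> 'a set \<Rightarrow> 'a \<Rightarrow> 'a set" where
  "colon R V a = {u \<in> carrier R. a \<otimes>\<^bsub>R\<^esub> u \<in> V}"

lemma (in cring) colon_ideal:
  assumes "ideal V R" "a \<in> carrier R" shows "ideal (colon R V a) R"
proof (rule idealI')
  note cl = ideal_closed[OF assms(1)]
  show "colon R V a \<subseteq> carrier R" "\<zero> \<in> colon R V a" using assms cl(2) by (auto simp: colon_def)
  show "x \<oplus> y \<in> colon R V a" if "x \<in> colon R V a" "y \<in> colon R V a" for x y
    using that assms cl by (auto simp: colon_def r_distr)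
  show "b \<otimes> x \<in> colon R V a" if "x \<in> colon R V a" "b \<in> carrier R" for b x
    using that assms cl(6)[of "a \<otimes> x" b] by (auto simp: colon_def m_lcomm)
qed

text \<open>The assumption \<open>iff\<close> says that multiplication by \<open>a\<close>, as a map
  from \<open>U\<close> to \<open>R/V'\<close>, has kernel \<open>V\<close>; its image is
  \<open>(aU + V')/V'\<close>. The two lattice maps send \<open>W\<close> to
  \<open>U \<inter> (W : a)\<close> and \<open>W\<close> to \<open>aW + V'\<close>.\<close>

lemma (in cring) quot_length_scaled:
  assumes V: "ideal V R" and U: "ideal U R" and V': "ideal V' R" and a: "a \<in> carrier R"
    and VU: "V \<subseteq> U" and iff: "\<And>u. u \<in> U \<Longrightarrow> a \<otimes> u \<in> V' \<longleftrightarrow> u \<in> V"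
  shows "quot_length R (scaled R a U <+> V') V' = quot_length R U V"
proof (rule antisym)
  show "quot_length R (scaled R a U <+> V') V' \<le> quot_length R U V"
    unfolding quot_length_def
  proof (rule chain_height_le_map[where f = "\<lambda>W. U \<inter> colon R W a"])
    fix W assume "W \<in> {W. ideal W R \<and> V' \<subseteq> W \<and> W \<subseteq> scaled R a U <+> V'}"
    then have W: "ideal W R" "V' \<subseteq> W" by auto
    show "U \<inter> colon R W a \<in> {W. ideal W R \<and> V \<subseteq> W \<and> W \<subseteq> U}"
      using i_intersect[OF U colon_ideal[OF W(1) a]] VU iff W ideal_closed(1)[OF U]
      by (auto simp: colon_def)
  next
    fix Z Y assume Z: "Z \<in> {W. ideal W R \<and> V' \<subseteq> W \<and> W \<subseteq> scaled R a U <+> V'}"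
      and Y: "Y \<in> {W. ideal W R \<and> V' \<subseteq> W \<and> W \<subseteq> scaled R a U <+> V'}" and XY: "Z \<subset> Y"
    then obtain y where y: "y \<in> Y" "y \<notin> Z" by blast
    then have "y \<in> scaled R a U <+> V'" using Y by blast
    then obtain s v where sv: "s \<in> scaled R a U" "v \<in> V'" "y = s \<oplus> v" by (rule set_add_memE)
    then obtain u where u: "u \<in> U" "s = a \<otimes> u" by (auto simp: scaled_def)
    have vc: "v \<in> carrier R" using ideal_closed(1)[OF V'] sv by blast
    have s: "s = y \<ominus> v"
      using set_add_minusD(2)[OF scaled_ideal[OF U a] sv(1) vc sv(3)] by simp
    have "s \<in> Y" unfolding s using ideal_closed(4)[of Y] Y y sv by blast
    moreover have "s \<notin> Z"
    proof
      assume "s \<in> Z"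
      then have "s \<oplus> v \<in> Z" using ideal_closed(3)[of Z] Z sv by blast
      then show False using sv y by simp
    qed
    ultimately have "u \<in> U \<inter> colon R Y a" "u \<notin> U \<inter> colon R Z a"
      using u ideal_closed(1)[OF U] by (auto simp: colon_def)
    moreover have "U \<inter> colon R Z a \<subseteq> U \<inter> colon R Y a" using XY by (auto simp: colon_def)
    ultimately show "U \<inter> colon R Z a \<subset> U \<inter> colon R Y a" by blast
  qed
  show "quot_length R U V \<le> quot_length R (scaled R a U <+> V') V'"
    unfolding quot_length_def
  proof (rule chain_height_le_map[where f = "\<lambda>W. scaled R a W <+> V'"])
    fix W assume W: "W \<in> {W. ideal W R \<and> V \<subseteq> W \<and> W \<subseteq> U}"
    then have "scaled R a W \<subseteq> scaled R a U" by (auto simp: scaled_def)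
    then have "scaled R a W <+> V' \<subseteq> scaled R a U <+> V'" by (intro set_add_mono) auto
    then show "scaled R a W <+> V' \<in> {W. ideal W R \<and> V' \<subseteq> W \<and> W \<subseteq> scaled R a U <+> V'}"
      using W scaled_ideal[OF _ a, of W] V' add_ideals[of "scaled R a W" V'] set_add_subset_r[of "scaled R a W" V']
      by simp
  next
    fix Z Y assume Z: "Z \<in> {W. ideal W R \<and> V \<subseteq> W \<and> W \<subseteq> U}"
      and Y: "Y \<in> {W. ideal W R \<and> V \<subseteq> W \<and> W \<subseteq> U}" and XY: "Z \<subset> Y"
    then obtain y where y: "y \<in> Y" "y \<notin> Z" by blast
    have ids: "ideal (scaled R a Z) R" "ideal (scaled R a Y) R" using Z Y scaled_ideal[OF _ a] by auto
    have yc: "y \<in> carrier R" using y Y U ideal_closed(1) by blast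
    have "a \<otimes> y \<in> scaled R a Y" using y by (auto simp: scaled_def)
    then have 1: "a \<otimes> y \<in> scaled R a Y <+> V'" using set_add_subset_l[OF ids(2) V'] by blast
    have 2: "a \<otimes> y \<notin> scaled R a Z <+> V'"
    proof
      assume "a \<otimes> y \<in> scaled R a Z <+> V'"
      then obtain s v where sv: "s \<in> scaled R a Z" "v \<in> V'" "a \<otimes> y = s \<oplus> v" by (rule set_add_memE)
      then obtain x where x: "x \<in> Z" "s = a \<otimes> x" by (auto simp: scaled_def)
      have c: "x \<in> carrier R" "v \<in> carrier R" using x Z sv V' ideal_closed(1) by blast+
      have "a \<otimes> (y \<ominus> x) = v" using sv(3) x(2) c yc a by algebra
      moreover have yx: "y \<ominus> x \<in> U" using x y Z Y ideal_closed(4)[OF U] by blast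
      ultimately have "y \<ominus> x \<in> V" using iff[OF yx] sv by simp
      then have "y \<ominus> x \<in> Z" using Z by blast
      then have "(y \<ominus> x) \<oplus> x \<in> Z" using x Z ideal_closed(3)[of Z] by blast
      moreover have "(y \<ominus> x) \<oplus> x = y" using c yc by algebra
      ultimately show False using y by simp
    qed
    have "scaled R a Z <+> V' \<subseteq> scaled R a Y <+> V'"
      using XY by (intro set_add_mono) (auto simp: scaled_def)
    then show "scaled R a Z <+> V' \<subset> scaled R a Y <+> V'" using 1 2 by blast
  qed
qed

text \<open>The cyclic module generated by the class of \<open>a\<close> is
  \<open>R/(V' : a)\<close>, a quotient of \<open>R/V\<close> because \<open>V\<close> multiplies
  \<open>a\<close> into \<open>V'\<close>.\<close>

lemma (in cring) quot_length_cyclic: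
  assumes V: "ideal V R" and V': "ideal V' R" and a: "a \<in> carrier R" and "\<And>v. v \<in> V \<Longrightarrow> a \<otimes> v \<in> V'"
  shows "quot_length R (scaled R a (carrier R) <+> V') V' \<le> quot_length R (carrier R) V"
proof -
  have "quot_length R (scaled R a (carrier R) <+> V') V' = quot_length R (carrier R) (colon R V' a)"
    by (rule quot_length_scaled[OF colon_ideal[OF V' a] oneideal V' a]) (auto simp: colon_def)
  also have "\<dots> \<le> quot_length R (carrier R) V"
    using assms ideal_closed(1)[OF V] by (intro quot_length_mono) (auto simp: colon_def)
  finally show ?thesis .
qed

section \<open>Multigraded families of ideals\<close>

definition bump :: "nat \<Rightarrow> nat \<Rightarrow> (nat \<Rightarrow> nat) \<Rightarrow> nat \<Rightarrow> nat" where
  "bump j k r = r(j := r j + k)"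

lemma bump_0 [simp]: "bump j 0 r = r"
  and bump_bump: "bump j k (bump j l r) = bump j (k + l) r"
  and bump_commute: "bump i k (bump j l r) = bump j l (bump i k r)"
  and bump_same: "bump j k r j = r j + k"
  by (auto simp: bump_def fun_eq_iff)

text \<open>\<open>U r\<close> stands for the component of multidegree \<open>r\<close> of a graded
  submodule. Components stay ideals of \<open>R\<close>, and the degree is carried by the index
  alone. Multidegrees are total functions, so one type serves any number of variables.\<close>

type_synonym 'a graded = "(nat \<Rightarrow> nat) \<Rightarrow> 'a set"

definition family :: "('a, 'b) ring_scheme \<Rightarrow> 'a graded \<Rightarrow> bool" where
  "family R U \<longleftrightarrow> (\<forall>r. ideal (U r) R)"

text \<open>A pair \<open>(x, j)\<close> acts as multiplication by \<open>x\<close>, raising the \<open>j\<close>-th degree by one.\<close>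

definition stable :: "('a, 'b) ring_scheme \<Rightarrow> ('a \<times> nat) list \<Rightarrow> 'a graded \<Rightarrow> bool" where
  "stable R S U \<longleftrightarrow> (\<forall>x j r u. (x, j) \<in> set S \<longrightarrow> u \<in> U r \<longrightarrow> x \<otimes>\<^bsub>R\<^esub> u \<in> U (bump j 1 r))"

definition subfamily ::
  "('a, 'b) ring_scheme \<Rightarrow> ('a \<times> nat) list \<Rightarrow> 'a graded \<Rightarrow> 'a graded
    \<Rightarrow> 'a graded \<Rightarrow> bool" where
  "subfamily R S V U W \<longleftrightarrow> family R W \<and> stable R S W \<and> (\<forall>r. V r \<subseteq> W r \<and> W r \<subseteq> U r)"

text \<open>For stable \<open>V\<close> and \<open>U\<close> with \<open>V r \<subseteq> U r\<close>
  this is the ascending chain condition on homogeneous submodules of the graded module with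
  components \<open>U r / V r\<close>, over the polynomial ring with one variable for each entry of
  \<open>S\<close>.\<close>

definition family_acc ::
  "('a, 'b) ring_scheme \<Rightarrow> ('a \<times> nat) list \<Rightarrow> 'a graded \<Rightarrow> 'a graded \<Rightarrow> bool" where
  "family_acc R S V U \<longleftrightarrow>
     (\<forall>W. (\<forall>t. subfamily R S V U (W t)) \<longrightarrow> (\<forall>t r. W t r \<subseteq> W (Suc t) r) \<longrightarrow> (\<exists>t0. \<forall>t\<ge>t0. W t = W t0))"

lemma family_accD:
  assumes "family_acc R S V U" "\<And>t. subfamily R S V U (W t)" "\<And>t r. W t r \<subseteq> W (Suc t) r"
  obtains t0 where "\<And>t. t \<ge> t0 \<Longrightarrow> W t = W t0"
  using assms unfolding family_acc_def by blast

text \<open>Passage to a subquotient only removes candidates for the chain.\<close>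

lemma family_acc_mono:
  assumes "family_acc R S V U" "\<And>r. V r \<subseteq> V' r" "\<And>r. U' r \<subseteq> U r"
  shows "family_acc R S V' U'"
proof -
  have "subfamily R S V U W" if "subfamily R S V' U' W" for W
    using that assms(2,3) unfolding subfamily_def by (meson subset_trans)
  then show ?thesis using assms(1) unfolding family_acc_def by simp
qed

lemma familyD: "family R U \<Longrightarrow> ideal (U r) R"
  by (simp add: family_def)

lemma stableD: "stable R S U \<Longrightarrow> (x, j) \<in> set S \<Longrightarrow> u \<in> U r \<Longrightarrow> x \<otimes>\<^bsub>R\<^esub> u \<in> U (bump j 1 r)"
  by (simp add: stable_def)

subsection \<open>The basis theorem\<close>

lemma (in noetherian_ring) ideal_seq_stabilises:
  assumes "\<And>t. ideal (W t) R" "\<And>t. W t \<subseteq> W (Suc t)"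
  obtains t0 where "\<And>t::nat. t \<ge> t0 \<Longrightarrow> W t = W t0"
proof -
  have mono: "W s \<subseteq> W t" if "s \<le> t" for s t
    using assms(2) that by (rule lift_Suc_mono_le)
  have "subset.chain {I. ideal I R} (range W)"
    unfolding subset_chain_def using assms(1) mono nat_le_linear by blast
  then have "\<Union> (range W) \<in> range W" by (intro ideal_chain_is_trivial) auto
  then obtain t0 where t0: "\<Union> (range W) = W t0" by blast
  have "W t = W t0" if "t \<ge> t0" for t
    using mono[OF that] t0 by blast
  then show ?thesis using that by blast
qed

text \<open>The ring itself in multidegree zero: the base case of the basis theorem, where no
  operators act and the chain condition is that of \<open>R\<close>.\<close>

definition concentrated :: "('a, 'b) ring_scheme \<Rightarrow> 'a graded" where
  "concentrated R r = (if r = (\<lambda>_. 0) then carrier R else {\<zero>\<^bsub>R\<^esub>})"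

lemma (in noetherian_ring) family_acc_concentrated:
  "family_acc R [] (\<lambda>_. {\<zero>}) (concentrated R)"
  unfolding family_acc_def
proof (intro allI impI)
  fix W assume W: "\<forall>t. subfamily R [] (\<lambda>_. {\<zero>}) (concentrated R) (W t)" and inc: "\<forall>t r. W t r \<subseteq> W (Suc t) r"
  have "ideal (W t (\<lambda>_. 0)) R" for t using W by (simp add: subfamily_def family_def)
  then obtain t0 where t0: "\<And>t. t \<ge> t0 \<Longrightarrow> W t (\<lambda>_. 0) = W t0 (\<lambda>_. 0)"
    using ideal_seq_stabilises[of "\<lambda>t. W t (\<lambda>_. 0)"] inc by blast
  have "W t r = {\<zero>}" if "r \<noteq> (\<lambda>_. 0)" for t r
  proof -
    have "{\<zero>} \<subseteq> W t r" "W t r \<subseteq> concentrated R r" using W by (simp_all add: subfamily_def)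
    then show ?thesis using that by (auto simp: concentrated_def)
  qed
  then have "W t = W t0" if "t \<ge> t0" for t
    using t0[OF that] by (metis ext)
  then show "\<exists>t0. \<forall>t\<ge>t0. W t = W t0" by blast
qed

text \<open>The sum of \<open>x^i U\<close> over \<open>i < k\<close>, that is, the elements of
  degree below \<open>k\<close> in \<open>x\<close>. The test \<open>k \<le> r j\<close> excludes
  the powers for which the subtraction \<open>r j - k\<close> would be cut off at 0.\<close>

fun partial :: "('a, 'b) ring_scheme \<Rightarrow> 'a \<Rightarrow> nat \<Rightarrow> 'a graded \<Rightarrow> nat \<Rightarrow> 'a graded" where
  "partial R x j U 0 r = {\<zero>\<^bsub>R\<^esub>}"
| "partial R x j U (Suc k) r = partial R x j U k r <+>\<^bsub>R\<^esub>
     (if k \<le> r j then scaled R (x [^]\<^bsub>R\<^esub> k) (U (r(j := r j - k))) else {\<zero>\<^bsub>R\<^esub>})"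

declare partial.simps(2) [simp del]

text \<open>The family \<open>\<Sum>\<^sub>k x\<^sup>k U\<close>, with \<open>x\<close> placed in degree \<open>j\<close>.\<close>

definition adjoin :: "('a, 'b) ring_scheme \<Rightarrow> 'a \<Rightarrow> nat \<Rightarrow> 'a graded \<Rightarrow> 'a graded" where
  "adjoin R x j U r = partial R x j U (Suc (r j)) r"

context cring
begin

lemma partial_Suc_ideal:
  assumes "family R U" "x \<in> carrier R"
  shows "ideal (if k \<le> r j then scaled R (x [^] k) (U (r(j := r j - k))) else {\<zero>}) R"
  using scaled_ideal[OF familyD[OF assms(1)]] assms(2) zeroideal by simp

lemma partial_ideal:
  assumes "family R U" "x \<in> carrier R"
  shows "ideal (partial R x j U k r) R"
proof (induction k)
  case (Suc k)
  then show ?case using add_ideals[OF Suc partial_Suc_ideal[OF assms]] by (simp add: partial.simps(2))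
qed (simp add: zeroideal)

lemma partial_mono:
  assumes "family R U" "x \<in> carrier R" "k \<le> l"
  shows "partial R x j U k r \<subseteq> partial R x j U l r"
proof -
  have "partial R x j U k r \<subseteq> partial R x j U (Suc k) r" for k
    unfolding partial.simps(2)
    by (rule set_add_subset_l[OF partial_ideal[OF assms(1,2)] partial_Suc_ideal[OF assms(1,2)]])
  then show ?thesis using assms(3) by (rule lift_Suc_mono_le)
qed

lemma partial_Suc_memI:
  assumes "family R U" "x \<in> carrier R" "k \<le> r j" "v \<in> U (r(j := r j - k))"
  shows "x [^] k \<otimes> v \<in> partial R x j U (Suc k) r"
proof -
  have "x [^] k \<otimes> v \<in> scaled R (x [^] k) (U (r(j := r j - k)))" using assms(4) by (auto simp: scaled_def)
  then show ?thesis
    using set_add_subset_r[OF partial_ideal[OF assms(1,2)] partial_Suc_ideal[OF assms(1,2), of k r j], of j k r] assms(3)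
    by (auto simp: partial.simps(2))
qed

lemma partial_Suc_memE:
  assumes "family R U" "x \<in> carrier R" "w \<in> partial R x j U (Suc k) r"
  obtains "w \<in> partial R x j U k r"
  | e v where "e \<in> partial R x j U k r" "k \<le> r j" "v \<in> U (r(j := r j - k))" "w = e \<oplus> x [^] k \<otimes> v"
proof -
  obtain e s where es: "e \<in> partial R x j U k r" "w = e \<oplus> s"
    "s \<in> (if k \<le> r j then scaled R (x [^] k) (U (r(j := r j - k))) else {\<zero>})"
    using assms(3) unfolding partial.simps(2) by (rule set_add_memE)
  show ?thesis
  proof (cases "k \<le> r j")
    case True
    then show ?thesis using es that(2) by (auto simp: scaled_def)
  next
    case False
    then have "w = e" using es ideal_closed(1)[OF partial_ideal[OF assms(1,2)], of j k r] by auto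
    then show ?thesis using es that(1) by simp
  qed
qed

lemma partial_le_adjoin:
  assumes "family R U" "x \<in> carrier R"
  shows "partial R x j U k r \<subseteq> adjoin R x j U r"
proof (cases "k \<le> Suc (r j)")
  case True
  then show ?thesis unfolding adjoin_def by (rule partial_mono[OF assms])
next
  case False
  \<comment> \<open>From \<open>Suc (r j)\<close> on, the guard lets only the zero ideal be
    added.\<close>
  have "partial R x j U (Suc (r j) + l) r \<subseteq> adjoin R x j U r" for l
  proof (induction l)
    case (Suc l)
    show ?case
    proof
      fix w assume "w \<in> partial R x j U (Suc (r j) + Suc l) r"
      then have "w \<in> partial R x j U (Suc (Suc (r j) + l)) r" by simp
      then show "w \<in> adjoin R x j U r"
        by (rule partial_Suc_memE[OF assms]) (use Suc in auto)
    qed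
  qed (simp add: adjoin_def)
  from this[of "k - Suc (r j)"] show ?thesis using False by simp
qed

lemma partial_mult:
  assumes "family R U" "x \<in> carrier R" "w \<in> partial R x j U k r"
  shows "x \<otimes> w \<in> partial R x j U (Suc k) (bump j 1 r)"
  using assms(3)
proof (induction k arbitrary: w)
  case 0
  then show ?case
    using assms(2) ideal_closed(2)[OF partial_ideal[OF assms(1,2), of j "Suc 0" "bump j 1 r"]]
    by simp
next
  case (Suc k)
  note id = partial_ideal[OF assms(1,2)]
  have up: "x \<otimes> e \<in> partial R x j U (Suc (Suc k)) (bump j 1 r)" if "e \<in> partial R x j U k r" for e
    using Suc.IH[OF that] partial_mono[OF assms(1,2), of "Suc k" "Suc (Suc k)" j "bump j 1 r"] by auto
  from Suc.prems show ?case
  proof (rule partial_Suc_memE[OF assms(1,2)])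
    assume "w \<in> partial R x j U k r"
    then show ?thesis by (rule up)
  next
    fix e v assume e: "e \<in> partial R x j U k r" "k \<le> r j" "v \<in> U (r(j := r j - k))" "w = e \<oplus> x [^] k \<otimes> v"
    have c: "e \<in> carrier R" "v \<in> carrier R"
      using ideal_closed(8)[OF id e(1)] ideal_closed(8)[OF familyD[OF assms(1)] e(3)] .
    have "(bump j 1 r)(j := bump j 1 r j - Suc k) = r(j := r j - k)"
      by (simp add: bump_def fun_eq_iff)
    then have "x [^] Suc k \<otimes> v \<in> partial R x j U (Suc (Suc k)) (bump j 1 r)"
      using e by (intro partial_Suc_memI[OF assms(1,2)]) (simp_all add: bump_same)
    moreover have "x \<otimes> w = x \<otimes> e \<oplus> x [^] Suc k \<otimes> v"
      using c assms(2) e(4) by (simp add: r_distr m_ac)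
    ultimately show ?thesis using ideal_closed(3)[OF id] up[OF e(1)] by simp
  qed
qed

lemma partial_stable:
  assumes "family R U" "x \<in> carrier R" "stable R S U" "(y, i) \<in> set S" "y \<in> carrier R"
    and "w \<in> partial R x j U k r"
  shows "y \<otimes> w \<in> partial R x j U k (bump i 1 r)"
  using assms(6)
proof (induction k arbitrary: w)
  case 0
  then show ?case using assms(5) by simp
next
  case (Suc k)
  note id = partial_ideal[OF assms(1,2)]
  have up: "y \<otimes> e \<in> partial R x j U (Suc k) (bump i 1 r)" if "e \<in> partial R x j U k r" for e
    using Suc.IH[OF that] partial_mono[OF assms(1,2), of "k" "Suc k" j "bump i 1 r"] by auto
  from Suc.prems show ?case
  proof (rule partial_Suc_memE[OF assms(1,2)])
    assume "w \<in> partial R x j U k r"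
    then show ?thesis by (rule up)
  next
    fix e v assume e: "e \<in> partial R x j U k r" "k \<le> r j" "v \<in> U (r(j := r j - k))" "w = e \<oplus> x [^] k \<otimes> v"
    have c: "e \<in> carrier R" "v \<in> carrier R"
      using ideal_closed(8)[OF id e(1)] ideal_closed(8)[OF familyD[OF assms(1)] e(3)] .
    \<comment> \<open>For \<open>i = j\<close>, raising and lowering commute only because
      \<open>k \<le> r j\<close>.\<close>
    have "(bump i 1 r)(j := bump i 1 r j - k) = bump i 1 (r(j := r j - k))"
      using e(2) by (auto simp add: bump_def fun_eq_iff)
    then have "y \<otimes> v \<in> U ((bump i 1 r)(j := bump i 1 r j - k))"
      using stableD[OF assms(3), OF assms(4), OF e(3)] by simp
    then have "x [^] k \<otimes> (y \<otimes> v) \<in> partial R x j U (Suc k) (bump i 1 r)"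
      using e(2) by (intro partial_Suc_memI[OF assms(1,2)]) (auto simp: bump_def)
    moreover have "y \<otimes> w = y \<otimes> e \<oplus> x [^] k \<otimes> (y \<otimes> v)"
      using c assms(2,5) e(4) by (simp add: r_distr m_ac)
    ultimately show ?thesis using ideal_closed(3)[OF id] up[OF e(1)] by simp
  qed
qed

lemma adjoin_family: "family R U \<Longrightarrow> x \<in> carrier R \<Longrightarrow> family R (adjoin R x j U)"
  unfolding family_def[of R "adjoin R x j U"] adjoin_def using partial_ideal by blast

lemma adjoin_stable:
  assumes "family R U" "x \<in> carrier R" "stable R S U" "\<And>y i. (y, i) \<in> set S \<Longrightarrow> y \<in> carrier R"
  shows "stable R ((x, j) # S) (adjoin R x j U)"
  unfolding stable_def
proof (intro allI impI)
  fix y i r w assume yi: "(y, i) \<in> set ((x, j) # S)" and w: "w \<in> adjoin R x j U r"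
  show "y \<otimes> w \<in> adjoin R x j U (bump i 1 r)"
  proof (cases "(y, i) = (x, j)")
    case True
    then show ?thesis using partial_mult[OF assms(1,2) w[unfolded adjoin_def]] by (simp add: adjoin_def bump_same)
  next
    case False
    then have "(y, i) \<in> set S" using yi by auto
    from partial_stable[OF assms(1-3) this assms(4)[OF this] w[unfolded adjoin_def]]
    show ?thesis using partial_le_adjoin[OF assms(1,2)] by blast
  qed
qed

lemma le_adjoin:
  assumes "family R U" "x \<in> carrier R"
  shows "U r \<subseteq> adjoin R x j U r"
proof
  fix u assume u: "u \<in> U r"
  have "x [^] (0::nat) \<otimes> u \<in> partial R x j U (Suc 0) r"
    using u by (intro partial_Suc_memI[OF assms]) auto
  moreover have "u \<in> carrier R" using ideal_closed(8)[OF familyD[OF assms(1)] u] .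
  ultimately show "u \<in> adjoin R x j U r" using partial_le_adjoin[OF assms, of j "Suc 0" r] by auto
qed

text \<open>The coefficients \<open>u\<close> of the leading terms \<open>x\<^sup>k u\<close> of elements of \<open>W\<close>.\<close>

definition leading :: "'a \<Rightarrow> nat \<Rightarrow> 'a graded \<Rightarrow> nat \<Rightarrow> 'a graded \<Rightarrow> 'a graded" where
  "leading x j U k W r = U r \<inter> colon R (W (bump j k r) <+> partial R x j U k (bump j k r)) (x [^] k)"

lemma leading_family:
  assumes "family R U" "x \<in> carrier R" "family R W"
  shows "family R (leading x j U k W)"
  unfolding family_def leading_def
  using assms(2) by (intro allI i_intersect colon_ideal add_ideals familyD[OF assms(1)] familyD[OF assms(3)] partial_ideal[OF assms(1,2)]) simp

lemma leading_memD:
  assumes "u \<in> leading x j U k W r"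
  obtains w e where "u \<in> U r" "w \<in> W (bump j k r)" "e \<in> partial R x j U k (bump j k r)" "x [^] k \<otimes> u = w \<oplus> e"
  using assms by (auto simp: leading_def colon_def elim!: set_add_memE)

lemma leading_memI:
  assumes "family R U" "u \<in> U r" "w \<in> W (bump j k r)" "e \<in> partial R x j U k (bump j k r)" "x [^] k \<otimes> u = w \<oplus> e"
  shows "u \<in> leading x j U k W r"
  using assms(2-) ideal_closed(8)[OF familyD[OF assms(1)] assms(2)]
  by (auto simp: leading_def colon_def intro: set_add_memI)

lemma leading_stable:
  assumes "family R U" "x \<in> carrier R" "family R W" "stable R S W" "stable R S U"
    and S: "\<And>y i. (y, i) \<in> set S \<Longrightarrow> y \<in> carrier R"
  shows "stable R S (leading x j U k W)"
  unfolding stable_def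
proof (intro allI impI)
  fix y i r u assume yi: "(y, i) \<in> set S" and "u \<in> leading x j U k W r"
  then obtain w e where u: "u \<in> U r" "w \<in> W (bump j k r)" "e \<in> partial R x j U k (bump j k r)" "x [^] k \<otimes> u = w \<oplus> e"
    by (elim leading_memD)
  note y = S[OF yi]
  have c: "u \<in> carrier R" "w \<in> carrier R" "e \<in> carrier R"
    using ideal_closed(8)[OF familyD[OF assms(1)] u(1)] ideal_closed(8)[OF familyD[OF assms(3)] u(2)]
      ideal_closed(8)[OF partial_ideal[OF assms(1,2)] u(3)] .
  have "x [^] k \<otimes> (y \<otimes> u) = y \<otimes> (x [^] k \<otimes> u)" using c y assms(2) by (simp add: m_ac)
  also have "\<dots> = y \<otimes> w \<oplus> y \<otimes> e" using c y u(4) by (simp add: r_distr)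
  finally have eq: "x [^] k \<otimes> (y \<otimes> u) = y \<otimes> w \<oplus> y \<otimes> e" .
  show "y \<otimes> u \<in> leading x j U k W (bump i 1 r)"
  proof (rule leading_memI[OF assms(1) _ _ _ eq])
    show "y \<otimes> u \<in> U (bump i 1 r)" by (rule stableD[OF assms(5), OF yi, OF u(1)])
    show "y \<otimes> w \<in> W (bump j k (bump i 1 r))"
      using stableD[OF assms(4), OF yi, OF u(2)] by (simp only: bump_commute[of j k i 1])
    show "y \<otimes> e \<in> partial R x j U k (bump j k (bump i 1 r))"
      using partial_stable[OF assms(1,2,5) yi y u(3)] by (simp only: bump_commute[of j k i 1])
  qed
qed

text \<open>Multiplying \<open>x^k u = w + e\<close> by \<open>x\<close> keeps the coefficient
  \<open>u\<close>; stability of \<open>W\<close> under \<open>(x, j)\<close> keeps the witness in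
  \<open>W\<close>.\<close>

lemma leading_Suc:
  assumes "family R U" "x \<in> carrier R" "family R W" "stable R ((x, j) # S) W"
  shows "leading x j U k W r \<subseteq> leading x j U (Suc k) W r"
proof
  fix u assume "u \<in> leading x j U k W r"
  then obtain w e where u: "u \<in> U r" "w \<in> W (bump j k r)" "e \<in> partial R x j U k (bump j k r)" "x [^] k \<otimes> u = w \<oplus> e"
    by (elim leading_memD)
  have c: "u \<in> carrier R" "w \<in> carrier R" "e \<in> carrier R"
    using ideal_closed(8)[OF familyD[OF assms(1)] u(1)] ideal_closed(8)[OF familyD[OF assms(3)] u(2)]
      ideal_closed(8)[OF partial_ideal[OF assms(1,2)] u(3)] .
  have "x [^] Suc k \<otimes> u = x \<otimes> (x [^] k \<otimes> u)" using c assms(2) by (simp add: m_ac)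
  also have "\<dots> = x \<otimes> w \<oplus> x \<otimes> e" using c assms(2) u(4) by (simp add: r_distr)
  finally have eq: "x [^] Suc k \<otimes> u = x \<otimes> w \<oplus> x \<otimes> e" .
  have b: "bump j 1 (bump j k r) = bump j (Suc k) r" by (simp add: bump_bump)
  show "u \<in> leading x j U (Suc k) W r"
  proof (rule leading_memI[OF assms(1) u(1) _ _ eq])
    show "x \<otimes> w \<in> W (bump j (Suc k) r)" using stableD[OF assms(4), of x j, OF _ u(2)] unfolding b by simp
    show "x \<otimes> e \<in> partial R x j U (Suc k) (bump j (Suc k) r)"
      using partial_mult[OF assms(1,2) u(3)] unfolding b .
  qed
qed

lemma leading_mono:
  assumes "\<And>r. W r \<subseteq> W' r"
  shows "leading x j U k W r \<subseteq> leading x j U k W' r"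
proof -
  have "W (bump j k r) <+> partial R x j U k (bump j k r) \<subseteq> W' (bump j k r) <+> partial R x j U k (bump j k r)"
    using assms by (intro set_add_mono) auto
  then show ?thesis unfolding leading_def colon_def by blast
qed

text \<open>An element of \<open>W'\<close> of degree at most \<open>k\<close> in \<open>x\<close>
  has its coefficient of \<open>x^k\<close> among those of \<open>W\<close>; subtracting the
  matching element of \<open>W\<close> leaves one of smaller degree, and induction applies. As
  \<open>x\<close> is an element of \<open>R\<close>, coefficients are not unique, which is why
  \<open>leading\<close> works modulo \<open>partial\<close>.\<close>

lemma leading_determines:
  assumes "family R U" "x \<in> carrier R" "family R W" "family R W'"
    and le: "\<And>r. W r \<subseteq> W' r" and le': "\<And>r. W' r \<subseteq> adjoin R x j U r"
    and eq: "\<And>k. leading x j U k W' = leading x j U k W"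
  shows "W' = W"
proof -
  have "W' r \<inter> partial R x j U k r \<subseteq> W r" for k r
  proof (induction k)
    case 0
    then show ?case using ideal_closed(2)[OF familyD[OF assms(3)], of r] by auto
  next
    case (Suc k)
    show ?case
    proof
      fix w assume w: "w \<in> W' r \<inter> partial R x j U (Suc k) r"
      then have "w \<in> partial R x j U (Suc k) r" by simp
      then show "w \<in> W r"
      proof (rule partial_Suc_memE[OF assms(1,2)])
        assume "w \<in> partial R x j U k r"
        then show ?thesis using w Suc by blast
      next
        fix e v assume e: "e \<in> partial R x j U k r" "k \<le> r j" "v \<in> U (r(j := r j - k))" "w = e \<oplus> x [^] k \<otimes> v"
        have b: "bump j k (r(j := r j - k)) = r" using e(2) by (simp add: bump_def fun_eq_iff)
        note id = partial_ideal[OF assms(1,2)]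
        have c: "e \<in> carrier R" "v \<in> carrier R" "w \<in> carrier R"
          using ideal_closed(8)[OF id e(1)] ideal_closed(8)[OF familyD[OF assms(1)] e(3)]
            ideal_closed(8)[OF id, of w j "Suc k" r] w by simp_all
        have "x [^] k \<otimes> v = w \<oplus> \<ominus> e"
        proof -
          have "x [^] k \<otimes> v \<in> carrier R" using c assms(2) by simp
          then show ?thesis using e(4) c by algebra
        qed
        then have "v \<in> leading x j U k W' (r(j := r j - k))"
          using w ideal_closed(5)[OF id e(1)] e(3) by (intro leading_memI[OF assms(1)]) (simp_all add: b)
        then have "v \<in> leading x j U k W (r(j := r j - k))" by (simp only: eq)
        then obtain w' e' where w': "w' \<in> W r" "e' \<in> partial R x j U k r" "x [^] k \<otimes> v = w' \<oplus> e'"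
          by (elim leading_memD) (simp add: b)
        have c': "w' \<in> carrier R" "e' \<in> carrier R"
          using ideal_closed(8)[OF familyD[OF assms(3)] w'(1)] ideal_closed(8)[OF id w'(2)] .
        have "w \<ominus> w' = e \<oplus> e'" using e(4) w'(3) c c' by algebra
        then have "w \<ominus> w' \<in> partial R x j U k r" using ideal_closed(3)[OF id e(1) w'(2)] by simp
        moreover have "w \<ominus> w' \<in> W' r"
          using ideal_closed(4)[OF familyD[OF assms(4)], of w r w'] w w' le by blast
        ultimately have "w \<ominus> w' \<in> W r" using Suc by blast
        then have "(w \<ominus> w') \<oplus> w' \<in> W r" using ideal_closed(3)[OF familyD[OF assms(3)] _ w'(1)] by blast
        moreover have "(w \<ominus> w') \<oplus> w' = w" using c c' by algebra
        ultimately show ?thesis by simp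
      qed
    qed
  qed
  then have "W' r \<subseteq> W r" for r
    using le'[of r] unfolding adjoin_def by blast
  then show ?thesis using le by (intro ext) blast
qed

text \<open>Hilbert's basis theorem, with the argument run inside families of ideals of \<open>R\<close>.\<close>

lemma family_acc_adjoin:
  assumes U: "family R U" "stable R S U" "family_acc R S (\<lambda>_. {\<zero>}) U" and x: "x \<in> carrier R"
    and S: "\<And>y i. (y, i) \<in> set S \<Longrightarrow> y \<in> carrier R"
  shows "family_acc R ((x, j) # S) (\<lambda>_. {\<zero>}) (adjoin R x j U)"
  unfolding family_acc_def
proof (intro allI impI)
  fix W assume W: "\<forall>t. subfamily R ((x, j) # S) (\<lambda>_. {\<zero>}) (adjoin R x j U) (W t)"
    and inc: "\<forall>t r. W t r \<subseteq> W (Suc t) r"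
  have Wf: "family R (W t)" "stable R ((x, j) # S) (W t)" "stable R S (W t)" "\<And>r. W t r \<subseteq> adjoin R x j U r" for t
    using W by (auto simp: subfamily_def stable_def)
  have Wmono: "W s r \<subseteq> W t r" if "s \<le> t" for s t r
    using lift_Suc_mono_le[of "\<lambda>t. W t r", OF _ that] inc by simp
  define L where "L k t = leading x j U k (W t)" for k t
  have Lf: "subfamily R S (\<lambda>_. {\<zero>}) U (L k t)" for k t
    unfolding subfamily_def L_def
  proof (intro conjI allI)
    show F: "family R (leading x j U k (W t))" by (rule leading_family[OF U(1) x Wf(1)])
    show "stable R S (leading x j U k (W t))" by (rule leading_stable[OF U(1) x Wf(1,3) U(2) S])
    show "{\<zero>} \<subseteq> leading x j U k (W t) r" for r using ideal_closed(2)[OF familyD[OF F]] by simp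
    show "leading x j U k (W t) r \<subseteq> U r" for r unfolding leading_def by blast
  qed
  have Lk: "L k t r \<subseteq> L (Suc k) t r" for k t r
    unfolding L_def by (rule leading_Suc[OF U(1) x Wf(1,2)])
  have Lt: "L k s r \<subseteq> L k t r" if "s \<le> t" for k s t r
    unfolding L_def using Wmono[OF that] by (rule leading_mono)
  have Lkt: "L k s r \<subseteq> L l t r" if "k \<le> l" "s \<le> t" for k l s t r
  proof -
    have "L k s r \<subseteq> L l s r" using lift_Suc_mono_le[of "\<lambda>k. L k s r", OF _ that(1)] Lk by simp
    then show ?thesis using Lt[OF that(2), of l r] by (rule subset_trans)
  qed
  \<comment> \<open>The leading families grow in both indices, so a stationary diagonal fixes all
    \<open>L k t\<close> with \<open>k\<close> and \<open>t\<close> at least \<open>t0\<close>. Only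
    the finitely many rows \<open>k < t0\<close> remain, and each is stationary on its own.\<close>
  obtain t0 where t0: "\<And>t. t \<ge> t0 \<Longrightarrow> L t t = L t0 t0"
    by (rule family_accD[OF U(3), of "\<lambda>t. L t t"]) (use Lf Lkt in auto)
  have "\<exists>s. \<forall>t\<ge>s. L k t = L k s" for k
  proof -
    obtain s where "\<And>t. t \<ge> s \<Longrightarrow> L k t = L k s"
      by (rule family_accD[OF U(3), of "\<lambda>t. L k t"]) (use Lf Lt in auto)
    then show ?thesis by blast
  qed
  then obtain \<tau> where \<tau>: "\<And>k t. t \<ge> \<tau> k \<Longrightarrow> L k t = L k (\<tau> k)" by metis
  define T where "T = Max (insert t0 (\<tau> ` {..<t0}))"
  have T: "t0 \<le> T" "\<And>k. k < t0 \<Longrightarrow> \<tau> k \<le> T" unfolding T_def by auto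
  have big: "L k t = L t0 t0" if "k \<ge> t0" "t \<ge> t0" for k t
  proof (rule ext, rule antisym)
    fix r
    have "L (max k t) (max k t) r = L t0 t0 r" using t0[of "max k t"] that by simp
    then show "L k t r \<subseteq> L t0 t0 r" using Lkt[of k "max k t" t "max k t" r] by simp
    show "L t0 t0 r \<subseteq> L k t r" by (rule Lkt[OF that])
  qed
  have LT: "L k t = L k T" if "t \<ge> T" for k t
  proof (cases "k < t0")
    case True
    then show ?thesis using \<tau>[of k t] \<tau>[of k T] T(2)[OF True] that by simp
  next
    case False
    then show ?thesis using big[of k t] big[of k T] T(1) that by simp
  qed
  have "W t = W T" if "t \<ge> T" for t
    by (rule leading_determines[OF U(1) x Wf(1)[of T] Wf(1)[of t] Wmono[OF that] Wf(4) LT[OF that, unfolded L_def]])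
  then show "\<exists>t0. \<forall>t\<ge>t0. W t = W t0" by blast
qed

end

section \<open>Functions of Hilbert type\<close>

text \<open>Telescoping \<open>(t+1)^(d+1) - t^(d+1)\<close> and expanding by the binomial theorem
  expresses the sum of the \<open>t^d\<close> through sums of lower powers.\<close>

lemma sum_powers_poly:
  "\<exists>q::real poly. \<forall>k. (\<Sum>t\<le>k. real t ^ d) = poly q (real k)"
proof (induction d rule: less_induct)
  case (less d)
  then obtain q where q: "\<And>i k. i < d \<Longrightarrow> (\<Sum>t\<le>k. real t ^ i) = poly (q i) (real k)" by metis
  define Q where "Q = smult (1 / real (Suc d)) ([:1, 1:] ^ Suc d - (\<Sum>i<d. smult (real (Suc d choose i)) (q i)))"
  have "(\<Sum>t\<le>k. real t ^ d) = poly Q (real k)" for k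
  proof -
    have "real (Suc k) ^ Suc d = (\<Sum>t\<le>k. real (Suc t) ^ Suc d - real t ^ Suc d)"
      by (induction k) simp_all
    also have "\<dots> = (\<Sum>t\<le>k. \<Sum>i\<le>d. real (Suc d choose i) * real t ^ i)"
    proof (rule sum.cong)
      fix t
      have "real (Suc t) ^ Suc d = (real t + 1) ^ Suc d" by (simp add: add.commute)
      also have "\<dots> = (\<Sum>i\<le>Suc d. real (Suc d choose i) * real t ^ i)"
        using binomial_ring[of "real t" 1 "Suc d"] by simp
      also have "\<dots> = (\<Sum>i\<le>d. real (Suc d choose i) * real t ^ i) + real t ^ Suc d"
        by (simp only: sum.atMost_Suc binomial_n_n of_nat_1 mult_1)
      finally show "real (Suc t) ^ Suc d - real t ^ Suc d = (\<Sum>i\<le>d. real (Suc d choose i) * real t ^ i)"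
        by simp
    qed simp
    also have "\<dots> = (\<Sum>i\<le>d. real (Suc d choose i) * (\<Sum>t\<le>k. real t ^ i))"
      by (subst sum.swap) (simp add: sum_distrib_left)
    also have "\<dots> = (\<Sum>i<d. real (Suc d choose i) * (\<Sum>t\<le>k. real t ^ i)) + real (Suc d) * (\<Sum>t\<le>k. real t ^ d)"
      by (simp add: lessThan_Suc_atMost[symmetric] del: binomial_Suc_Suc)
    finally have "real (Suc d) * (\<Sum>t\<le>k. real t ^ d)
        = real (Suc k) ^ Suc d - (\<Sum>i<d. real (Suc d choose i) * poly (q i) (real k))"
      using q by (simp del: binomial_Suc_Suc power_Suc)
    then have "(\<Sum>t\<le>k. real t ^ d)
        = (real (Suc k) ^ Suc d - (\<Sum>i<d. real (Suc d choose i) * poly (q i) (real k))) / real (Suc d)"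
      by (simp add: field_simps del: binomial_Suc_Suc power_Suc)
    then show ?thesis
      by (simp add: Q_def poly_sum poly_power add.commute del: binomial_Suc_Suc power_Suc)
  qed
  then show ?case by blast
qed

lemma sum_poly_poly:
  fixes p :: "real poly"
  obtains q where "\<And>k. (\<Sum>t\<le>k. poly p (real t)) = poly q (real k)"
proof -
  obtain s :: "nat \<Rightarrow> real poly" where s: "\<And>d k. (\<Sum>t\<le>k. real t ^ d) = poly (s d) (real k)"
    using sum_powers_poly by metis
  have "(\<Sum>t\<le>k. poly p (real t)) = poly (\<Sum>i\<le>degree p. smult (coeff p i) (s i)) (real k)" for k
  proof -
    have "(\<Sum>t\<le>k. poly p (real t)) = (\<Sum>t\<le>k. \<Sum>i\<le>degree p. coeff p i * real t ^ i)"
      by (simp add: poly_altdef)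
    also have "\<dots> = (\<Sum>i\<le>degree p. coeff p i * (\<Sum>t\<le>k. real t ^ i))"
      by (subst sum.swap) (simp add: sum_distrib_left)
    finally show ?thesis by (simp add: s poly_sum)
  qed
  then show ?thesis using that by blast
qed

text \<open>Nonnegativity is required at every argument, polynomiality only far out: partial sums
  starting at 0 preserve both, and the irregular early values end up in the constant term.\<close>

definition evpoly :: "(nat \<Rightarrow> real) \<Rightarrow> bool" where
  "evpoly g \<longleftrightarrow> (\<forall>k. 0 \<le> g k) \<and> (\<exists>p N. \<forall>k\<ge>N. g k = poly p (real k))"

lemma evpolyI: "(\<And>k. 0 \<le> g k) \<Longrightarrow> (\<And>k. k \<ge> N \<Longrightarrow> g k = poly p (real k)) \<Longrightarrow> evpoly g"
  unfolding evpoly_def by blast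

lemma evpoly_indicator: "evpoly (\<lambda>k. if k = b then 1 else 0)"
  unfolding evpoly_def by (intro conjI exI[of _ 0] exI[of _ "Suc b"]) auto

lemma evpoly_sum:
  assumes "evpoly g"
  shows "evpoly (\<lambda>k. \<Sum>t\<le>k. g t)"
proof -
  obtain p N where p: "\<And>k. k \<ge> N \<Longrightarrow> g k = poly p (real k)" and pos: "\<And>k. 0 \<le> g k"
    using assms unfolding evpoly_def by blast
  obtain q where q: "\<And>k. (\<Sum>t\<le>k. poly p (real t)) = poly q (real k)" by (rule sum_poly_poly[of p]) blast
  define c where "c = (\<Sum>t<N. g t - poly p (real t))"
  have eq: "(\<Sum>t\<le>k. g t) = poly (q + [:c:]) (real k)" if "k \<ge> N" for k
  proof -
    have "(\<Sum>t\<le>k. g t - poly p (real t)) = (\<Sum>t<N. g t - poly p (real t))"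
      by (rule sum.mono_neutral_right) (use that p in auto)
    then show ?thesis using q[of k] by (simp add: sum_subtractf c_def)
  qed
  show ?thesis by (rule evpolyI[OF sum_nonneg[OF pos] eq])
qed

lemma evpoly_shift_sum:
  assumes "evpoly g"
  shows "evpoly (\<lambda>k. \<Sum>t<k. g t)"
proof -
  obtain p N where p: "\<And>k. k \<ge> N \<Longrightarrow> (\<Sum>t\<le>k. g t) = poly p (real k)"
    using evpoly_sum[OF assms] unfolding evpoly_def by blast
  have eq: "(\<Sum>t<k. g t) = poly (pcompose p [:-1, 1:]) (real k)" if "k \<ge> Suc N" for k
  proof -
    obtain l where l: "k = Suc l" "l \<ge> N" using \<open>k \<ge> Suc N\<close> by (cases k) auto
    then have "(\<Sum>t<k. g t) = (\<Sum>t\<le>l. g t)" by (simp only: lessThan_Suc_atMost)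
    then show ?thesis using p[OF l(2)] l(1) by (simp add: poly_pcompose)
  qed
  have pos: "0 \<le> g k" for k using assms by (simp add: evpoly_def)
  show ?thesis by (rule evpolyI[OF sum_nonneg[OF pos] eq])
qed

text \<open>Selects the multidegrees in \<open>n\<close> variables among total functions: two of
  them agree as soon as their first \<open>n\<close> values do.\<close>

definition supported :: "nat \<Rightarrow> (nat \<Rightarrow> nat) \<Rightarrow> bool" where
  "supported n r \<longleftrightarrow> (\<forall>j\<ge>n. r j = 0)"

text \<open>Separated variables let a sum over one variable act on one factor, and nonnegative
  weights and factors rule out cancellation between summands. A bare polynomial would lose this
  information on signs.\<close>

definition hilbert_type :: "nat \<Rightarrow> ((nat \<Rightarrow> nat) \<Rightarrow> real) \<Rightarrow> bool" where
  "hilbert_type n f \<longleftrightarrow> (\<exists>m w g. (\<forall>i<m. 0 \<le> w i \<and> (\<forall>j<n. evpoly (g i j))) \<and>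
     (\<forall>r. supported n r \<longrightarrow> f r = (\<Sum>i<m::nat. w i * (\<Prod>j<n. g i j (r j)))))"

lemma hilbert_typeI:
  assumes "\<And>i j. i < m \<Longrightarrow> j < n \<Longrightarrow> evpoly (g i j)" "\<And>i. i < m \<Longrightarrow> 0 \<le> w i"
    and "\<And>r. supported n r \<Longrightarrow> f r = (\<Sum>i<m::nat. w i * (\<Prod>j<n. g i j (r j)))"
  shows "hilbert_type n f"
  unfolding hilbert_type_def using assms by blast

lemma hilbert_typeE:
  assumes "hilbert_type n f"
  obtains m w g where "\<And>i j. i < m \<Longrightarrow> j < n \<Longrightarrow> evpoly (g i j)" "\<And>i. i < m \<Longrightarrow> 0 \<le> w i"
    "\<And>r. supported n r \<Longrightarrow> f r = (\<Sum>i<m::nat. w i * (\<Prod>j<n. g i j (r j)))"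
  using assms unfolding hilbert_type_def by blast

lemma hilbert_type_cong:
  assumes "hilbert_type n f" "\<And>r. supported n r \<Longrightarrow> f' r = f r"
  shows "hilbert_type n f'"
  using assms unfolding hilbert_type_def by auto

lemma hilbert_type_0: "hilbert_type n (\<lambda>_. 0)"
  by (rule hilbert_typeI[where m = 0]) auto

lemma hilbert_type_add:
  assumes "hilbert_type n f" "hilbert_type n f'"
  shows "hilbert_type n (\<lambda>r. f r + f' r)"
proof -
  obtain m w g where 1: "\<And>i j. i < m \<Longrightarrow> j < n \<Longrightarrow> evpoly (g i j)" "\<And>i. i < m \<Longrightarrow> 0 \<le> w i"
    "\<And>r. supported n r \<Longrightarrow> f r = (\<Sum>i<m::nat. w i * (\<Prod>j<n. g i j (r j)))" by (rule hilbert_typeE[OF assms(1)]) blast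
  obtain m' w' g' where 2: "\<And>i j. i < m' \<Longrightarrow> j < n \<Longrightarrow> evpoly (g' i j)" "\<And>i. i < m' \<Longrightarrow> 0 \<le> w' i"
    "\<And>r. supported n r \<Longrightarrow> f' r = (\<Sum>i<m'::nat. w' i * (\<Prod>j<n. g' i j (r j)))" by (rule hilbert_typeE[OF assms(2)]) blast
  define G where "G i = (if i < m then g i else g' (i - m))" for i
  define W where "W i = (if i < m then w i else w' (i - m))" for i
  show ?thesis
  proof (rule hilbert_typeI[where m = "m + m'" and w = W and g = G])
    show "evpoly (G i j)" if "i < m + m'" "j < n" for i j
      using 1(1)[of i j] 2(1)[of "i - m" j] that by (simp add: G_def)
    show "0 \<le> W i" if "i < m + m'" for i
      using 1(2)[of i] 2(2)[of "i - m"] that by (simp add: W_def)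
    fix r assume r: "supported n r"
    have "(\<Sum>i<m + m'. W i * (\<Prod>j<n. G i j (r j)))
        = (\<Sum>i<m. W i * (\<Prod>j<n. G i j (r j))) + (\<Sum>i<m'. W (m + i) * (\<Prod>j<n. G (m + i) j (r j)))"
      by (induction m') simp_all
    then show "f r + f' r = (\<Sum>i<m + m'. W i * (\<Prod>j<n. G i j (r j)))"
      using 1(3)[OF r] 2(3)[OF r] by (simp add: W_def G_def)
  qed
qed

lemma hilbert_type_sum:
  assumes "finite F" "\<And>b. b \<in> F \<Longrightarrow> hilbert_type n (f b)"
  shows "hilbert_type n (\<lambda>r. \<Sum>b\<in>F. f b r)"
  using assms by (induction F) (auto intro: hilbert_type_0 hilbert_type_add)

text \<open>A point mass at \<open>b\<close> is a product of one-variable indicators.\<close>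

lemma hilbert_type_finite_support:
  assumes "finite {r. supported n r \<and> f r \<noteq> 0}" "\<And>r. 0 \<le> f r"
  shows "hilbert_type n f"
proof -
  let ?F = "{r. supported n r \<and> f r \<noteq> 0}"
  have "hilbert_type n (\<lambda>r. f b * (\<Prod>j<n. if r j = b j then 1 else 0))" for b
    by (rule hilbert_typeI[where m = 1 and w = "\<lambda>_. f b" and g = "\<lambda>_ j k. if k = b j then 1 else 0"])
      (auto intro: evpoly_indicator assms)
  then have "hilbert_type n (\<lambda>r. \<Sum>b\<in>?F. f b * (\<Prod>j<n. if r j = b j then 1 else 0))"
    by (rule hilbert_type_sum[OF assms(1)])
  then show ?thesis
  proof (rule hilbert_type_cong)
    fix r assume r: "supported n r"
    have "f b * (\<Prod>j<n. if r j = b j then 1 else 0) = (if b = r then f r else 0)" if "b \<in> ?F" for b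
    proof (cases "b = r")
      case False
      then obtain j where "b j \<noteq> r j" by blast
      moreover have "j < n" using calculation r that by (metis (mono_tags, lifting) linorder_not_le mem_Collect_eq supported_def)
      ultimately have "(\<Prod>j<n. if r j = b j then 1 else 0) = (0::real)" by (intro prod_zero) (auto intro!: bexI[of _ j])
      then show ?thesis using False by simp
    qed simp
    then have "(\<Sum>b\<in>?F. f b * (\<Prod>j<n. if r j = b j then 1 else 0)) = (\<Sum>b\<in>?F. if b = r then f r else 0)"
      by (rule sum.cong[OF refl])
    also have "\<dots> = f r" using assms(1) r by simp
    finally show "f r = (\<Sum>b\<in>?F. f b * (\<Prod>j<n. if r j = b j then 1 else 0))" by simp
  qed
qed

lemma supported_upd: "supported n r \<Longrightarrow> j < n \<Longrightarrow> supported n (r(j := t))"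
  by (auto simp: supported_def)

lemma prod_fun_upd:
  fixes r :: "nat \<Rightarrow> 'b" and g :: "nat \<Rightarrow> 'b \<Rightarrow> real"
  assumes "j < n"
  shows "(\<Prod>l<n. g l ((r(j := t)) l)) = g j t * (\<Prod>l\<in>{..<n} - {j}. g l (r l))"
  using assms by (subst prod.remove[of _ j]) auto

text \<open>Summing over variable \<open>j\<close> changes only the \<open>j\<close>-th factor. The
  index set \<open>A k\<close> is left open because \<open>{..k}\<close> arises from cokernels and
  \<open>{..<k}\<close> from filtrations by powers of an ideal.\<close>

lemma hilbert_type_cumulative_general:
  assumes "hilbert_type n f" "j < n"
    and C: "\<And>g. evpoly g \<Longrightarrow> evpoly (\<lambda>k. \<Sum>t\<in>A k. g t)"
  shows "hilbert_type n (\<lambda>r. \<Sum>t\<in>A (r j). f (r(j := t)))"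
proof -
  obtain m w g where 1: "\<And>i j. i < m \<Longrightarrow> j < n \<Longrightarrow> evpoly (g i j)" "\<And>i. i < m \<Longrightarrow> 0 \<le> w i"
    "\<And>r. supported n r \<Longrightarrow> f r = (\<Sum>i<m::nat. w i * (\<Prod>j<n. g i j (r j)))" by (rule hilbert_typeE[OF assms(1)]) blast
  define G where "G i = (g i)(j := (\<lambda>k. \<Sum>t\<in>A k. g i j t))" for i
  show ?thesis
  proof (rule hilbert_typeI[where m = m and w = w and g = G])
    show "evpoly (G i l)" if "i < m" "l < n" for i l
      using 1(1)[of i] C that assms(2) by (simp add: G_def)
    show "0 \<le> w i" if "i < m" for i using 1(2) that .
    fix r assume r: "supported n r"
    have "(\<Sum>t\<in>A (r j). f (r(j := t))) = (\<Sum>t\<in>A (r j). \<Sum>i<m. w i * (g i j t * (\<Prod>l\<in>{..<n} - {j}. g i l (r l))))"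
      by (simp only: 1(3)[OF supported_upd[OF r assms(2)]] prod_fun_upd[OF assms(2)])
    also have "\<dots> = (\<Sum>i<m. \<Sum>t\<in>A (r j). w i * (g i j t * (\<Prod>l\<in>{..<n} - {j}. g i l (r l))))"
      by (rule sum.swap)
    also have "\<dots> = (\<Sum>i<m. w i * ((\<Sum>t\<in>A (r j). g i j t) * (\<Prod>l\<in>{..<n} - {j}. g i l (r l))))"
      by (simp add: sum_distrib_left sum_distrib_right mult.assoc)
    also have "\<dots> = (\<Sum>i<m. w i * (\<Prod>l<n. G i l (r l)))"
    proof (rule sum.cong)
      fix i
      have "(\<Prod>l<n. G i l (r l)) = G i j (r j) * (\<Prod>l\<in>{..<n} - {j}. G i l (r l))"
        using assms(2) by (subst prod.remove[of _ j]) auto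
      also have "(\<Prod>l\<in>{..<n} - {j}. G i l (r l)) = (\<Prod>l\<in>{..<n} - {j}. g i l (r l))"
        by (rule prod.cong) (auto simp: G_def)
      finally show "w i * ((\<Sum>t\<in>A (r j). g i j t) * (\<Prod>l\<in>{..<n} - {j}. g i l (r l))) = w i * (\<Prod>l<n. G i l (r l))"
        by (simp add: G_def)
    qed simp
    finally show "(\<Sum>t\<in>A (r j). f (r(j := t))) = (\<Sum>i<m. w i * (\<Prod>l<n. G i l (r l)))" .
  qed
qed

lemmas hilbert_type_cumulative = hilbert_type_cumulative_general[OF _ _ evpoly_sum]
lemmas hilbert_type_cumulative_less = hilbert_type_cumulative_general[OF _ _ evpoly_shift_sum]

section \<open>Hilbert functions of families of ideals\<close>

text \<open>Only meaningful for quotients of finite length.\<close>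

definition qlen :: "('a, 'b) ring_scheme \<Rightarrow> 'a set \<Rightarrow> 'a set \<Rightarrow> real" where
  "qlen R U V = real (the_enat (quot_length R U V))"

lemma qlen_self [simp]: "qlen R U U = 0"
  by (simp add: qlen_def zero_enat_def)

lemma qlen_nonneg [simp]: "0 \<le> qlen R U V"
  by (simp add: qlen_def)

lemma (in cring) qlen_add:
  assumes "ideal V R" "ideal W R" "ideal U R" "V \<subseteq> W" "W \<subseteq> U" "quot_length R U V \<noteq> \<infinity>"
  shows "qlen R U V = qlen R U W + qlen R W V"
proof -
  have eq: "quot_length R U V = quot_length R U W + quot_length R W V"
    using assms(1-5) by (rule quot_length_add)
  then obtain a b where "quot_length R U W = enat a" "quot_length R W V = enat b"
    using assms(6) by (cases "quot_length R U W"; cases "quot_length R W V") auto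
  then show ?thesis using eq by (simp add: qlen_def)
qed

lemma quot_length_finite_mono:
  "V' \<subseteq> V \<Longrightarrow> U \<subseteq> U' \<Longrightarrow> quot_length R U' V' \<noteq> \<infinity> \<Longrightarrow> quot_length R U V \<noteq> \<infinity>"
  using quot_length_mono[of V' V U U' R] enat_ord_simps(5) by metis

text \<open>Without operators, \<open>U r\<close> or \<open>V r\<close> may be chosen independently
  in each multidegree, so infinitely many degrees with \<open>U r \<noteq> V r\<close> would give an
  infinite strict chain.\<close>

lemma family_acc_Nil_finite:
  assumes "family R U" "family R V" "\<And>r. V r \<subseteq> U r" "family_acc R [] V U"
  shows "finite {r. U r \<noteq> V r}"
proof (rule ccontr)
  assume "infinite {r. U r \<noteq> V r}"
  then obtain b :: "nat \<Rightarrow> nat \<Rightarrow> nat" where b: "inj b" "range b \<subseteq> {r. U r \<noteq> V r}"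
    using infinite_countable_subset by blast
  define W where "W t r = (if r \<in> b ` {..<t} then U r else V r)" for t r
  have "subfamily R [] V U (W t)" for t
    using assms by (auto simp: subfamily_def family_def stable_def W_def)
  moreover have "W t r \<subseteq> W (Suc t) r" for t r
    using assms(3) by (auto simp: W_def lessThan_Suc)
  ultimately obtain t0 where t0: "\<And>t. t \<ge> t0 \<Longrightarrow> W t = W t0"
    using family_accD[OF assms(4), of W] by metis
  have "b t0 \<notin> b ` {..<t0}" using b(1) by (auto simp: inj_def)
  then have "W t0 (b t0) = V (b t0)" "W (Suc t0) (b t0) = U (b t0)" by (simp_all add: W_def)
  moreover have "W (Suc t0) = W t0" by (rule t0) simp
  moreover have "U (b t0) \<noteq> V (b t0)" using b(2) by blast
  ultimately show False by metis
qed

context cring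
begin

text \<open>The preimage in \<open>U\<close> of the kernel of \<open>x^i\<close> on
  \<open>U/V\<close>.\<close>

definition torsion :: "'a \<Rightarrow> nat \<Rightarrow> 'a graded \<Rightarrow> 'a graded \<Rightarrow> nat \<Rightarrow> 'a graded" where
  "torsion x j V U i r = U r \<inter> colon R (V (bump j i r)) (x [^] i)"

lemma torsion_iff:
  assumes "family R U"
  shows "u \<in> torsion x j V U i r \<longleftrightarrow> u \<in> U r \<and> x [^] i \<otimes> u \<in> V (bump j i r)"
  unfolding torsion_def colon_def using ideal_closed(8)[OF familyD[OF assms]] by blast

lemma torsion_family:
  assumes "family R U" "family R V" "x \<in> carrier R"
  shows "family R (torsion x j V U i)"
  unfolding family_def torsion_def
  using assms(3) by (intro allI i_intersect colon_ideal familyD[OF assms(1)] familyD[OF assms(2)]) simp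

lemma torsion_stable:
  assumes "family R U" "family R V" "x \<in> carrier R" "stable R S U" "stable R S V"
    and S: "\<And>y l. (y, l) \<in> set S \<Longrightarrow> y \<in> carrier R"
  shows "stable R S (torsion x j V U i)"
  unfolding stable_def
proof (intro allI impI)
  fix y l r u assume yl: "(y, l) \<in> set S" and "u \<in> torsion x j V U i r"
  then have u: "u \<in> U r" "x [^] i \<otimes> u \<in> V (bump j i r)" by (simp_all add: torsion_iff[OF assms(1)])
  have c: "u \<in> carrier R" "y \<in> carrier R" using ideal_closed(8)[OF familyD[OF assms(1)] u(1)] S[OF yl] .
  have "y \<otimes> (x [^] i \<otimes> u) \<in> V (bump l 1 (bump j i r))"
    by (rule stableD[OF assms(5), OF yl, OF u(2)])
  moreover have "y \<otimes> (x [^] i \<otimes> u) = x [^] i \<otimes> (y \<otimes> u)" using c assms(3) by (simp add: m_ac)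
  ultimately have "x [^] i \<otimes> (y \<otimes> u) \<in> V (bump j i (bump l 1 r))" by (simp only: bump_commute[of j i l 1])
  moreover have "y \<otimes> u \<in> U (bump l 1 r)" by (rule stableD[OF assms(4), OF yl, OF u(1)])
  ultimately show "y \<otimes> u \<in> torsion x j V U i (bump l 1 r)" by (simp only: torsion_iff[OF assms(1)])
qed

text \<open>Read from right to left, \<open>x\<close> maps layer \<open>Suc i\<close> of the torsion
  into layer \<open>i\<close>. Once the torsion is stationary, the equivalence says that
  \<open>x\<close> is injective modulo it.\<close>

lemma torsion_step:
  assumes "family R U" "x \<in> carrier R" "stable R ((x, j) # S) U" "u \<in> U r"
  shows "x \<otimes> u \<in> torsion x j V U i (bump j 1 r) \<longleftrightarrow> u \<in> torsion x j V U (Suc i) r"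
proof -
  have "u \<in> carrier R" using ideal_closed(8)[OF familyD[OF assms(1)] assms(4)] .
  then have eq: "x [^] i \<otimes> (x \<otimes> u) = x [^] Suc i \<otimes> u" using assms(2) by (simp add: m_assoc)
  have "x \<otimes> u \<in> U (bump j 1 r)" using stableD[OF assms(3), of x j, OF _ assms(4)] by simp
  then show ?thesis using assms(4) by (simp only: torsion_iff[OF assms(1)] eq bump_bump) simp
qed

lemma torsion_Suc:
  assumes "family R U" "family R V" "x \<in> carrier R" "stable R ((x, j) # S) V"
  shows "torsion x j V U i r \<subseteq> torsion x j V U (Suc i) r"
proof
  fix u assume "u \<in> torsion x j V U i r"
  then have u: "u \<in> U r" "x [^] i \<otimes> u \<in> V (bump j i r)" by (simp_all add: torsion_iff[OF assms(1)])
  have c: "u \<in> carrier R" using ideal_closed(8)[OF familyD[OF assms(1)] u(1)] .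
  have "x \<otimes> (x [^] i \<otimes> u) \<in> V (bump j 1 (bump j i r))"
    using stableD[OF assms(4), of x j, OF _ u(2)] by simp
  moreover have "x \<otimes> (x [^] i \<otimes> u) = x [^] Suc i \<otimes> u" using c assms(3) by (simp add: m_ac)
  ultimately show "u \<in> torsion x j V U (Suc i) r"
    using u(1) by (simp add: torsion_iff[OF assms(1)] bump_bump)
qed

lemma torsion_0:
  assumes "family R U" "family R V" "\<And>r. V r \<subseteq> U r"
  shows "torsion x j V U 0 = V"
proof -
  have "u \<in> torsion x j V U 0 r \<longleftrightarrow> u \<in> V r" for r u
    using assms(3)[of r] ideal_closed(8)[OF familyD[OF assms(2)], of u r] ideal_closed(8)[OF familyD[OF assms(1)], of u r]
    by (cases "u \<in> carrier R") (auto simp: torsion_iff[OF assms(1)])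
  then show ?thesis by blast
qed

text \<open>The quotient of \<open>U\<close> by this family is the cokernel of \<open>x\<close> on
  \<open>U/G\<close>. Nothing is multiplied into degree 0 of variable \<open>j\<close>, so
  \<open>G\<close> alone remains there.\<close>

definition image_family :: "'a \<Rightarrow> nat \<Rightarrow> 'a graded \<Rightarrow> 'a graded \<Rightarrow> 'a graded" where
  "image_family x j U G r = (if r j = 0 then G r else scaled R x (U (r(j := r j - 1))) <+> G r)"

lemma image_family_bump: "image_family x j U G (bump j 1 r) = scaled R x (U r) <+> G (bump j 1 r)"
  by (simp add: image_family_def bump_def)

lemma image_family_family:
  assumes "family R U" "family R G" "x \<in> carrier R"
  shows "family R (image_family x j U G)"
  unfolding family_def image_family_def
  using add_ideals[OF scaled_ideal[OF familyD[OF assms(1)] assms(3)] familyD[OF assms(2)]] familyD[OF assms(2)]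
  by simp

lemma le_image_family:
  assumes "family R U" "family R G" "x \<in> carrier R"
  shows "G r \<subseteq> image_family x j U G r"
  unfolding image_family_def
  using set_add_subset_r[OF scaled_ideal[OF familyD[OF assms(1)] assms(3)] familyD[OF assms(2)]] by simp

lemma image_family_le:
  assumes "family R U" "stable R ((x, j) # S) U" "\<And>r. G r \<subseteq> U r"
  shows "image_family x j U G r \<subseteq> U r"
proof (cases "r j = 0")
  case False
  define r' where "r' = r(j := r j - 1)"
  have r: "r = bump j 1 r'" using False by (auto simp: r'_def bump_def)
  have "scaled R x (U r') \<subseteq> U r"
    unfolding r scaled_def using stableD[OF assms(2), of x j] by auto
  then show ?thesis
    unfolding r image_family_bump using familyD[OF assms(1)] assms(3) by (intro set_add_least) auto
qed (simp add: image_family_def assms(3))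

lemma image_family_stable:
  assumes "family R U" "family R G" "x \<in> carrier R" "stable R S U" "stable R S G"
    and S: "\<And>y l. (y, l) \<in> set S \<Longrightarrow> y \<in> carrier R"
  shows "stable R S (image_family x j U G)"
  unfolding stable_def
proof (intro allI impI)
  fix y l r u assume yl: "(y, l) \<in> set S" and u: "u \<in> image_family x j U G r"
  note G = le_image_family[OF assms(1-3)]
  show "y \<otimes> u \<in> image_family x j U G (bump l 1 r)"
  proof (cases "r j = 0")
    case True
    then have "u \<in> G r" using u by (simp add: image_family_def)
    then show ?thesis using stableD[OF assms(5), OF yl] G by blast
  next
    case False
    define r' where "r' = r(j := r j - 1)"
    have r: "r = bump j 1 r'" using False by (auto simp: r'_def bump_def)
    obtain s g where sg: "s \<in> scaled R x (U r')" "g \<in> G r" "u = s \<oplus> g"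
      using u unfolding r image_family_bump by (rule set_add_memE)
    then obtain v where v: "v \<in> U r'" "s = x \<otimes> v" by (auto simp: scaled_def)
    have c: "v \<in> carrier R" "g \<in> carrier R" "y \<in> carrier R"
      using ideal_closed(8)[OF familyD[OF assms(1)] v(1)] ideal_closed(8)[OF familyD[OF assms(2)] sg(2)] S[OF yl] .
    have "y \<otimes> u = x \<otimes> (y \<otimes> v) \<oplus> y \<otimes> g" using c sg(3) v(2) assms(3) by (simp add: r_distr m_ac)
    moreover have "x \<otimes> (y \<otimes> v) \<in> scaled R x (U (bump l 1 r'))"
      using stableD[OF assms(4), OF yl, OF v(1)] by (auto simp: scaled_def)
    moreover have "y \<otimes> g \<in> G (bump j 1 (bump l 1 r'))"
      using stableD[OF assms(5), OF yl, OF sg(2)] by (simp only: r bump_commute[of j 1 l 1])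
    ultimately have "y \<otimes> u \<in> image_family x j U G (bump j 1 (bump l 1 r'))"
      unfolding image_family_bump by (simp only: set_add_memI)
    then show ?thesis by (simp only: r bump_commute[of j 1 l 1])
  qed
qed

text \<open>Injectivity of \<open>x\<close> gives an exact sequence from degree \<open>t\<close> to
  degree \<open>t + 1\<close> in variable \<open>j\<close>: the length grows by that of the cokernel
  at each step, and the sum telescopes.\<close>

lemma qlen_image_family_sum:
  assumes "family R U" "family R G" "x \<in> carrier R" "stable R ((x, j) # S) U" "stable R ((x, j) # S) G"
    and GU: "\<And>r. G r \<subseteq> U r" and fin: "\<And>r. quot_length R (U r) (G r) \<noteq> \<infinity>"
    and inj: "\<And>r u. u \<in> U r \<Longrightarrow> x \<otimes> u \<in> G (bump j 1 r) \<longleftrightarrow> u \<in> G r"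
  shows "qlen R (U r) (G r) = (\<Sum>t\<le>r j. qlen R (U (r(j := t))) (image_family x j U G (r(j := t))))"
proof -
  note ids = familyD[OF assms(1)] familyD[OF assms(2)] familyD[OF image_family_family[OF assms(1-3)]]
  have step: "qlen R (U r) (G r) = qlen R (U r) (image_family x j U G r) + qlen R (image_family x j U G r) (G r)" for r
    using le_image_family[OF assms(1-3)] image_family_le[OF assms(1,4) GU] fin by (intro qlen_add ids) auto
  have "qlen R (U (r(j := k))) (G (r(j := k))) = (\<Sum>t\<le>k. qlen R (U (r(j := t))) (image_family x j U G (r(j := t))))" for k
  proof (induction k)
    case 0
    then show ?case using step[of "r(j := 0)"] by (simp add: image_family_def)
  next
    case (Suc k)
    have b: "r(j := Suc k) = bump j 1 (r(j := k))" by (auto simp: bump_def)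
    have "qlen R (image_family x j U G (r(j := Suc k))) (G (r(j := Suc k))) = qlen R (U (r(j := k))) (G (r(j := k)))"
      unfolding b image_family_bump qlen_def
      by (subst quot_length_scaled[OF ids(2) ids(1) ids(2) assms(3) GU inj]) auto
    then show ?case using step[of "r(j := Suc k)"] Suc unfolding sum.atMost_Suc by linarith
  qed
  from this[of "r j"] show ?thesis by simp
qed

text \<open>
  Induction on the number of operators: the \<open>x\<close>-torsion is filtered by pieces that \<open>x\<close> annihilates,
  and modulo the torsion \<open>x\<close> is injective, so that the Hilbert function is the sum over one variable
  of that of the cokernel of \<open>x\<close>.
\<close>

theorem hilbert_type_family:
  assumes "\<And>x j. (x, j) \<in> set S \<Longrightarrow> x \<in> carrier R \<and> j < n"
    and "family R U" "family R V" "stable R S U" "stable R S V" "\<And>r. V r \<subseteq> U r"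
    and "family_acc R S V U" "\<And>r. quot_length R (U r) (V r) \<noteq> \<infinity>"
  shows "hilbert_type n (\<lambda>r. qlen R (U r) (V r))"
  using assms
proof (induction S arbitrary: U V)
  case Nil
  have "{r. supported n r \<and> qlen R (U r) (V r) \<noteq> 0} \<subseteq> {r. U r \<noteq> V r}" by auto
  then have "finite {r. supported n r \<and> qlen R (U r) (V r) \<noteq> 0}"
    using family_acc_Nil_finite[OF Nil(2,3,6,7)] by (rule finite_subset)
  then show ?case by (rule hilbert_type_finite_support) simp
next
  case (Cons a S)
  obtain x j where a: "a = (x, j)" by (cases a)
  note st = Cons.prems(4,5)[unfolded a]
  have x: "x \<in> carrier R" and j: "j < n" using Cons.prems(1)[of x j] a by auto
  have S: "\<And>y l. (y, l) \<in> set S \<Longrightarrow> y \<in> carrier R \<and> l < n"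
    and S': "\<And>y l. (y, l) \<in> set ((x, j) # S) \<Longrightarrow> y \<in> carrier R"
    using Cons.prems(1) a by (meson list.set_intros)+
  have weak: "stable R S W" if "stable R ((x, j) # S) W" for W
    using that by (simp add: stable_def)
  note acc = Cons.prems(7)[unfolded a]
  define K where "K i = torsion x j V U i" for i
  have K0: "K 0 = V" unfolding K_def by (rule torsion_0[OF Cons.prems(2,3,6)])
  have Kf: "family R (K i)" for i unfolding K_def by (rule torsion_family[OF Cons.prems(2,3) x])
  have Ks: "stable R ((x, j) # S) (K i)" for i
    unfolding K_def by (rule torsion_stable[OF Cons.prems(2,3) x st S'])
  have KU: "K i r \<subseteq> U r" for i r by (auto simp: K_def torsion_def)
  have Kinc: "K i r \<subseteq> K (Suc i) r" for i r
    unfolding K_def by (rule torsion_Suc[OF Cons.prems(2,3) x st(2)])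
  have VK: "V r \<subseteq> K i r" for i r
    using lift_Suc_mono_le[of "\<lambda>i. K i r" 0 i] Kinc K0 by simp
  have Ksub: "subfamily R ((x, j) # S) V U (K i)" for i
    unfolding subfamily_def using Kf Ks VK KU by blast
  obtain t0 where t0: "\<And>t. t \<ge> t0 \<Longrightarrow> K t = K t0"
    using family_accD[OF acc, of K] Ksub Kinc by metis
  have finK: "quot_length R (K i r) (V r) \<noteq> \<infinity>" "quot_length R (U r) (K i r) \<noteq> \<infinity>"
    "quot_length R (K (Suc i) r) (K i r) \<noteq> \<infinity>" for i r
    using Cons.prems(8)[of r] quot_length_finite_mono[of "V r" _ _ "U r" R] VK KU by auto
  have torsion_part: "hilbert_type n (\<lambda>r. qlen R (K i r) (V r))" for i
  proof (induction i)
    case 0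
    then show ?case using hilbert_type_0 by (simp add: K0)
  next
    case (Suc i)
    \<comment> \<open>On this layer \<open>x\<close> acts as zero, so stability under
      \<open>S\<close> already implies stability under \<open>x\<close>, and the chain condition
      descends to fewer operators.\<close>
    have "family_acc R S (K i) (K (Suc i))"
    proof -
      have "subfamily R ((x, j) # S) V U W" if W: "subfamily R S (K i) (K (Suc i)) W" for W
      proof -
        have "x \<otimes> w \<in> W (bump j 1 r)" if "w \<in> W r" for w r
        proof -
          have w: "w \<in> K (Suc i) r" using W that by (auto simp: subfamily_def)
          then have "w \<in> U r" using KU by blast
          then have "x \<otimes> w \<in> K i (bump j 1 r)"
            using w torsion_step[OF Cons.prems(2) x st(1)] by (simp only: K_def)
          then show ?thesis using W by (auto simp: subfamily_def)
        qed
        then have "stable R ((x, j) # S) W" using W by (auto simp: subfamily_def stable_def)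
        moreover have "V r \<subseteq> W r" "W r \<subseteq> U r" for r
          using W VK[of r i] KU[of "Suc i" r] unfolding subfamily_def by (blast, blast)
        ultimately show ?thesis using W unfolding subfamily_def by blast
      qed
      then show ?thesis using acc unfolding family_acc_def by simp
    qed
    then have "hilbert_type n (\<lambda>r. qlen R (K (Suc i) r) (K i r))"
      by (intro Cons.IH S Kf weak[OF Ks] Kinc finK)
    from hilbert_type_add[OF this Suc] show ?case
    proof (rule hilbert_type_cong)
      fix r
      show "qlen R (K (Suc i) r) (V r) = qlen R (K (Suc i) r) (K i r) + qlen R (K i r) (V r)"
        by (intro qlen_add familyD[OF Kf] familyD[OF Cons.prems(3)] VK Kinc finK)
    qed
  qed
  define C where "C = image_family x j U (K t0)"
  have Cf: "family R C" unfolding C_def by (rule image_family_family[OF Cons.prems(2) Kf x])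
  have KC: "K t0 r \<subseteq> C r" for r unfolding C_def by (rule le_image_family[OF Cons.prems(2) Kf x])
  have CU: "C r \<subseteq> U r" for r unfolding C_def by (rule image_family_le[OF Cons.prems(2) st(1) KU])
  have Cs: "stable R ((x, j) # S) C"
    unfolding C_def by (rule image_family_stable[OF Cons.prems(2) Kf x st(1) Ks S'])
  \<comment> \<open>Multiplication by \<open>x\<close> sends all of \<open>U\<close> into
    \<open>C\<close>, so stability under \<open>x\<close> is again automatic.\<close>
  have "family_acc R S C U"
  proof -
    have "subfamily R ((x, j) # S) V U W" if W: "subfamily R S C U W" for W
    proof -
      have "x \<otimes> w \<in> W (bump j 1 r)" if "w \<in> W r" for w r
      proof -
        have "w \<in> U r" using W that by (auto simp: subfamily_def)
        then have "x \<otimes> w \<in> scaled R x (U r)" by (auto simp: scaled_def)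
        then have "x \<otimes> w \<in> C (bump j 1 r)"
          using set_add_subset_l[OF scaled_ideal[OF familyD[OF Cons.prems(2)] x] familyD[OF Kf]]
          unfolding C_def image_family_bump by blast
        then show ?thesis using W by (auto simp: subfamily_def)
      qed
      then have "stable R ((x, j) # S) W" using W by (auto simp: subfamily_def stable_def)
      moreover have "V r \<subseteq> W r" for r
        using W VK[of r t0] KC[of r] unfolding subfamily_def by blast
      ultimately show ?thesis using W unfolding subfamily_def by blast
    qed
    then show ?thesis using acc unfolding family_acc_def by simp
  qed
  moreover have "quot_length R (U r) (C r) \<noteq> \<infinity>" for r
    using quot_length_finite_mono[OF KC order_refl finK(2)] .
  ultimately have "hilbert_type n (\<lambda>r. qlen R (U r) (C r))"
    by (intro Cons.IH S Cons.prems(2) Cf weak[OF st(1)] weak[OF Cs] CU)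
  from hilbert_type_cumulative[OF this j]
  have "hilbert_type n (\<lambda>r. \<Sum>t\<le>r j. qlen R (U (r(j := t))) (C (r(j := t))))" .
  then have "hilbert_type n (\<lambda>r. qlen R (U r) (K t0 r))"
  proof (rule hilbert_type_cong)
    fix r
    have "x \<otimes> u \<in> K t0 (bump j 1 r) \<longleftrightarrow> u \<in> K t0 r" if "u \<in> U r" for u r
      using torsion_step[OF Cons.prems(2) x st(1) that, of V t0] t0[of "Suc t0"] by (simp add: K_def)
    then show "qlen R (U r) (K t0 r) = (\<Sum>t\<le>r j. qlen R (U (r(j := t))) (C (r(j := t))))"
      unfolding C_def by (intro qlen_image_family_sum[OF Cons.prems(2) Kf x st(1) Ks KU finK(2)])
  qed
  from hilbert_type_add[OF this torsion_part[of t0]] show ?case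
  proof (rule hilbert_type_cong)
    fix r
    show "qlen R (U r) (V r) = qlen R (U r) (K t0 r) + qlen R (K t0 r) (V r)"
      by (intro qlen_add familyD[OF Kf] familyD[OF Cons.prems(3)] familyD[OF Cons.prems(2)] VK KU Cons.prems(8))
  qed
qed

end

section \<open>Products of powers of ideals\<close>

text \<open>The ideals are given by a function instead of a list, so that one slot can be replaced
  by a function update.\<close>

definition mprod :: "('a, 'b) ring_scheme \<Rightarrow> nat \<Rightarrow> (nat \<Rightarrow> 'a set) \<Rightarrow> 'a graded" where
  "mprod R n I r = (\<Otimes>\<^bsub>ideals_set R\<^esub>j\<in>{..<n}. ideal_pow R (I j) (r j))"

lemma ideal_prod_mono: "A \<subseteq> A' \<Longrightarrow> B \<subseteq> B' \<Longrightarrow> A \<cdot>\<^bsub>R\<^esub> B \<subseteq> A' \<cdot>\<^bsub>R\<^esub> B'"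
proof
  fix s assume "A \<subseteq> A'" "B \<subseteq> B'" "s \<in> A \<cdot>\<^bsub>R\<^esub> B"
  then show "s \<in> A' \<cdot>\<^bsub>R\<^esub> B'"
    by (induction rule: ideal_prod.induct[OF \<open>s \<in> A \<cdot>\<^bsub>R\<^esub> B\<close>]) (auto intro: ideal_prod.intros)
qed

lemma (in cring) ideal_prod_least:
  assumes "ideal C R" "\<And>a b. a \<in> A \<Longrightarrow> b \<in> B \<Longrightarrow> a \<otimes> b \<in> C"
  shows "A \<cdot> B \<subseteq> C"
proof
  fix s assume "s \<in> A \<cdot> B"
  then show "s \<in> C"
    by (induction rule: ideal_prod.induct) (use assms ideal_closed(3)[OF assms(1)] in auto)
qed

context cring
begin

interpretation IS: comm_monoid "ideals_set R"
  by (rule ideals_set_is_comm_monoid)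

lemma ideals_set_simps:
  "carrier (ideals_set R) = {I. ideal I R}" "\<one>\<^bsub>ideals_set R\<^esub> = carrier R"
  "monoid.mult (ideals_set R) = ideal_prod R"
  by (simp_all add: ideals_set_def)

lemma ideal_pow_ideal: "ideal I R \<Longrightarrow> ideal (ideal_pow R I k) R"
  using IS.nat_pow_closed[of I k] by (simp add: ideals_set_simps)

lemma ideal_pow_0: "ideal_pow R I (0::nat) = carrier R"
  by (simp add: ideals_set_simps)

lemma ideal_pow_Suc: "ideal_pow R I (Suc k) = ideal_pow R I k \<cdot> I"
  by (simp add: ideals_set_simps)

lemma ideal_pow_1: "ideal I R \<Longrightarrow> ideal_pow R I (Suc 0) = I"
  using IS.nat_pow_eone[of I] by (simp add: ideals_set_simps)

lemma ideal_pow_add: "ideal I R \<Longrightarrow> ideal_pow R I (k + l) = ideal_pow R I k \<cdot> ideal_pow R I l"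
  using IS.nat_pow_mult[of I k l] by (simp add: ideals_set_simps)

lemma ideal_pow_pow: "ideal I R \<Longrightarrow> ideal_pow R (ideal_pow R I k) l = ideal_pow R I (k * l)"
  using IS.nat_pow_pow[of I k l] by (simp add: ideals_set_simps)

lemma ideal_pow_mono:
  assumes "I \<subseteq> J" shows "ideal_pow R I k \<subseteq> ideal_pow R J k"
proof (induction k)
  case (Suc k)
  show ?case unfolding ideal_pow_Suc by (rule ideal_prod_mono[OF Suc assms])
qed (simp add: ideals_set_simps)

lemma ideal_pow_antimono:
  assumes "ideal I R" "k \<le> l" shows "ideal_pow R I l \<subseteq> ideal_pow R I k"
proof -
  have "ideal_pow R I (k + (l - k)) \<subseteq> ideal_pow R I k"
    unfolding ideal_pow_add[OF assms(1)]
    using ideal_prod_inter[OF ideal_pow_ideal[OF assms(1)] ideal_pow_ideal[OF assms(1)]] by blast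
  then show ?thesis using assms(2) by simp
qed

lemma ideal_pow_carrier: "ideal_pow R (carrier R) (k::nat) = carrier R"
proof (induction k)
  case (Suc k)
  show ?case unfolding ideal_pow_Suc Suc by (rule ideal_prod_one[OF oneideal])
qed (simp add: ideals_set_simps)

lemma ideal_prod_one_l: "ideal I R \<Longrightarrow> carrier R \<cdot> I = I"
  using ideal_prod_commute[OF oneideal, of I] ideal_prod_one by simp

lemma mprod_ideal:
  assumes "\<forall>j<n. ideal (I j) R"
  shows "ideal (mprod R n I r) R"
proof -
  have "mprod R n I r \<in> carrier (ideals_set R)"
    unfolding mprod_def using ideal_pow_ideal assms by (intro IS.finprod_closed) (auto simp: ideals_set_simps(1))
  then show ?thesis by (simp add: ideals_set_simps)
qed

lemma mprod_cong:
  assumes "\<forall>j<n. ideal (I j) R" "\<And>j. j < n \<Longrightarrow> ideal_pow R (I j) (r j) = ideal_pow R (I' j) (r' j)"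
  shows "mprod R n I r = mprod R n I' r'"
  unfolding mprod_def
proof (rule IS.finprod_cong')
  have "ideal (ideal_pow R (I' j) (r' j)) R" if "j < n" for j
    using ideal_pow_ideal[of "I j" "r j"] assms(1) assms(2)[OF that] that by simp
  then show "(\<lambda>j. ideal_pow R (I' j) (r' j)) \<in> {..<n} \<rightarrow> carrier (ideals_set R)"
    by (auto simp: ideals_set_simps(1))
qed (use assms(2) in auto)

lemma mprod_0: "mprod R n I (\<lambda>_. 0) = carrier R"
  unfolding mprod_def using IS.finprod_one_eqI[of "{..<n}"] by (simp add: ideals_set_simps)

lemma mprod_nil [simp]: "mprod R 0 I r = carrier R"
  by (simp add: mprod_def ideals_set_simps)

lemma mprod_Suc:
  assumes "\<forall>j\<le>n. ideal (I j) R"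
  shows "mprod R (Suc n) I r = ideal_pow R (I n) (r n) \<cdot> mprod R n I r"
proof -
  have "(\<lambda>j. ideal_pow R (I j) (r j)) \<in> {..<n} \<rightarrow> carrier (ideals_set R)"
    using ideal_pow_ideal assms by (auto simp: ideals_set_simps(1))
  moreover have "ideal_pow R (I n) (r n) \<in> carrier (ideals_set R)"
    using ideal_pow_ideal assms by (auto simp: ideals_set_simps(1))
  ultimately show ?thesis
    unfolding mprod_def lessThan_Suc by (subst IS.finprod_insert) (auto simp: ideals_set_simps)
qed

lemma mprod_remove:
  assumes "\<forall>j<n. ideal (I j) R" "j < n"
  shows "mprod R n I r = ideal_pow R (I j) (r j) \<cdot> (\<Otimes>\<^bsub>ideals_set R\<^esub>l\<in>{..<n} - {j}. ideal_pow R (I l) (r l))"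
proof -
  have "(\<lambda>j. ideal_pow R (I j) (r j)) \<in> ({..<n} - {j}) \<rightarrow> carrier (ideals_set R)"
    using ideal_pow_ideal assms(1) by (auto simp: ideals_set_simps(1))
  moreover have "ideal_pow R (I j) (r j) \<in> carrier (ideals_set R)"
    using ideal_pow_ideal assms by (auto simp: ideals_set_simps(1))
  moreover have "insert j ({..<n} - {j}) = {..<n}" using assms(2) by auto
  ultimately show ?thesis
    unfolding mprod_def using IS.finprod_insert[of "{..<n} - {j}" j "\<lambda>j. ideal_pow R (I j) (r j)"]
    by (simp add: ideals_set_simps)
qed

lemma mprod_bump:
  assumes "\<forall>j<n. ideal (I j) R" "j < n"
  shows "mprod R n I (bump j k r) = ideal_pow R (I j) k \<cdot> mprod R n I r"
proof -
  let ?rest = "\<lambda>r. \<Otimes>\<^bsub>ideals_set R\<^esub>l\<in>{..<n} - {j}. ideal_pow R (I l) (r l)"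
  have eq: "?rest (bump j k r) = ?rest r"
    by (rule IS.finprod_cong') (use assms(1) ideal_pow_ideal in \<open>auto simp: ideals_set_simps(1) bump_def\<close>)
  have "?rest r \<in> carrier (ideals_set R)"
    using ideal_pow_ideal assms(1) by (intro IS.finprod_closed) (auto simp: ideals_set_simps(1))
  then have rest: "ideal (?rest r) R" by (simp add: ideals_set_simps(1))
  have Ij: "ideal (I j) R" using assms by simp
  note id = ideal_pow_ideal[OF Ij]
  have "mprod R n I (bump j k r) = ideal_pow R (I j) (k + r j) \<cdot> ?rest r"
    using mprod_remove[OF assms, of "bump j k r"] unfolding eq by (simp add: bump_same add.commute)
  also have "\<dots> = ideal_pow R (I j) k \<cdot> (ideal_pow R (I j) (r j) \<cdot> ?rest r)"
    unfolding ideal_pow_add[OF Ij] by (rule ideal_prod_assoc[OF id id rest])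
  finally show ?thesis using mprod_remove[OF assms, of r] by simp
qed

lemma mprod_bump_1:
  assumes "\<forall>j<n. ideal (I j) R" "j < n"
  shows "mprod R n I (bump j 1 r) = I j \<cdot> mprod R n I r"
  using mprod_bump[OF assms, of 1 r] ideal_pow_1[of "I j"] assms by simp

lemma mprod_mono:
  assumes "\<forall>j<n. ideal (I j) R" "\<forall>j<n. ideal (I' j) R"
    and "\<And>j. j < n \<Longrightarrow> ideal_pow R (I j) (r j) \<subseteq> ideal_pow R (I' j) (r' j)"
  shows "mprod R n I r \<subseteq> mprod R n I' r'"
  using assms
proof (induction n)
  case 0
  then show ?case by simp
next
  case (Suc n)
  have "mprod R n I r \<subseteq> mprod R n I' r'" by (rule Suc.IH) (use Suc.prems in auto)
  moreover have "mprod R (Suc n) I r = ideal_pow R (I n) (r n) \<cdot> mprod R n I r"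
    "mprod R (Suc n) I' r' = ideal_pow R (I' n) (r' n) \<cdot> mprod R n I' r'"
    using Suc.prems(1,2) by (auto intro!: mprod_Suc simp: less_Suc_eq_le)
  ultimately show ?case using Suc.prems(3)[of n] by (simp add: ideal_prod_mono)
qed

lemma mprod_const: "ideal J R \<Longrightarrow> mprod R n (\<lambda>_. J) r = ideal_pow R J (\<Sum>j<n. r j)"
proof (induction n)
  case 0
  then show ?case by (simp add: ideals_set_simps)
next
  case (Suc n)
  then show ?case by (subst mprod_Suc) (simp_all add: ideal_pow_add[symmetric] add.commute)
qed

end

declare (in cring) ideal_pow_0 [simp]

section \<open>Finiteness in Noetherian rings\<close>

lemma (in noetherian_ring) noetherian_induct [consumes 1, case_names step]:
  assumes "ideal I R"
    and step: "\<And>I. ideal I R \<Longrightarrow> (\<And>J. ideal J R \<Longrightarrow> I \<subset> J \<Longrightarrow> P J) \<Longrightarrow> P I"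
  shows "P I"
proof (rule ccontr)
  assume "\<not> P I"
  have "\<exists>W. \<forall>t. (ideal (W t) R \<and> \<not> P (W t)) \<and> W t \<subset> W (Suc t)"
  proof (rule dependent_nat_choice)
    show "\<exists>I. ideal I R \<and> \<not> P I" using assms(1) \<open>\<not> P I\<close> by blast
    show "\<exists>J. (ideal J R \<and> \<not> P J) \<and> I \<subset> J" if "ideal I R \<and> \<not> P I" for I t
      using step[of I] that by blast
  qed
  then obtain W :: "nat \<Rightarrow> 'a set" where W: "\<And>t. ideal (W t) R" "\<And>t. W t \<subset> W (Suc t)" by blast
  obtain t0 where "\<And>t. t \<ge> t0 \<Longrightarrow> W t = W t0"
    using ideal_seq_stabilises[of W] W(1) psubset_imp_subset[OF W(2)] by blast
  from this[of "Suc t0"] W(2)[of t0] show False by simp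
qed

locale noetherian_cring = cring R + noetherian_ring R for R (structure)

context noetherian_cring
begin

text \<open>\<open>U/AU\<close> is finitely generated over \<open>R/A\<close>: generators are added
  one at a time, and each contributes a cyclic module killed by \<open>A\<close>, of length at most
  that of \<open>R/A\<close>.\<close>

lemma quot_length_prod_finite:
  assumes A: "ideal A R" "quot_length R (carrier R) A \<noteq> \<infinity>" and U: "ideal U R"
  shows "quot_length R U (A \<cdot> U) \<noteq> \<infinity>"
proof -
  obtain F where F: "F \<subseteq> carrier R" "finite F" "U = Idl F" using finetely_gen[OF U] by blast
  obtain xs where xs: "set xs = F" using finite_list[OF F(2)] by blast
  have FU: "F \<subseteq> U" using genideal_self[OF F(1)] F(3) by simp
  define gen where "gen xs = foldr (\<lambda>x V. scaled R x (carrier R) <+> V) xs (A \<cdot> U)" for xs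
  have AU: "ideal (A \<cdot> U) R" by (rule ideal_prod_is_ideal[OF A(1) U])
  have *: "ideal (gen ys) R \<and> A \<cdot> U \<subseteq> gen ys \<and> set ys \<subseteq> gen ys \<and> quot_length R (gen ys) (A \<cdot> U) \<noteq> \<infinity>"
    if "set ys \<subseteq> F" for ys
    using that
  proof (induction ys)
    case Nil
    then show ?case using AU by (simp add: gen_def)
  next
    case (Cons y ys)
    then have IH: "ideal (gen ys) R" "A \<cdot> U \<subseteq> gen ys" "set ys \<subseteq> gen ys" "quot_length R (gen ys) (A \<cdot> U) \<noteq> \<infinity>"
      by auto
    have y: "y \<in> U" "y \<in> carrier R" using Cons.prems FU F(1) by auto
    have g: "gen (y # ys) = scaled R y (carrier R) <+> gen ys" by (simp add: gen_def)
    note sc = scaled_ideal[OF oneideal y(2)]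
    have id: "ideal (gen (y # ys)) R" unfolding g by (rule add_ideals[OF sc IH(1)])
    have sub: "scaled R y (carrier R) \<subseteq> gen (y # ys)" "gen ys \<subseteq> gen (y # ys)"
      unfolding g using set_add_subset_l[OF sc IH(1)] set_add_subset_r[OF sc IH(1)] .
    have "y \<otimes> \<one> \<in> scaled R y (carrier R)" by (auto simp: scaled_def)
    then have yin: "y \<in> gen (y # ys)" using sub(1) y(2) by auto
    have "y \<otimes> v \<in> gen ys" if "v \<in> A" for v
    proof -
      have "v \<otimes> y \<in> A \<cdot> U" using that y(1) by (rule ideal_prod.prod)
      then show ?thesis using IH(2) m_comm[OF y(2) ideal_closed(8)[OF A(1) that]] by auto
    qed
    then have "quot_length R (gen (y # ys)) (gen ys) \<le> quot_length R (carrier R) A"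
      unfolding g by (rule quot_length_cyclic[OF A(1) IH(1) y(2)])
    then have "quot_length R (gen (y # ys)) (gen ys) \<noteq> \<infinity>" using A(2) by (metis enat_ord_simps(5))
    moreover have "quot_length R (gen (y # ys)) (A \<cdot> U) = quot_length R (gen (y # ys)) (gen ys) + quot_length R (gen ys) (A \<cdot> U)"
      by (rule quot_length_add[OF AU IH(1) id IH(2) sub(2)])
    ultimately have "quot_length R (gen (y # ys)) (A \<cdot> U) \<noteq> \<infinity>" using IH(4) by (simp add: plus_eq_infty_iff_enat)
    then show ?case using id IH(2,3) sub(2) yin by auto
  qed
  have gx: "ideal (gen xs) R" "F \<subseteq> gen xs" "quot_length R (gen xs) (A \<cdot> U) \<noteq> \<infinity>" using *[of xs] xs by auto
  have "U \<subseteq> gen xs" unfolding F(3) by (rule genideal_minimal[OF gx(1,2)])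
  then show ?thesis using quot_length_finite_mono[OF order_refl _ gx(3)] by blast
qed

lemma finite_colength_iff: "finite_colength R I \<longleftrightarrow> ideal I R \<and> quot_length R (carrier R) I \<noteq> \<infinity>"
  unfolding finite_colength_def using colength_eq_quot_length by auto

lemma finite_colengthD: "finite_colength R I \<Longrightarrow> ideal I R"
  by (simp add: finite_colength_def)

lemma finite_colength_carrier: "finite_colength R (carrier R)"
  unfolding finite_colength_iff using oneideal by simp

lemma finite_colength_mono: "finite_colength R I \<Longrightarrow> ideal J R \<Longrightarrow> I \<subseteq> J \<Longrightarrow> finite_colength R J"
  unfolding finite_colength_iff using quot_length_finite_mono[of I J "carrier R" "carrier R" R] by simp

lemma finite_colength_prod:
  assumes "finite_colength R A" "finite_colength R U"
  shows "finite_colength R (A \<cdot> U)"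
proof -
  note A = assms(1)[unfolded finite_colength_iff] and U = assms(2)[unfolded finite_colength_iff]
  have id: "ideal (A \<cdot> U) R" using A U by (intro ideal_prod_is_ideal) auto
  have "A \<cdot> U \<subseteq> U" using ideal_prod_inter[of A U] A U by blast
  then have "quot_length R (carrier R) (A \<cdot> U) = quot_length R (carrier R) U + quot_length R U (A \<cdot> U)"
    using U id ideal_closed(1)[of U] by (intro quot_length_add oneideal) auto
  then show ?thesis
    using A U id quot_length_prod_finite[of A U] by (simp add: finite_colength_iff plus_eq_infty_iff_enat)
qed

lemma finite_colength_pow: "finite_colength R I \<Longrightarrow> finite_colength R (ideal_pow R I k)"
proof (induction k)
  case 0
  then show ?case using finite_colength_carrier by (simp only: ideal_pow_0)
next
  case (Suc k)
  then show ?case unfolding ideal_pow_Suc by (intro finite_colength_prod) auto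
qed

lemma finite_colength_mprod:
  "\<forall>j<n. finite_colength R (I j) \<Longrightarrow> finite_colength R (mprod R n I r)"
proof (induction n)
  case 0
  then show ?case using finite_colength_carrier by simp
next
  case (Suc n)
  have "\<forall>j\<le>n. ideal (I j) R" using finite_colengthD Suc.prems by (simp add: less_Suc_eq_le)
  then show ?case
    using mprod_Suc[of n I r] finite_colength_prod[OF finite_colength_pow Suc.IH] Suc.prems by simp
qed

lemma qlen_carrier_eq_colength: "ideal I R \<Longrightarrow> real (the_enat (colength R I)) = qlen R (carrier R) I"
  by (simp add: qlen_def colength_eq_quot_length)

lemma qlen_carrier_antimono:
  assumes "finite_colength R I" "ideal J R" "I \<subseteq> J"
  shows "qlen R (carrier R) J \<le> qlen R (carrier R) I"
proof -
  have "qlen R (carrier R) I = qlen R (carrier R) J + qlen R J I"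
    using assms ideal_closed(1)[OF assms(2)] by (intro qlen_add oneideal) (auto simp: finite_colength_iff)
  then show ?thesis by simp
qed

subsection \<open>The Hilbert function of a list of ideals\<close>

text \<open>Adjoining the operators one by one to \<open>R\<close> in degree zero preserves the
  chain condition and yields a family containing all their products. It serves as the Noetherian
  ambient object for families of Rees type.\<close>

lemma family_acc_generators:
  assumes "\<And>y i. (y, i) \<in> set S \<Longrightarrow> y \<in> carrier R"
  shows "\<exists>W. family R W \<and> stable R S W \<and> concentrated R (\<lambda>_. 0) \<subseteq> W (\<lambda>_. 0) \<and> family_acc R S (\<lambda>_. {\<zero>}) W"
  using assms
proof (induction S)
  case Nil
  have "family R (concentrated R)" by (simp add: family_def concentrated_def oneideal zeroideal)
  moreover have "stable R [] (concentrated R)" by (simp add: stable_def)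
  ultimately show ?case using family_acc_concentrated by blast
next
  case (Cons a S)
  obtain x j where a: "a = (x, j)" by (cases a)
  have x: "x \<in> carrier R" and S: "\<And>y i. (y, i) \<in> set S \<Longrightarrow> y \<in> carrier R"
    using Cons.prems a by (meson list.set_intros)+
  obtain W where W: "family R W" "stable R S W" "concentrated R (\<lambda>_. 0) \<subseteq> W (\<lambda>_. 0)" "family_acc R S (\<lambda>_. {\<zero>}) W"
  proof -
    have "\<exists>W. family R W \<and> stable R S W \<and> concentrated R (\<lambda>_. 0) \<subseteq> W (\<lambda>_. 0) \<and> family_acc R S (\<lambda>_. {\<zero>}) W"
      by (rule Cons.IH) (rule S)
    then show ?thesis using that by blast
  qed
  have "concentrated R (\<lambda>_. 0) \<subseteq> adjoin R x j W (\<lambda>_. 0)"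
    using W(3) le_adjoin[OF W(1) x] by blast
  then show ?case
    using adjoin_family[OF W(1) x, of j] adjoin_stable[OF W(1) x W(2), of j] family_acc_adjoin[OF W(1,2,4) x, of j] S
    unfolding a by blast
qed

lemma supported_induct [consumes 1, case_names zero bump]:
  assumes "supported n r" "P (\<lambda>_. 0)"
    and "\<And>r j. supported n r \<Longrightarrow> j < n \<Longrightarrow> P r \<Longrightarrow> P (bump j 1 r)"
  shows "P r"
  using assms(1)
proof (induction "\<Sum>j<n. r j" arbitrary: r)
  case 0
  then have "r j = 0" for j by (cases "j < n") (auto simp: supported_def)
  then have "r = (\<lambda>_. 0)" by (simp add: fun_eq_iff)
  then show ?case using assms(2) by simp
next
  case (Suc k)
  then obtain j where j: "j < n" "r j > 0" by (metis lessThan_iff neq0_conv sum.neutral nat.distinct(1))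
  define r' where "r' = r(j := r j - 1)"
  have r: "r = bump j 1 r'" using j by (auto simp: r'_def bump_def)
  have "(\<Sum>l<n. r l) = r j + (\<Sum>l\<in>{..<n} - {j}. r l)" "(\<Sum>l<n. r' l) = r' j + (\<Sum>l\<in>{..<n} - {j}. r' l)"
    using j by (simp_all add: sum.remove)
  moreover have "(\<Sum>l\<in>{..<n} - {j}. r' l) = (\<Sum>l\<in>{..<n} - {j}. r l)" by (rule sum.cong) (auto simp: r'_def)
  ultimately have "k = (\<Sum>l<n. r' l)" using Suc(2) j by (simp add: r'_def)
  moreover have "supported n r'" using Suc.prems j by (auto simp: supported_def r'_def)
  ultimately show ?case using Suc(1)[of r'] assms(3)[of r' j] j r by simp
qed

text \<open>The entries tagged \<open>j\<close> generate \<open>I j\<close>, so operating with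
  \<open>S\<close> amounts to multiplying in the multigraded Rees algebra of the ideals.\<close>

definition generator_list :: "nat \<Rightarrow> (nat \<Rightarrow> 'a set) \<Rightarrow> ('a \<times> nat) list \<Rightarrow> bool" where
  "generator_list n I S \<longleftrightarrow> (\<forall>x j. (x, j) \<in> set S \<longrightarrow> j < n \<and> x \<in> I j) \<and>
     (\<forall>j<n. \<exists>F. F \<subseteq> carrier R \<and> I j = Idl F \<and> (\<forall>x\<in>F. (x, j) \<in> set S))"

lemma generator_list_exists:
  assumes "\<forall>j<n. ideal (I j) R"
  shows "\<exists>S. generator_list n I S"
proof -
  have "\<exists>F. j < n \<longrightarrow> F \<subseteq> carrier R \<and> finite F \<and> I j = Idl F" for j
    using finetely_gen[of "I j"] assms by blast
  then obtain F where F: "\<And>j. j < n \<Longrightarrow> F j \<subseteq> carrier R \<and> finite (F j) \<and> I j = Idl (F j)" by metis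
  have "finite (SIGMA j:{..<n}. F j)" using F by auto
  then obtain xs where xs: "set xs = (SIGMA j:{..<n}. F j)" using finite_list by blast
  define S where "S = map (\<lambda>(j, x). (x, j)) xs"
  have S: "(x, j) \<in> set S \<longleftrightarrow> j < n \<and> x \<in> F j" for x j
    using xs by (auto simp: S_def)
  have "generator_list n I S"
    unfolding generator_list_def
  proof (intro conjI allI impI)
    show "j < n" "x \<in> I j" if "(x, j) \<in> set S" for x j
      using that F[of j] genideal_self[of "F j"] unfolding S by auto
    show "\<exists>F. F \<subseteq> carrier R \<and> I j = Idl F \<and> (\<forall>x\<in>F. (x, j) \<in> set S)" if "j < n" for j
      using F[OF that] that unfolding S by (intro exI[of _ "F j"]) simp
  qed
  then show ?thesis ..
qed

text \<open>The elements that multiply \<open>W r\<close> into the next degree form an ideal; it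
  contains generators of \<open>I j\<close>, hence \<open>I j\<close>. Induction on the total degree
  does the rest.\<close>

lemma stable_family_contains_mprod:
  assumes I: "\<forall>j<n. ideal (I j) R" and S: "generator_list n I S"
    and W: "family R W" "stable R S W" "carrier R \<subseteq> W (\<lambda>_. 0)" and r: "supported n r"
  shows "mprod R n I r \<subseteq> W r"
  using r
proof (induction rule: supported_induct)
  case zero
  then show ?case using W(3) by (simp add: mprod_0)
next
  case (bump r j)
  obtain F where F: "F \<subseteq> carrier R" "I j = Idl F" "\<And>x. x \<in> F \<Longrightarrow> (x, j) \<in> set S"
    using S bump(2) by (auto simp: generator_list_def)
  let ?C = "{a \<in> carrier R. \<forall>v\<in>W r. a \<otimes> v \<in> W (bump j 1 r)}"
  note cl = ideal_closed[OF familyD[OF W(1)]]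
  have "ideal ?C R"
  proof (rule idealI')
    show "x \<oplus> y \<in> ?C" if "x \<in> ?C" "y \<in> ?C" for x y
      using that cl(3,8) by (auto simp: l_distr)
    show "b \<otimes> x \<in> ?C" if "x \<in> ?C" "b \<in> carrier R" for b x
      using that cl(6,8) by (auto simp: m_assoc)
    show "\<zero> \<in> ?C" using cl(2,8) by auto
  qed auto
  moreover have "F \<subseteq> ?C"
    using F(1) stableD[OF W(2), OF F(3)] by auto
  ultimately have "I j \<subseteq> ?C" unfolding F(2) by (rule genideal_minimal)
  then show ?case
    unfolding mprod_bump_1[OF I bump(2)] using bump(3) by (intro ideal_prod_least familyD[OF W(1)]) auto
qed

text \<open>Both families of products lie in the Noetherian ambient family, so their quotient
  satisfies the chain condition.\<close>

lemma hilbert_type_prod: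
  assumes I: "\<forall>j<n. ideal (I j) R" and A: "ideal A R" and B: "ideal B R" and "A \<subseteq> B"
    and fin: "\<And>r. quot_length R (B \<cdot> mprod R n I r) (A \<cdot> mprod R n I r) \<noteq> \<infinity>"
  shows "hilbert_type n (\<lambda>r. qlen R (B \<cdot> mprod R n I r) (A \<cdot> mprod R n I r))"
proof -
  obtain S where S: "generator_list n I S" using generator_list_exists[OF I] by blast
  have S': "x \<in> carrier R \<and> j < n" if "(x, j) \<in> set S" for x j
    using S that I ideal_closed(8) unfolding generator_list_def by blast
  obtain W where W: "family R W" "stable R S W" "concentrated R (\<lambda>_. 0) \<subseteq> W (\<lambda>_. 0)" "family_acc R S (\<lambda>_. {\<zero>}) W"
    using family_acc_generators[of S] S' by blast
  have W0: "carrier R \<subseteq> W (\<lambda>_. 0)" using W(3) by (simp add: concentrated_def)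
  note M = mprod_ideal[OF I]
  have Ij: "ideal (I j) R" if "j < n" for j using I that by simp
  \<comment> \<open>Off the supported multidegrees every such family is zero: it lies in the ambient
    \<open>W\<close> there for trivial reasons, and the quotient vanishes.\<close>
  define U where "U C r = (if supported n r then C \<cdot> mprod R n I r else {\<zero>})" for C r
  have sup: "supported n (bump j 1 r) \<longleftrightarrow> supported n r" if "j < n" for j r
    using that by (auto simp: supported_def bump_def)
  have Uf: "family R (U C)" if "ideal C R" for C
    using ideal_prod_is_ideal[OF that M] zeroideal by (simp add: U_def family_def)
  have Us: "stable R S (U C)" if C: "ideal C R" for C
    unfolding stable_def
  proof (intro allI impI)
    fix x j r u assume xj: "(x, j) \<in> set S" and u: "u \<in> U C r"
    have x: "x \<in> carrier R" "j < n" "x \<in> I j" using S'[OF xj] S xj by (auto simp: generator_list_def)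
    show "x \<otimes> u \<in> U C (bump j 1 r)"
    proof (cases "supported n r")
      case True
      have "u \<in> C \<cdot> mprod R n I r" using u True by (simp add: U_def)
      with x(3) have "x \<otimes> u \<in> I j \<cdot> (C \<cdot> mprod R n I r)" by (rule ideal_prod.prod)
      also have "I j \<cdot> (C \<cdot> mprod R n I r) = C \<cdot> mprod R n I (bump j 1 r)"
        using ideal_prod_assoc[OF Ij[OF x(2)] C M] ideal_prod_assoc[OF C Ij[OF x(2)] M]
          ideal_prod_commute[OF Ij[OF x(2)] C] mprod_bump_1[OF I x(2)] by simp
      finally show ?thesis using True sup[OF x(2)] by (simp only: U_def) simp
    next
      case False
      then show ?thesis using u x sup[OF x(2)] by (simp add: U_def)
    qed
  qed
  have UW: "U C r \<subseteq> W r" if C: "ideal C R" for C r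
  proof (cases "supported n r")
    case True
    have "C \<cdot> mprod R n I r \<subseteq> mprod R n I r" using ideal_prod_inter[OF C M] by blast
    also have "\<dots> \<subseteq> W r" by (rule stable_family_contains_mprod[OF I S W(1,2) W0 True])
    finally show ?thesis using True by (simp add: U_def)
  next
    case False
    then show ?thesis using ideal_closed(2)[OF familyD[OF W(1)]] by (simp add: U_def)
  qed
  have "hilbert_type n (\<lambda>r. qlen R (U B r) (U A r))"
  proof (rule hilbert_type_family[of S])
    show "family_acc R S (U A) (U B)"
      by (rule family_acc_mono[OF W(4)]) (use UW B ideal_closed(2)[OF familyD[OF Uf[OF A]]] in auto)
    show "U A r \<subseteq> U B r" for r by (simp add: U_def ideal_prod_mono[OF \<open>A \<subseteq> B\<close> order_refl])
    show "quot_length R (U B r) (U A r) \<noteq> \<infinity>" for r using fin[of r] by (auto simp add: U_def zero_enat_def)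
  qed (use S' Uf Us A B in auto)
  then show ?thesis by (rule hilbert_type_cong) (simp add: U_def)
qed

text \<open>The quotient of \<open>R\<close> by the product is filtered by the powers of one ideal:
  the lengths of \<open>M / I_k M\<close> are summed over the exponent of \<open>I k\<close>, and
  what is left involves \<open>R\<close> in place of \<open>I k\<close>. Induction is on the number
  \<open>k\<close> of initial slots that may differ from \<open>R\<close>.\<close>

theorem hilbert_type_colength:
  assumes "\<forall>j<n. finite_colength R (I j)"
  shows "hilbert_type n (\<lambda>r. qlen R (carrier R) (mprod R n I r))"
proof -
  have "hilbert_type n (\<lambda>r. qlen R (carrier R) (mprod R n I r))"
    if "\<forall>j<n. finite_colength R (I j)" "\<And>j. j \<ge> k \<Longrightarrow> I j = carrier R" "k \<le> n" for k I
    using that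
  proof (induction k arbitrary: I)
    case 0
    have "mprod R n I r = mprod R n I (\<lambda>_. 0)" for r
      by (rule mprod_cong) (use 0 in \<open>simp_all add: ideal_pow_carrier oneideal ideals_set_simps\<close>)
    then show ?case using hilbert_type_0 by (simp add: mprod_0)
  next
    case (Suc k)
    have I: "\<forall>j<n. ideal (I j) R" using finite_colengthD Suc.prems(1) by simp
    have k: "k < n" using Suc.prems by simp
    have Ik: "ideal (I k) R" using I k by simp
    let ?M = "mprod R n I"
    note M = mprod_ideal[OF I]
    have fM: "quot_length R (carrier R) (?M r) \<noteq> \<infinity>" for r
      using finite_colength_mprod[of n I r] Suc.prems(1) by (simp add: finite_colength_iff)
    have M1: "?M (r(k := Suc t)) = I k \<cdot> ?M (r(k := t))" for r t
      using mprod_bump_1[OF I k, of "r(k := t)"] by (simp add: bump_def)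
    have sub: "I k \<cdot> ?M r \<subseteq> ?M r" "?M r \<subseteq> carrier R" for r
      using ideal_prod_inter[OF Ik M] ideal_closed(1)[OF M] by blast+
    have 1: "hilbert_type n (\<lambda>r. qlen R (carrier R) (mprod R n (I(k := carrier R)) r))"
      by (rule Suc.IH) (use Suc.prems finite_colength_carrier in auto)
    have fin: "quot_length R (?M r) (I k \<cdot> ?M r) \<noteq> \<infinity>" for r
      using quot_length_prod_finite[OF Ik _ M] Suc.prems(1) k by (simp add: finite_colength_iff)
    have "hilbert_type n (\<lambda>r. qlen R (carrier R \<cdot> ?M r) (I k \<cdot> ?M r))"
      by (rule hilbert_type_prod[OF I Ik oneideal])
        (use ideal_closed(1)[OF Ik] fin ideal_prod_one_l[OF M] in auto)
    then have "hilbert_type n (\<lambda>r. qlen R (?M r) (I k \<cdot> ?M r))" by (simp add: ideal_prod_one_l[OF M])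
    from hilbert_type_add[OF 1 hilbert_type_cumulative_less[OF this k]] show ?case
    proof (rule hilbert_type_cong)
      fix r
      have "qlen R (carrier R) (?M (r(k := s)))
          = qlen R (carrier R) (?M (r(k := 0))) + (\<Sum>t<s. qlen R (?M (r(k := t))) (I k \<cdot> ?M (r(k := t))))" for s
      proof (induction s)
        case (Suc s)
        have "qlen R (carrier R) (?M (r(k := Suc s)))
            = qlen R (carrier R) (?M (r(k := s))) + qlen R (?M (r(k := s))) (?M (r(k := Suc s)))"
          by (rule qlen_add[OF M M oneideal _ _ fM]) (unfold M1, rule sub, rule sub)
        then show ?case using Suc unfolding M1 sum.lessThan_Suc by linarith
      qed simp
      from this[of "r k"] have "qlen R (carrier R) (?M r)
          = qlen R (carrier R) (?M (r(k := 0))) + (\<Sum>t<r k. qlen R (?M (r(k := t))) (I k \<cdot> ?M (r(k := t))))"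
        by simp
      moreover have "?M (r(k := 0)) = mprod R n (I(k := carrier R)) r"
        by (rule mprod_cong[OF I]) (simp_all add: ideal_pow_carrier ideals_set_simps)
      ultimately show "qlen R (carrier R) (?M r) = qlen R (carrier R) (mprod R n (I(k := carrier R)) r)
          + (\<Sum>t<r k. qlen R (?M (r(k := t))) (I k \<cdot> ?M (r(k := t))))" by simp
    qed
  qed
  note gen = this
  \<comment> \<open>The induction asks for \<open>R\<close> in all slots from \<open>n\<close> on;
    the product does not read them.\<close>
  define I' where "I' j = (if j < n then I j else carrier R)" for j
  have "hilbert_type n (\<lambda>r. qlen R (carrier R) (mprod R n I' r))"
    by (rule gen[of I' n]) (use assms in \<open>auto simp: I'_def\<close>)
  moreover have "mprod R n I' r = mprod R n I r" for r
    by (rule mprod_cong) (use finite_colengthD assms in \<open>auto simp: I'_def\<close>)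
  ultimately show ?thesis by simp
qed

end

section \<open>Eventual form of functions of Hilbert type\<close>

lemma seq_null_comparison:
  fixes f g :: "nat \<Rightarrow> real"
  assumes "g \<longlonglongrightarrow> 0" "\<And>k. k \<ge> N \<Longrightarrow> \<bar>f k\<bar> \<le> g k"
  shows "f \<longlonglongrightarrow> 0"
  by (rule tendsto_0_le[OF assms(1), of _ 1])
    (use assms(2) in \<open>auto intro!: eventually_sequentiallyI[of N] intro: order_trans[OF _ abs_ge_self]\<close>)

lemma poly_over_power_tendsto:
  fixes p :: "real poly"
  assumes "degree p \<le> d"
  shows "(\<lambda>k. poly p (real k) / real k ^ d) \<longlonglongrightarrow> coeff p d"
proof -
  have "((\<lambda>x. poly p x / x ^ d) \<longlongrightarrow> coeff p d) at_infinity"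
  proof (cases "degree p = d")
    case True
    then show ?thesis using poly_divide_tendsto_aux[of p] by simp
  next
    case False
    then have "degree p < d" using assms by simp
    then have "((\<lambda>x. poly p x / poly (monom 1 d) x) \<longlongrightarrow> 0) at_infinity"
      by (intro poly_divide_tendsto_0_at_infinity) (simp add: degree_monom_eq)
    then show ?thesis using \<open>degree p < d\<close> by (simp add: poly_monom coeff_eq_0)
  qed
  then show ?thesis by (rule filterlim_compose[OF _ filterlim_real_at_infinity_sequentially])
qed

text \<open>Otherwise, dividing by the missing power of \<open>k\<close> as well would produce both
  the limit 0 and the limit \<open>lead_coeff p\<close>.\<close>

lemma degree_less_if_tendsto_0:
  fixes p :: "real poly"
  assumes "p \<noteq> 0" "(\<lambda>k. poly p (real k) / real k ^ d) \<longlonglongrightarrow> 0"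
  shows "degree p < d"
proof (rule ccontr)
  assume "\<not> degree p < d"
  then obtain e where e: "degree p = d + e" by (metis le_Suc_ex not_less)
  have "(\<lambda>k. poly p (real k) / real k ^ d * inverse (real k ^ e)) \<longlonglongrightarrow> 0"
  proof (rule seq_null_comparison[OF tendsto_rabs_zero[OF assms(2)], of 1])
    show "\<bar>poly p (real k) / real k ^ d * inverse (real k ^ e)\<bar> \<le> \<bar>poly p (real k) / real k ^ d\<bar>" if "k \<ge> 1" for k
    proof -
      have "1 \<le> real k ^ e" using that by (simp add: one_le_power)
      then have "inverse (real k ^ e) \<le> 1" by (simp add: inverse_le_1_iff)
      moreover have "0 \<le> inverse (real k ^ e)" by simp
      ultimately have "\<bar>poly p (real k) / real k ^ d\<bar> * inverse (real k ^ e) \<le> \<bar>poly p (real k) / real k ^ d\<bar> * 1"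
        by (intro mult_left_mono) auto
      then show ?thesis unfolding abs_mult[of "poly p (real k) / real k ^ d"]
        using \<open>0 \<le> inverse (real k ^ e)\<close> by simp
    qed
  qed
  moreover have "poly p (real k) / real k ^ d * inverse (real k ^ e) = poly p (real k) / real k ^ degree p" for k
    by (simp add: e power_add divide_inverse)
  ultimately have "(\<lambda>k. poly p (real k) / real k ^ degree p) \<longlonglongrightarrow> 0" by simp
  moreover have "(\<lambda>k. poly p (real k) / real k ^ degree p) \<longlonglongrightarrow> lead_coeff p"
    by (rule poly_over_power_tendsto) simp
  ultimately have "lead_coeff p = 0" using LIMSEQ_unique by blast
  then show False using assms(1) by simp
qed

definition peval :: "nat \<Rightarrow> (nat \<Rightarrow> real poly) \<Rightarrow> (nat \<Rightarrow> nat) \<Rightarrow> real" where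
  "peval n p r = (\<Prod>j<n. poly (p j) (real (r j)))"

definition large :: "nat \<Rightarrow> nat \<Rightarrow> (nat \<Rightarrow> nat) \<Rightarrow> bool" where
  "large n N r \<longleftrightarrow> supported n r \<and> (\<forall>j<n. N \<le> r j)"

definition eventual_sum :: "nat \<Rightarrow> ((nat \<Rightarrow> nat) \<Rightarrow> real) \<Rightarrow> nat \<Rightarrow> 'i set \<Rightarrow> ('i \<Rightarrow> real) \<Rightarrow> ('i \<Rightarrow> nat \<Rightarrow> real poly) \<Rightarrow> bool" where
  "eventual_sum n f N F w p \<longleftrightarrow> finite F \<and> (\<forall>r. large n N r \<longrightarrow> f r = (\<Sum>i\<in>F. w i * peval n (p i) r))"

text \<open>Positive leading coefficients keep the top-degree terms of different summands from
  cancelling.\<close>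

definition positive_sum :: "nat \<Rightarrow> nat \<Rightarrow> 'i set \<Rightarrow> ('i \<Rightarrow> real) \<Rightarrow> ('i \<Rightarrow> nat \<Rightarrow> real poly) \<Rightarrow> bool" where
  "positive_sum n N F w p \<longleftrightarrow>
     (\<forall>i\<in>F. 0 < w i \<and> (\<forall>j<n. 0 < lead_coeff (p i j) \<and> (\<forall>k\<ge>N. 0 \<le> poly (p i j) (real k))))"

lemma large_mono: "large n N r \<Longrightarrow> M \<le> N \<Longrightarrow> large n M r"
  by (auto simp: large_def)

lemma lead_coeff_pos_if_eventually_nonneg:
  fixes p :: "real poly"
  assumes "p \<noteq> 0" "\<And>k. k \<ge> N \<Longrightarrow> 0 \<le> poly p (real k)"
  shows "0 < lead_coeff p"
proof -
  have "(\<lambda>k. poly p (real k) / real k ^ degree p) \<longlonglongrightarrow> lead_coeff p"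
    by (rule poly_over_power_tendsto) simp
  then have "0 \<le> lead_coeff p"
    by (rule tendsto_lowerbound) (auto intro!: eventually_sequentiallyI[of N] divide_nonneg_nonneg assms(2))
  then show ?thesis using assms(1) by (metis leading_coeff_0_iff order_less_le)
qed

text \<open>Summands with weight zero or with a factor that is eventually zero are discarded. Every
  remaining factor is a nonzero polynomial with nonnegative values far out, so its leading
  coefficient is positive.\<close>

lemma hilbert_type_eventual_sum:
  assumes "hilbert_type n f"
  obtains N F w p where "eventual_sum n f N (F :: nat set) w p" "positive_sum n N F w p"
proof -
  obtain m w g where 1: "\<And>i j. i < m \<Longrightarrow> j < n \<Longrightarrow> evpoly (g i j)" "\<And>i. i < m \<Longrightarrow> 0 \<le> w i"
    "\<And>r. supported n r \<Longrightarrow> f r = (\<Sum>i<m::nat. w i * (\<Prod>j<n. g i j (r j)))" by (rule hilbert_typeE[OF assms(1)]) blast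
  have "\<exists>p M. i < m \<longrightarrow> j < n \<longrightarrow> (\<forall>k\<ge>M. g i j k = poly p (real k) \<and> 0 \<le> poly p (real k))" for i j
    using 1(1)[of i j] unfolding evpoly_def by metis
  then obtain p M where pM: "\<And>i j k. i < m \<Longrightarrow> j < n \<Longrightarrow> M i j \<le> k \<Longrightarrow> g i j k = poly (p i j) (real k) \<and> 0 \<le> poly (p i j) (real k)"
    by metis
  define N where "N = Max (insert 0 ((\<lambda>(i, j). M i j) ` ({..<m} \<times> {..<n})))"
  have N: "M i j \<le> N" if "i < m" "j < n" for i j
    unfolding N_def using that by (intro Max_ge) (auto intro!: image_eqI[of _ _ "(i, j)"])
  define F where "F = {i \<in> {..<m}. w i \<noteq> 0 \<and> (\<forall>j<n. p i j \<noteq> 0)}"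
  have "eventual_sum n f N F w p"
    unfolding eventual_sum_def
  proof (intro conjI allI impI)
    show "finite F" by (simp add: F_def)
    fix r assume r: "large n N r"
    have "g i j (r j) = poly (p i j) (real (r j))" if "i < m" "j < n" for i j
      using pM[OF that, of "r j"] N[OF that] r that(2) by (simp add: large_def order_trans)
    then have "f r = (\<Sum>i<m. w i * peval n (p i) r)"
      unfolding 1(3)[OF r[unfolded large_def, THEN conjunct1]] peval_def
      by (auto intro!: sum.cong prod.cong)
    also have "\<dots> = (\<Sum>i\<in>F. w i * peval n (p i) r)"
    proof (rule sum.mono_neutral_right)
      show "\<forall>i\<in>{..<m} - F. w i * peval n (p i) r = 0"
      proof
        fix i assume "i \<in> {..<m} - F"
        then consider "w i = 0" | j where "j < n" "p i j = 0" by (auto simp: F_def)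
        then show "w i * peval n (p i) r = 0"
        proof cases
          case 2
          then have "peval n (p i) r = 0" unfolding peval_def by (intro prod_zero bexI[of _ j]) auto
          then show ?thesis by simp
        qed simp
      qed
    qed (auto simp: F_def)
    finally show "f r = (\<Sum>i\<in>F. w i * peval n (p i) r)" .
  qed
  moreover have "positive_sum n N F w p"
    unfolding positive_sum_def
  proof (intro ballI conjI allI impI)
    fix i assume i: "i \<in> F"
    then show "0 < w i" using 1(2)[of i] by (simp add: F_def less_le)
    fix j assume j: "j < n"
    show nn: "0 \<le> poly (p i j) (real k)" if "N \<le> k" for k
      using pM[of i j k] N[of i j] i j that by (simp add: F_def)
    show "0 < lead_coeff (p i j)"
      using i j nn by (intro lead_coeff_pos_if_eventually_nonneg[of _ N]) (auto simp: F_def)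
  qed
  ultimately show ?thesis using that by blast
qed

definition diagonal :: "nat \<Rightarrow> nat \<Rightarrow> nat \<Rightarrow> nat" where
  "diagonal n k j = (if j < n then k else 0)"

lemma large_diagonal: "N \<le> k \<Longrightarrow> large n N (diagonal n k)"
  by (simp add: large_def supported_def diagonal_def)

lemma peval_nonneg: "positive_sum n N F w p \<Longrightarrow> i \<in> F \<Longrightarrow> large n N r \<Longrightarrow> 0 \<le> w i * peval n (p i) r"
  unfolding peval_def positive_sum_def large_def by (intro mult_nonneg_nonneg prod_nonneg) (auto simp: less_imp_le)

text \<open>On the diagonal every summand is nonnegative and hence at most \<open>f\<close>, so a
  growth bound in the single variable \<open>k\<close> limits the total degree of each summand
  separately.\<close>

lemma eventual_sum_degree_less:
  assumes f: "eventual_sum n f N F w p" and pos: "positive_sum n N F w p"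
    and lim: "(\<lambda>k. f (diagonal n k) / real k ^ d) \<longlonglongrightarrow> 0" and i: "i \<in> F"
  shows "(\<Sum>j<n. degree (p i j)) < d"
proof -
  define P where "P = (\<Prod>j<n. p i j)"
  have ne: "p i j \<noteq> 0" if "j < n" for j
    using pos i that unfolding positive_sum_def by force
  have deg: "degree P = (\<Sum>j<n. degree (p i j))"
    unfolding P_def by (rule degree_prod_sum_eq) (use ne in auto)
  have w: "0 < w i" using pos i by (simp add: positive_sum_def)
  have Pk: "poly P (real k) = peval n (p i) (diagonal n k)" for k
    unfolding P_def poly_prod peval_def diagonal_def by (rule prod.cong) auto
  have bd: "\<bar>w i * poly P (real k) / real k ^ d\<bar> \<le> f (diagonal n k) / real k ^ d" if "k \<ge> N" for k
  proof -
    have 0: "0 \<le> w l * peval n (p l) (diagonal n k)" if "l \<in> F" for l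
      using peval_nonneg[OF pos that large_diagonal[OF \<open>k \<ge> N\<close>]] .
    have "w i * peval n (p i) (diagonal n k) \<le> f (diagonal n k)"
      using f large_diagonal[OF that, of n] i 0 unfolding eventual_sum_def by (auto intro!: member_le_sum)
    then show ?thesis using 0[OF i] by (simp add: Pk divide_right_mono)
  qed
  have "(\<lambda>k. w i * poly P (real k) / real k ^ d) \<longlonglongrightarrow> 0"
    by (rule seq_null_comparison[OF lim bd])
  then have "(\<lambda>k. poly (smult (w i) P) (real k) / real k ^ d) \<longlonglongrightarrow> 0" by simp
  moreover have "smult (w i) P \<noteq> 0" using w ne by (simp add: P_def)
  ultimately have "degree (smult (w i) P) < d" by (intro degree_less_if_tendsto_0)
  then show ?thesis using w deg by simp
qed

subsection \<open>Differences\<close>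

text \<open>Iterated forward differences, one for each listed variable. Taken once in each of
  \<open>n\<close> variables, they extract the coefficient of the product of all variables from a
  polynomial of total degree at most \<open>n\<close>.\<close>

fun mixed_diff :: "nat list \<Rightarrow> ((nat \<Rightarrow> nat) \<Rightarrow> real) \<Rightarrow> (nat \<Rightarrow> nat) \<Rightarrow> real" where
  "mixed_diff [] f r = f r"
| "mixed_diff (j # L) f r = mixed_diff L f (bump j 1 r) - mixed_diff L f r"

definition pdiff :: "real poly \<Rightarrow> real poly" where
  "pdiff p = pcompose p [:1, 1:] - p"

lemma poly_pdiff: "poly (pdiff p) x = poly p (x + 1) - poly p x"
  by (simp add: pdiff_def poly_pcompose add.commute)

lemma pdiff_degree_0: "degree p = 0 \<Longrightarrow> pdiff p = 0"
  by (metis (no_types, lifting) degree_eq_zeroE diff_self pcompose_const pdiff_def)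

lemma pdiff_degree_1:
  assumes "degree p = 1" shows "pdiff p = [:lead_coeff p:]"
proof -
  obtain a b where "p = [:a, b:]" using assms by (metis degree_eq_zeroE degree_pCons_eq_if nat.inject One_nat_def pCons_cases zero_neq_one)
  then show ?thesis using assms by (simp add: pdiff_def pcompose_pCons split: if_splits)
qed

lemma large_bump: "large n N r \<Longrightarrow> j < n \<Longrightarrow> large n N (bump j k r)"
  by (auto simp: large_def bump_def supported_def)

text \<open>A difference in variable \<open>l\<close> acts on the \<open>l\<close>-th factor alone.
  The right-hand side depends on \<open>L\<close> only through \<open>set L\<close>, so differences
  may be reordered.\<close>

lemma mixed_diff_eventual_sum:
  assumes f: "eventual_sum n f N F w p" and L: "distinct L" "set L \<subseteq> {..<n}" and r: "large n N r"
  shows "mixed_diff L f r = (\<Sum>i\<in>F. w i * peval n (\<lambda>j. if j \<in> set L then pdiff (p i j) else p i j) r)"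
  using L r
proof (induction L arbitrary: r)
  case Nil
  then show ?case using f by (simp add: eventual_sum_def)
next
  case (Cons l L)
  let ?q = "\<lambda>L i j. if j \<in> set L then pdiff (p i j) else p i j"
  have l: "l < n" "l \<notin> set L" using Cons.prems by auto
  have step: "peval n (?q L i) (bump l 1 r) - peval n (?q L i) r = peval n (?q (l # L) i) r" for i
  proof -
    have split: "peval n q s = poly (q l) (real (s l)) * (\<Prod>j\<in>{..<n} - {l}. poly (q j) (real (s j)))" for q s
      unfolding peval_def using l(1) by (subst prod.remove[of _ l]) auto
    have 1: "(\<Prod>j\<in>{..<n} - {l}. poly (?q L i j) (real (bump l 1 r j))) = (\<Prod>j\<in>{..<n} - {l}. poly (?q L i j) (real (r j)))"
      by (rule prod.cong) (auto simp: bump_def)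
    have 2: "(\<Prod>j\<in>{..<n} - {l}. poly (?q (l # L) i j) (real (r j))) = (\<Prod>j\<in>{..<n} - {l}. poly (?q L i j) (real (r j)))"
      by (rule prod.cong) auto
    have 3: "poly (?q (l # L) i l) (real (r l)) = poly (?q L i l) (real (r l) + 1) - poly (?q L i l) (real (r l))"
      using l(2) by (simp add: poly_pdiff)
    have 4: "real (bump l 1 r l) = real (r l) + 1" by (simp add: bump_def)
    show ?thesis unfolding split[of _ "bump l 1 r"] split[of _ r] 1 2 3 4 by (simp only: left_diff_distrib)
  qed
  have "mixed_diff L f (bump l 1 r) = (\<Sum>i\<in>F. w i * peval n (?q L i) (bump l 1 r))"
    "mixed_diff L f r = (\<Sum>i\<in>F. w i * peval n (?q L i) r)"
    using Cons.prems large_bump[OF Cons.prems(3) l(1)] by (auto intro!: Cons.IH)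
  then show ?case
    by (simp only: mixed_diff.simps sum_subtractf[symmetric] right_diff_distrib[symmetric] step)
qed

text \<open>If a factor in \<open>L\<close> is constant, its difference vanishes. Otherwise the
  degrees in \<open>L\<close> are at least 1 and sum to at most \<open>length L\<close>, so they are
  1 in \<open>L\<close> and 0 elsewhere, and what remains is the product of the leading
  coefficients.\<close>

lemma peval_pdiff_const:
  assumes "distinct L" "set L \<subseteq> {..<n}" "(\<Sum>j<n. degree (p j)) \<le> length L" "\<And>j. j < n \<Longrightarrow> 0 < lead_coeff (p j)"
  shows "\<exists>C\<ge>0. \<forall>r. peval n (\<lambda>j. if j \<in> set L then pdiff (p j) else p j) r = C"
proof (cases "\<exists>j\<in>set L. degree (p j) = 0")
  case True
  then obtain j where j: "j \<in> set L" "degree (p j) = 0" by blast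
  have "peval n (\<lambda>j. if j \<in> set L then pdiff (p j) else p j) r = 0" for r
    unfolding peval_def using j assms(2) by (intro prod_zero) (auto intro!: bexI[of _ j] simp: pdiff_degree_0)
  then show ?thesis by auto
next
  case False
  have split: "(\<Sum>j<n. degree (p j)) = (\<Sum>j\<in>set L. degree (p j)) + (\<Sum>j\<in>{..<n} - set L. degree (p j))"
    using assms(2) by (subst sum.subset_diff[of "set L"]) (auto simp: add.commute)
  have ge: "(\<Sum>j\<in>set L. 1) \<le> (\<Sum>j\<in>set L. degree (p j))" using False by (intro sum_mono) (simp add: Suc_le_eq)
  have card: "(\<Sum>j\<in>set L. 1) = length L" using assms(1) by (simp add: distinct_card)
  have d0: "degree (p j) = 0" if "j < n" "j \<notin> set L" for j
  proof -
    have "(\<Sum>j\<in>{..<n} - set L. degree (p j)) = 0" using split ge card assms(3) by linarith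
    then show ?thesis using that by simp
  qed
  have d1: "degree (p j) = 1" if "j \<in> set L" for j
  proof (rule ccontr)
    assume "degree (p j) \<noteq> 1"
    then have "1 < degree (p j)" using False that by (metis less_one linorder_neqE_nat)
    then have "(\<Sum>j\<in>set L. 1) < (\<Sum>j\<in>set L. degree (p j))"
      using False that by (intro sum_strict_mono_ex1) (auto simp: Suc_le_eq)
    then show False using split card assms(3) by linarith
  qed
  have "peval n (\<lambda>j. if j \<in> set L then pdiff (p j) else p j) r = (\<Prod>j<n. lead_coeff (p j))" for r
    unfolding peval_def
  proof (rule prod.cong)
    fix j assume j: "j \<in> {..<n}"
    show "poly (if j \<in> set L then pdiff (p j) else p j) (real (r j)) = lead_coeff (p j)"
    proof (cases "j \<in> set L")
      case True
      then show ?thesis using pdiff_degree_1[OF d1] by simp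
    next
      case False
      then have "degree (p j) = 0" using d0 j by simp
      then obtain a where "p j = [:a:]" by (rule degree_eq_zeroE)
      then show ?thesis using False by simp
    qed
  qed simp
  moreover have "0 \<le> (\<Prod>j<n. lead_coeff (p j))" using assms(4) by (intro prod_nonneg) (auto simp: less_imp_le)
  ultimately show ?thesis by blast
qed

lemma mixed_diff_const:
  assumes f: "eventual_sum n f N F w p" and pos: "positive_sum n N F w p"
    and L: "distinct L" "set L \<subseteq> {..<n}" and deg: "\<And>i. i \<in> F \<Longrightarrow> (\<Sum>j<n. degree (p i j)) \<le> length L"
  shows "\<exists>C\<ge>0. \<forall>r. large n N r \<longrightarrow> mixed_diff L f r = C"
proof -
  have "\<exists>C\<ge>0. \<forall>r. peval n (\<lambda>j. if j \<in> set L then pdiff (p i j) else p i j) r = C" if "i \<in> F" for i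
    using pos that by (intro peval_pdiff_const L deg) (auto simp: positive_sum_def)
  then obtain C where C: "\<And>i. i \<in> F \<Longrightarrow> 0 \<le> C i"
    "\<And>i r. i \<in> F \<Longrightarrow> peval n (\<lambda>j. if j \<in> set L then pdiff (p i j) else p i j) r = C i" by metis
  have "mixed_diff L f r = (\<Sum>i\<in>F. w i * C i)" if "large n N r" for r
    unfolding mixed_diff_eventual_sum[OF f L that] by (rule sum.cong) (simp_all add: C(2))
  moreover have "0 \<le> (\<Sum>i\<in>F. w i * C i)"
    using pos C(1) by (intro sum_nonneg mult_nonneg_nonneg) (auto simp: positive_sum_def less_imp_le)
  ultimately show ?thesis by blast
qed

subsection \<open>Expansion into monomials\<close>

definition exponents :: "nat \<Rightarrow> (nat \<Rightarrow> nat) set" where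
  "exponents n = {\<alpha> \<in> extensional {..<n}. (\<Sum>j<n. \<alpha> j) \<le> n}"

lemma exponents_subset: "exponents n \<subseteq> PiE {..<n} (\<lambda>_. {..n})"
proof
  fix \<alpha> assume a: "\<alpha> \<in> exponents n"
  have "\<alpha> j \<le> n" if "j < n" for j
    using member_le_sum[of j "{..<n}" \<alpha>] a that by (auto simp: exponents_def)
  then show "\<alpha> \<in> PiE {..<n} (\<lambda>_. {..n})" using a by (auto simp: exponents_def PiE_def)
qed

lemma finite_exponents: "finite (exponents n)"
  by (rule finite_subset[OF exponents_subset]) (auto intro: finite_PiE)

lemma peval_monomials:
  assumes "(\<Sum>j<n. degree (p j)) \<le> n"
  shows "peval n p r = (\<Sum>\<alpha>\<in>exponents n. (\<Prod>j<n. coeff (p j) (\<alpha> j)) * (\<Prod>j<n. real (r j) ^ \<alpha> j))"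
proof -
  have dj: "degree (p j) \<le> n" if "j < n" for j
    using member_le_sum[of j "{..<n}" "\<lambda>j. degree (p j)"] assms that by simp
  have "peval n p r = (\<Prod>j<n. \<Sum>a\<le>n. coeff (p j) a * real (r j) ^ a)"
    unfolding peval_def
  proof (rule prod.cong)
    fix j assume "j \<in> {..<n}"
    then show "poly (p j) (real (r j)) = (\<Sum>a\<le>n. coeff (p j) a * real (r j) ^ a)"
      using dj unfolding poly_altdef by (intro sum.mono_neutral_left) (auto simp: coeff_eq_0)
  qed simp
  also have "\<dots> = (\<Sum>\<alpha>\<in>PiE {..<n} (\<lambda>_. {..n}). \<Prod>j<n. coeff (p j) (\<alpha> j) * real (r j) ^ \<alpha> j)"
    by (rule prod_sum_PiE) auto
  also have "\<dots> = (\<Sum>\<alpha>\<in>exponents n. \<Prod>j<n. coeff (p j) (\<alpha> j) * real (r j) ^ \<alpha> j)"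
  proof (rule sum.mono_neutral_right)
    show "\<forall>\<alpha>\<in>PiE {..<n} (\<lambda>_. {..n}) - exponents n. (\<Prod>j<n. coeff (p j) (\<alpha> j) * real (r j) ^ \<alpha> j) = 0"
    proof
      fix \<alpha> assume a: "\<alpha> \<in> PiE {..<n} (\<lambda>_. {..n}) - exponents n"
      then have "\<not> (\<Sum>j<n. \<alpha> j) \<le> n" by (auto simp: exponents_def PiE_def)
      then have "\<not> (\<Sum>j<n. \<alpha> j) \<le> (\<Sum>j<n. degree (p j))" using assms by simp
      then obtain j where j: "j < n" "degree (p j) < \<alpha> j" by (meson lessThan_iff not_less sum_mono)
      then have "coeff (p j) (\<alpha> j) * real (r j) ^ \<alpha> j = 0" by (simp add: coeff_eq_0)
      then show "(\<Prod>j<n. coeff (p j) (\<alpha> j) * real (r j) ^ \<alpha> j) = 0" using j(1) by (intro prod_zero) auto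
    qed
  qed (simp_all add: finite_PiE exponents_subset)
  finally show ?thesis by (simp add: prod.distrib)
qed

text \<open>An exponent vector of total degree at most \<open>n\<close> other than the all-ones
  vector has a zero entry, and the difference in that variable kills its monomial.\<close>

lemma mixed_diff_monomials:
  assumes "\<And>r. large n N r \<Longrightarrow> f r = (\<Sum>\<alpha>\<in>exponents n. c \<alpha> * (\<Prod>j<n. real (r j) ^ \<alpha> j))" "large n N r"
  shows "mixed_diff [0..<n] f r = c (restrict (\<lambda>_. 1) {..<n})"
proof -
  let ?p = "\<lambda>\<alpha> j. monom 1 (\<alpha> j) :: real poly"
  let ?one = "restrict (\<lambda>_. 1) {..<n} :: nat \<Rightarrow> nat"
  have "eventual_sum n f N (exponents n) c ?p"
    unfolding eventual_sum_def peval_def using assms(1) finite_exponents by (simp add: poly_monom)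
  then have "mixed_diff [0..<n] f r
      = (\<Sum>\<alpha>\<in>exponents n. c \<alpha> * peval n (\<lambda>j. if j \<in> set [0..<n] then pdiff (?p \<alpha> j) else ?p \<alpha> j) r)"
    using assms(2) by (intro mixed_diff_eventual_sum) auto
  also have "\<dots> = (\<Sum>\<alpha>\<in>exponents n. if \<alpha> = ?one then c \<alpha> else 0)"
  proof (rule sum.cong)
    fix \<alpha> assume a: "\<alpha> \<in> exponents n"
    show "c \<alpha> * peval n (\<lambda>j. if j \<in> set [0..<n] then pdiff (?p \<alpha> j) else ?p \<alpha> j) r = (if \<alpha> = ?one then c \<alpha> else 0)"
    proof (cases "\<alpha> = ?one")
      case True
      have "pdiff (?p \<alpha> j) = 1" if "j < n" for j
        using that pdiff_degree_1[of "?p \<alpha> j"] by (simp add: True degree_monom_eq one_pCons)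
      then show ?thesis by (simp add: peval_def True)
    next
      case False
      have "\<exists>j<n. \<alpha> j = 0"
      proof (rule ccontr)
        assume "\<not> ?thesis"
        then have ge: "1 \<le> \<alpha> j" if "j < n" for j using that by (simp add: Suc_le_eq)
        have "\<alpha> j = 1" if "j < n" for j
        proof (rule ccontr)
          assume "\<alpha> j \<noteq> 1"
          then have "1 < \<alpha> j" using ge[OF that] by simp
          then have "(\<Sum>j<n. 1) < (\<Sum>j<n. \<alpha> j)" using ge that by (intro sum_strict_mono_ex1) auto
          then show False using a by (simp add: exponents_def)
        qed
        then have "\<alpha> = ?one" using a by (intro extensionalityI[of _ "{..<n}"]) (auto simp: exponents_def)
        then show False using False by simp
      qed
      then obtain j where j: "j < n" "\<alpha> j = 0" by blast
      then have "pdiff (?p \<alpha> j) = 0" by (simp add: pdiff_degree_0)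
      then have "peval n (\<lambda>j. if j \<in> set [0..<n] then pdiff (?p \<alpha> j) else ?p \<alpha> j) r = 0"
        unfolding peval_def using j(1) by (intro prod_zero) (auto intro!: bexI[of _ j])
      then show ?thesis using False by simp
    qed
  qed simp
  also have "\<dots> = c ?one"
    using finite_exponents by (simp add: exponents_def)
  finally show ?thesis .
qed

section \<open>Growth of the Samuel function\<close>

locale noetherian_local = noetherian_cring R for R (structure) +
  fixes m
  assumes local: "local_ring R m"

context noetherian_local
begin

lemma m_maximal: "maximalideal m R" and m_unique: "maximalideal M R \<Longrightarrow> M = m"
  using local by (auto simp: local_ring_def)

lemma m_ideal: "ideal m R"
  using m_maximal by (rule maximalideal.axioms(1))

lemma m_proper: "m \<noteq> carrier R"
  using maximalideal.I_notcarr[OF m_maximal] by simp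

lemma proper_ideal_le_m:
  assumes "ideal I R" "I \<noteq> carrier R"
  shows "I \<subseteq> m"
  using assms
proof (induction rule: noetherian_induct)
  case (step I)
  show ?case
  proof (cases "maximalideal I R")
    case True
    then show ?thesis using m_unique by simp
  next
    case False
    then obtain J where "ideal J R" "I \<subseteq> J" "J \<noteq> I" "J \<noteq> carrier R"
      using step.hyps step.prems by (metis maximalidealI)
    then show ?thesis using step.IH[of J] by blast
  qed
qed

lemma one_notin_m: "\<one> \<notin> m"
  using ideal.one_imp_carrier[OF m_ideal] m_proper by blast

text \<open>Nakayama for a cyclic module: \<open>1 - a\<close> lies outside \<open>m\<close> and is
  therefore a unit.\<close>

lemma unit_minus_mem:
  assumes V: "ideal V R" and z: "z \<in> carrier R" and a: "a \<in> m" and v: "z \<ominus> a \<otimes> z \<in> V"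
  shows "z \<in> V"
proof -
  have ac: "a \<in> carrier R" using ideal_closed(8)[OF m_ideal a] .
  define u where "u = \<one> \<ominus> a"
  have uc: "u \<in> carrier R" using ac by (simp add: u_def)
  have "u \<notin> m"
  proof
    assume "u \<in> m"
    then have "u \<oplus> a \<in> m" using ideal_closed(3)[OF m_ideal _ a] by blast
    moreover have "u \<oplus> a = \<one>" unfolding u_def using ac by algebra
    ultimately show False using one_notin_m by simp
  qed
  have "u \<otimes> \<one> \<in> scaled R u (carrier R)" by (auto simp: scaled_def)
  then have "u \<in> scaled R u (carrier R)" using uc by simp
  then have "scaled R u (carrier R) = carrier R"
    using proper_ideal_le_m[OF scaled_ideal[OF oneideal uc]] \<open>u \<notin> m\<close> by blast
  then obtain w where w: "w \<in> carrier R" "u \<otimes> w = \<one>"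
    using one_closed unfolding scaled_def by (metis (no_types, lifting) image_iff)
  have "w \<otimes> (z \<ominus> a \<otimes> z) \<in> V" by (rule ideal_closed(6)[OF V v w(1)])
  moreover have "w \<otimes> (z \<ominus> a \<otimes> z) = (u \<otimes> w) \<otimes> z" unfolding u_def using w(1) z ac by algebra
  ultimately show ?thesis using w z by simp
qed

text \<open>For \<open>a\<close> in \<open>m\<close>, the submodule generated by \<open>a z\<close>
  is strictly smaller than that generated by \<open>z\<close>, unless \<open>z\<close> lies in
  \<open>V\<close>; hence each factor from \<open>m\<close> lowers the length by at least
  one.\<close>

lemma m_pow_annihilates:
  assumes V: "ideal V R" and "z \<in> carrier R" "quot_length R (scaled R z (carrier R) <+> V) V \<le> enat l"
    and "w \<in> ideal_pow R m l"
  shows "w \<otimes> z \<in> V"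
  using assms(2-)
proof (induction l arbitrary: z w)
  case 0
  note sc = scaled_ideal[OF oneideal 0(1)]
  have "scaled R z (carrier R) <+> V = V"
    using 0 by (intro quot_length_eq_0D[OF V add_ideals[OF sc V] set_add_subset_r[OF sc V]]) (simp add: zero_enat_def[symmetric])
  moreover have "z \<otimes> \<one> \<in> scaled R z (carrier R)" by (auto simp: scaled_def)
  ultimately have "z \<in> V" using set_add_subset_l[OF sc V] 0(1) by auto
  moreover have "w \<in> carrier R" using 0(3) ideal_closed(8)[OF ideal_pow_ideal[OF m_ideal]] by blast
  ultimately show ?case using ideal_closed(6)[OF V] by blast
next
  case (Suc l)
  note z = Suc.prems(1)
  have wc: "w \<in> carrier R" using Suc.prems(3) ideal_closed(8)[OF ideal_pow_ideal[OF m_ideal]] by blast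
  show ?case
  proof (cases "z \<in> V")
    case True
    then show ?thesis using ideal_closed(6)[OF V] wc by blast
  next
    case False
    have "b \<otimes> a \<in> colon R V z" if b: "b \<in> ideal_pow R m l" and a: "a \<in> m" for b a
    proof -
      have c: "a \<in> carrier R" "b \<in> carrier R"
        using a b ideal_closed(8)[OF m_ideal] ideal_closed(8)[OF ideal_pow_ideal[OF m_ideal]] by blast+
      define y where "y = a \<otimes> z"
      have y: "y \<in> carrier R" using c z by (simp add: y_def)
      note scy = scaled_ideal[OF oneideal y] and scz = scaled_ideal[OF oneideal z]
      have "scaled R y (carrier R) \<subseteq> scaled R z (carrier R)"
      proof
        fix s assume "s \<in> scaled R y (carrier R)"
        then obtain t where "t \<in> carrier R" "s = y \<otimes> t" by (auto simp: scaled_def)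
        then have "s = z \<otimes> (a \<otimes> t)" "a \<otimes> t \<in> carrier R" using c z by (simp_all add: y_def m_ac)
        then show "s \<in> scaled R z (carrier R)" by (auto simp: scaled_def)
      qed
      then have sub: "scaled R y (carrier R) <+> V \<subseteq> scaled R z (carrier R) <+> V" by (intro set_add_mono) auto
      \<comment> \<open>Strictness: \<open>z = t a z + v\<close> would put
        \<open>(1 - t a) z\<close>, hence \<open>z\<close>, into \<open>V\<close>.\<close>
      have "z \<notin> scaled R y (carrier R) <+> V"
      proof
        assume "z \<in> scaled R y (carrier R) <+> V"
        then obtain s v where sv: "s \<in> scaled R y (carrier R)" "v \<in> V" "z = s \<oplus> v" by (rule set_add_memE)
        then obtain t where t: "t \<in> carrier R" "s = y \<otimes> t" by (auto simp: scaled_def)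
        have vc: "v \<in> carrier R" using ideal_closed(8)[OF V sv(2)] .
        have "z = y \<otimes> t \<oplus> v" using sv t by simp
        then have "z \<ominus> y \<otimes> t = v" using vc y t(1) z by algebra
        moreover have "(t \<otimes> a) \<otimes> z = y \<otimes> t" using t(1) c z by (simp add: y_def m_ac)
        ultimately have "z \<ominus> (t \<otimes> a) \<otimes> z \<in> V" using sv(2) by simp
        then have "z \<in> V" using unit_minus_mem[OF V z ideal_closed(6)[OF m_ideal a t(1)]] by simp
        then show False using False by simp
      qed
      moreover have "z \<otimes> \<one> \<in> scaled R z (carrier R)" by (auto simp: scaled_def)
      then have "z \<in> scaled R z (carrier R) <+> V" using set_add_subset_l[OF scz V] z by auto
      ultimately have "scaled R y (carrier R) <+> V \<subset> scaled R z (carrier R) <+> V" using sub by blast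
      then have "quot_length R (scaled R y (carrier R) <+> V) V + 1 \<le> quot_length R (scaled R z (carrier R) <+> V) V"
        by (rule quot_length_extend[OF V add_ideals[OF scy V] add_ideals[OF scz V] set_add_subset_r[OF scy V]])
      also have "\<dots> \<le> enat l + 1" using Suc.prems(2) by (simp add: one_enat_def)
      finally have "quot_length R (scaled R y (carrier R) <+> V) V \<le> enat l" by simp
      from Suc.IH[OF y this b] show ?thesis
        unfolding y_def colon_def using c z by (simp add: m_ac)
    qed
    then have "ideal_pow R m (Suc l) \<subseteq> colon R V z"
      unfolding ideal_pow_Suc by (intro ideal_prod_least colon_ideal V z)
    then have "z \<otimes> w \<in> V" using Suc.prems(3) by (auto simp: colon_def)
    then show ?thesis using m_comm[OF z wc] by simp
  qed
qed

lemma finite_colength_contains_m_pow: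
  assumes "finite_colength R V"
  obtains c where "ideal_pow R m c \<subseteq> V"
proof -
  have V: "ideal V R" "quot_length R (carrier R) V \<noteq> \<infinity>" using assms by (simp_all add: finite_colength_iff)
  then obtain l where l: "quot_length R (carrier R) V = enat l" by auto
  have "quot_length R (scaled R \<one> (carrier R) <+> V) V \<le> enat l"
    unfolding l[symmetric]
    by (intro quot_length_mono) (use ideal_closed(1)[OF add_ideals[OF scaled_ideal[OF oneideal one_closed] V(1)]] in auto)
  then have "w \<otimes> \<one> \<in> V" if "w \<in> ideal_pow R m l" for w
    using m_pow_annihilates[OF V(1) one_closed _ that] by blast
  then have "ideal_pow R m l \<subseteq> V"
    using ideal_closed(8)[OF ideal_pow_ideal[OF m_ideal]] by (metis r_one subsetI)
  then show ?thesis using that by blast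
qed

lemma finite_colength_m: "finite_colength R m"
proof -
  have "quot_length R (carrier R) m \<le> 1"
    unfolding quot_length_def
  proof (rule chain_height_leI)
    fix k C assume C: "strict_chain {W. ideal W R \<and> m \<subseteq> W \<and> W \<subseteq> carrier R} k C"
    have C2: "C i = m \<or> C i = carrier R" if "i \<le> k" for i
      using C that maximalideal.I_maximal[OF m_maximal, of "C i"] by (simp add: strict_chain_def)
    have "k \<le> 1"
    proof (rule ccontr)
      assume "\<not> k \<le> 1"
      then have k: "0 < k" "1 < k" "0 \<le> k" "1 \<le> k" "2 \<le> k" by auto
      have "C 0 \<subset> C (Suc 0)" "C 1 \<subset> C (Suc 1)" using C k(1,2) unfolding strict_chain_def by blast+
      then show False using C2[OF k(3)] C2[OF k(4)] C2[OF k(5)] ideal_closed(1)[OF m_ideal]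
        by (auto simp: numeral_2_eq_2)
    qed
    then show "enat k \<le> 1" by (simp add: one_enat_def)
  qed
  then show ?thesis
    using m_ideal enat_ile[of "quot_length R (carrier R) m" 1] by (auto simp: finite_colength_iff one_enat_def)
qed

text \<open>The Samuel function of \<open>R/Q\<close> with respect to \<open>m\<close>.\<close>

abbreviation mfun :: "'a set \<Rightarrow> nat \<Rightarrow> real" where
  "mfun Q k \<equiv> qlen R (carrier R) (Q <+> ideal_pow R m k)"

lemma sum_m_pow:
  assumes "ideal Q R"
  shows "ideal (Q <+> ideal_pow R m k) R" "finite_colength R (Q <+> ideal_pow R m k)"
    "Q \<subseteq> Q <+> ideal_pow R m k" "ideal_pow R m k \<subseteq> Q <+> ideal_pow R m k"
proof -
  note mk = ideal_pow_ideal[OF m_ideal]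
  show id: "ideal (Q <+> ideal_pow R m k) R" by (rule add_ideals[OF assms mk])
  show sub: "ideal_pow R m k \<subseteq> Q <+> ideal_pow R m k" by (rule set_add_subset_r[OF assms mk])
  show "Q \<subseteq> Q <+> ideal_pow R m k" by (rule set_add_subset_l[OF assms mk])
  show "finite_colength R (Q <+> ideal_pow R m k)"
    by (rule finite_colength_mono[OF finite_colength_pow[OF finite_colength_m] id sub])
qed

text \<open>Multiplication by \<open>a\<close> on \<open>R/V\<close>, with
  \<open>V = Q + m^k\<close>, has image isomorphic to \<open>R/(V : a)\<close> and cokernel
  \<open>R/(aR + V)\<close>.\<close>

lemma mfun_split:
  assumes Q: "ideal Q R" and a: "a \<in> carrier R"
  shows "mfun Q k = qlen R (carrier R) (scaled R a (carrier R) <+> (Q <+> ideal_pow R m k))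
      + qlen R (carrier R) (colon R (Q <+> ideal_pow R m k) a)"
proof -
  let ?V = "Q <+> ideal_pow R m k"
  note V = sum_m_pow(1)[OF Q] and sc = scaled_ideal[OF oneideal a]
  have "mfun Q k = qlen R (carrier R) (scaled R a (carrier R) <+> ?V) + qlen R (scaled R a (carrier R) <+> ?V) ?V"
    by (rule qlen_add[OF V add_ideals[OF sc V] oneideal set_add_subset_r[OF sc V] ideal_closed(1)[OF add_ideals[OF sc V]]])
      (use sum_m_pow(2)[OF Q] in \<open>simp add: finite_colength_iff\<close>)
  moreover have "quot_length R (scaled R a (carrier R) <+> ?V) ?V = quot_length R (carrier R) (colon R ?V a)"
    by (rule quot_length_scaled[OF colon_ideal[OF V a] oneideal V a]) (auto simp: colon_def)
  ultimately show ?thesis by (simp add: qlen_def)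
qed

lemma mfun_le_split:
  assumes Q: "ideal Q R" and a: "a \<in> carrier R" and Q': "ideal Q' R" and sub: "Q' <+> ideal_pow R m l \<subseteq> colon R (Q <+> ideal_pow R m k) a"
  shows "mfun Q k \<le> mfun (scaled R a (carrier R) <+> Q) k + mfun Q' l"
proof -
  note sc = scaled_ideal[OF oneideal a] and V = sum_m_pow(1)[OF Q]
  note Q1 = add_ideals[OF sc Q] and W = add_ideals[OF sc V]
  have "(scaled R a (carrier R) <+> Q) <+> ideal_pow R m k \<subseteq> scaled R a (carrier R) <+> (Q <+> ideal_pow R m k)"
    by (intro set_add_least W set_add_subset_l[OF sc V] subset_trans[OF sum_m_pow(3)[OF Q] set_add_subset_r[OF sc V]]
        subset_trans[OF sum_m_pow(4)[OF Q] set_add_subset_r[OF sc V]])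
  then have "qlen R (carrier R) (scaled R a (carrier R) <+> (Q <+> ideal_pow R m k)) \<le> mfun (scaled R a (carrier R) <+> Q) k"
    by (rule qlen_carrier_antimono[OF sum_m_pow(2)[OF Q1] W])
  moreover have "qlen R (carrier R) (colon R (Q <+> ideal_pow R m k) a) \<le> mfun Q' l"
    by (rule qlen_carrier_antimono[OF sum_m_pow(2)[OF Q'] colon_ideal[OF V a] sub])
  ultimately show ?thesis using mfun_split[OF Q a, of k] by simp
qed

text \<open>The dimension of \<open>R/Q\<close> is at most \<open>d\<close>, with primes of the
  quotient read as primes of \<open>R\<close> above \<open>Q\<close>.\<close>

definition dim_le :: "'a set \<Rightarrow> nat \<Rightarrow> bool" where
  "dim_le Q d \<longleftrightarrow> (\<forall>k C. strict_chain {P. primeideal P R \<and> Q \<subseteq> P} k C \<longrightarrow> k \<le> d)"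

lemma dim_le_mono: "dim_le Q d \<Longrightarrow> Q \<subseteq> Q' \<Longrightarrow> dim_le Q' d"
  unfolding dim_le_def strict_chain_def by blast

lemma m_prime: "primeideal m R"
  by (rule maximalideal_prime[OF m_maximal])

lemma dim_le_prime:
  assumes Q: "primeideal Q R" and "dim_le Q d" "Q \<subset> Q'"  "Q' \<subseteq> m"
  shows "\<exists>d'. d = Suc d' \<and> dim_le Q' d'"
proof -
  have *: "Suc k \<le> d" if C: "strict_chain {P. primeideal P R \<and> Q' \<subseteq> P} k C" for k C
  proof -
    have "strict_chain {P. primeideal P R \<and> Q \<subseteq> P} (Suc k) (\<lambda>i. case i of 0 \<Rightarrow> Q | Suc i \<Rightarrow> C i)"
      using C Q assms(3) unfolding strict_chain_def by (auto split: nat.splits)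
    then show ?thesis using assms(2) by (auto simp: dim_le_def)
  qed
  have "strict_chain {P. primeideal P R \<and> Q' \<subseteq> P} 0 (\<lambda>_. m)"
    using m_prime assms(4) by (simp add: strict_chain_def)
  from *[OF this] obtain d' where "d = Suc d'" by (cases d) auto
  then show ?thesis using * by (auto simp: dim_le_def)
qed

text \<open>If \<open>Q\<close> is proper and not prime, some \<open>ab\<close> in \<open>Q\<close>
  splits the length into parts for \<open>Q + aR\<close> and \<open>Q : a\<close>, both strictly
  larger ideals. If \<open>Q\<close> is prime and not \<open>m\<close>, an \<open>x\<close> in
  \<open>m\<close> outside \<open>Q\<close> lowers the dimension, and the increments of the Samuel
  function are bounded by the function of \<open>Q + xR\<close>.\<close>

theorem mfun_upper_bound:
  assumes "ideal Q R" "dim_le Q d"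
  shows "\<exists>C\<ge>0. \<forall>k\<ge>1. mfun Q k \<le> C * real k ^ d"
  using assms
proof (induction arbitrary: d rule: noetherian_induct)
  case (step Q)
  note Q = step.hyps
  show ?case
  proof (cases "Q = carrier R")
    case True
    have "mfun Q k = 0" for k
      using sum_m_pow(3)[OF Q, of k] ideal_closed(1)[OF sum_m_pow(1)[OF Q, of k]] True by simp
    then show ?thesis by (intro exI[of _ 0]) simp
  next
    case proper: False
    then have Qm: "Q \<subseteq> m" using proper_ideal_le_m[OF Q] by blast
    show ?thesis
    proof (cases "primeideal Q R")
      case prime: True
      show ?thesis
      proof (cases "Q = m")
        case True
        have "mfun Q k \<le> qlen R (carrier R) m * real k ^ d" if "k \<ge> 1" for k
        proof -
          have "mfun Q k \<le> qlen R (carrier R) m"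
            using sum_m_pow(1,3)[OF Q, of k] True by (intro qlen_carrier_antimono finite_colength_m) auto
          also have "\<dots> \<le> qlen R (carrier R) m * real k ^ d"
            using mult_left_mono[of 1 "real k ^ d" "qlen R (carrier R) m"] that by (simp add: one_le_power)
          finally show ?thesis .
        qed
        then show ?thesis by (intro exI[of _ "qlen R (carrier R) m"]) simp
      next
        case False
        then obtain x where x: "x \<in> m" "x \<notin> Q" using Qm by blast
        have xc: "x \<in> carrier R" using ideal_closed(8)[OF m_ideal x(1)] .
        note sc = scaled_ideal[OF oneideal xc]
        let ?Q1 = "scaled R x (carrier R) <+> Q"
        have "x \<otimes> \<one> \<in> scaled R x (carrier R)" by (auto simp: scaled_def)
        then have "x \<in> ?Q1" using set_add_subset_l[OF sc Q] xc by auto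
        then have Q1: "ideal ?Q1 R" "Q \<subset> ?Q1" using add_ideals[OF sc Q] set_add_subset_r[OF sc Q] x by auto
        have "scaled R x (carrier R) \<subseteq> m" using ideal_closed(7)[OF m_ideal x(1)] by (auto simp: scaled_def)
        then have "?Q1 \<subseteq> m" using Qm by (intro set_add_least m_ideal)
        then obtain d' where d': "d = Suc d'" "dim_le ?Q1 d'"
          using dim_le_prime[OF prime step.prems Q1(2)] by blast
        obtain C where C: "C \<ge> 0" "\<And>k. k \<ge> 1 \<Longrightarrow> mfun ?Q1 k \<le> C * real k ^ d'"
          using step.IH[OF Q1 d'(2)] by blast
        \<comment> \<open>Since \<open>x\<close> lies in \<open>m\<close>, it maps
          \<open>Q + m^k\<close> into \<open>Q + m^(k+1)\<close>, so the colon term at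
          \<open>Suc k\<close> is at most \<open>mfun Q k\<close>.\<close>
        have rec: "mfun Q (Suc k) \<le> C * real (Suc k) ^ d' + mfun Q k" for k
        proof -
          have "x \<otimes> u \<in> Q <+> ideal_pow R m (Suc k)" if u: "u \<in> Q <+> ideal_pow R m k" for u
          proof -
            obtain q w where qw: "q \<in> Q" "w \<in> ideal_pow R m k" "u = q \<oplus> w" using u by (rule set_add_memE)
            have c: "q \<in> carrier R" "w \<in> carrier R"
              using ideal_closed(8)[OF Q qw(1)] ideal_closed(8)[OF ideal_pow_ideal[OF m_ideal] qw(2)] .
            have "w \<otimes> x \<in> ideal_pow R m (Suc k)" unfolding ideal_pow_Suc by (rule ideal_prod.prod[OF qw(2) x(1)])
            moreover have "x \<otimes> q \<in> Q" using ideal_closed(6)[OF Q qw(1) xc] .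
            ultimately have "x \<otimes> q \<oplus> w \<otimes> x \<in> Q <+> ideal_pow R m (Suc k)" by (rule set_add_memI[rotated])
            moreover have "x \<otimes> u = x \<otimes> q \<oplus> w \<otimes> x" using qw(3) c xc by (simp add: r_distr m_comm)
            ultimately show ?thesis by simp
          qed
          then have "Q <+> ideal_pow R m k \<subseteq> colon R (Q <+> ideal_pow R m (Suc k)) x"
            using ideal_closed(8)[OF sum_m_pow(1)[OF Q]] by (auto simp: colon_def)
          from mfun_le_split[OF Q xc Q this] show ?thesis using C(2)[of "Suc k"] by simp
        qed
        have "mfun Q k \<le> real k * (C * real k ^ d')" for k
        proof (induction k)
          case 0
          have "Q <+> ideal_pow R m 0 = carrier R"
            using sum_m_pow(4)[OF Q, of 0] ideal_closed(1)[OF sum_m_pow(1)[OF Q, of 0]] by (simp add: ideals_set_simps)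
          then show ?case by simp
        next
          case (Suc k)
          have "real k * (C * real k ^ d') \<le> real k * (C * real (Suc k) ^ d')"
            using C(1) by (intro mult_left_mono power_mono) auto
          then have "mfun Q (Suc k) \<le> C * real (Suc k) ^ d' + real k * (C * real (Suc k) ^ d')"
            using rec[of k] Suc by linarith
          then show ?case by (simp add: algebra_simps)
        qed
        then show ?thesis using C(1) d'(1) by (intro exI[of _ C]) (simp add: mult_ac)
      qed
    next
      case False
      then obtain a b where ab: "a \<in> carrier R" "b \<in> carrier R" "a \<otimes> b \<in> Q" "a \<notin> Q" "b \<notin> Q"
        using primeidealI[OF Q is_cring] proper by metis
      note sc = scaled_ideal[OF oneideal ab(1)]
      let ?Q1 = "scaled R a (carrier R) <+> Q" and ?Q2 = "colon R Q a"
      have "a \<otimes> \<one> \<in> scaled R a (carrier R)" by (auto simp: scaled_def)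
      then have "a \<in> ?Q1" using set_add_subset_l[OF sc Q] ab by auto
      then have Q1: "ideal ?Q1 R" "Q \<subset> ?Q1" using add_ideals[OF sc Q] set_add_subset_r[OF sc Q] ab by auto
      have "b \<in> ?Q2" "Q \<subseteq> ?Q2" using ab ideal_closed(6,8)[OF Q] by (auto simp: colon_def)
      then have Q2: "ideal ?Q2 R" "Q \<subset> ?Q2" using colon_ideal[OF Q ab(1)] ab by auto
      obtain C1 where C1: "C1 \<ge> 0" "\<And>k. k \<ge> 1 \<Longrightarrow> mfun ?Q1 k \<le> C1 * real k ^ d"
        using step.IH[OF Q1 dim_le_mono[OF step.prems]] Q1(2) by blast
      obtain C2 where C2: "C2 \<ge> 0" "\<And>k. k \<ge> 1 \<Longrightarrow> mfun ?Q2 k \<le> C2 * real k ^ d"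
        using step.IH[OF Q2 dim_le_mono[OF step.prems]] Q2(2) by blast
      have "mfun Q k \<le> (C1 + C2) * real k ^ d" if "k \<ge> 1" for k
      proof -
        have "?Q2 <+> ideal_pow R m k \<subseteq> colon R (Q <+> ideal_pow R m k) a"
        proof (rule set_add_least[OF colon_ideal[OF sum_m_pow(1)[OF Q] ab(1)]])
          show "?Q2 \<subseteq> colon R (Q <+> ideal_pow R m k) a" using sum_m_pow(3)[OF Q, of k] by (auto simp: colon_def)
          show "ideal_pow R m k \<subseteq> colon R (Q <+> ideal_pow R m k) a"
            using sum_m_pow(4)[OF Q, of k] ideal_closed(6,8)[OF ideal_pow_ideal[OF m_ideal, of k]] ab(1)
            unfolding colon_def by blast
        qed
        from mfun_le_split[OF Q ab(1) Q2(1) this] show ?thesis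
          using C1(2)[OF that] C2(2)[OF that] by (simp add: algebra_simps)
      qed
      then show ?thesis using C1(1) C2(1) by (intro exI[of _ "C1 + C2"]) simp
    qed
  qed
qed

end

text \<open>The graded submodule with components \<open>m^k \<inter> T\<close> is exhausted by those
  generated in degrees up to \<open>t\<close>. The chain condition makes these stationary at some
  \<open>c\<close>, which gives \<open>m^(k+c) \<inter> T = m^k (m^c \<inter> T)\<close>.\<close>

lemma (in noetherian_cring) artin_rees:
  assumes m: "ideal m R" and T: "ideal T R"
  obtains c where "\<And>k. ideal_pow R m (k + c) \<inter> T \<subseteq> ideal_pow R m k \<cdot> T"
proof -
  have m': "\<forall>j<Suc 0. ideal ((\<lambda>_. m) j) R" using m by simp
  obtain S where S: "generator_list (Suc 0) (\<lambda>_. m) S" using generator_list_exists[OF m'] by blast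
  have S': "x \<in> m" "j = 0" if "(x, j) \<in> set S" for x j
    using S that by (auto simp: generator_list_def)
  have "\<exists>W. family R W \<and> stable R S W \<and> concentrated R (\<lambda>_. 0) \<subseteq> W (\<lambda>_. 0) \<and> family_acc R S (\<lambda>_. {\<zero>}) W"
    by (rule family_acc_generators) (use S'(1) ideal_closed(8)[OF m] in blast)
  then obtain W where W: "family R W" "stable R S W" "concentrated R (\<lambda>_. 0) \<subseteq> W (\<lambda>_. 0)" "family_acc R S (\<lambda>_. {\<zero>}) W"
    by blast
  have W0: "carrier R \<subseteq> W (\<lambda>_. 0)" using W(3) by (simp add: concentrated_def)
  note mk = ideal_pow_ideal[OF m]
  have Wm: "ideal_pow R m (r 0) \<subseteq> W r" if "supported (Suc 0) r" for r
    using stable_family_contains_mprod[OF m' S W(1,2) W0 that] mprod_const[OF m, of "Suc 0" r] by simp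
  define T' where "T' k = ideal_pow R m k \<inter> T" for k
  have T': "ideal (T' k) R" for k unfolding T'_def by (rule i_intersect[OF mk T])
  \<comment> \<open>The degree \<open>k\<close> component of the submodule generated in degrees up
    to \<open>t\<close>: it is \<open>T' k\<close> for \<open>k \<le> t\<close> and
    \<open>m^(k-t) T' t\<close> beyond, and truncated subtraction with \<open>min\<close> covers
    both.\<close>
  define V where "V t k = ideal_pow R m (k - t) \<cdot> T' (min k t)" for t k
  have Vid: "ideal (V t k) R" for t k unfolding V_def by (rule ideal_prod_is_ideal[OF mk T'])
  have V_le: "V t k = T' k" if "k \<le> t" for t k
    using that ideal_prod_one_l[OF T'] by (simp add: V_def min_def ideals_set_simps)
  have mT': "ideal_pow R m (Suc 0) \<cdot> T' k \<subseteq> T' (Suc k)" for k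
  proof (rule ideal_prod_least[OF T'])
    fix a b assume a: "a \<in> ideal_pow R m (Suc 0)" and b: "b \<in> T' k"
    have "a \<in> m" using a unfolding ideal_pow_1[OF m] .
    have "b \<otimes> a \<in> ideal_pow R m (Suc k)"
      unfolding ideal_pow_Suc using b \<open>a \<in> m\<close> by (intro ideal_prod.prod) (auto simp: T'_def)
    moreover have "a \<otimes> b = b \<otimes> a"
      using ideal_closed(8)[OF m \<open>a \<in> m\<close>] ideal_closed(8)[OF T' b] by (simp add: m_comm)
    moreover have "a \<otimes> b \<in> T"
      using b ideal_closed(6)[OF T] ideal_closed(8)[OF m \<open>a \<in> m\<close>] by (auto simp: T'_def)
    ultimately show "a \<otimes> b \<in> T' (Suc k)" by (simp add: T'_def)
  qed
  have Vinc: "V t k \<subseteq> V (Suc t) k" for t k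
  proof (cases "k \<le> t")
    case True
    then show ?thesis by (simp add: V_le)
  next
    case False
    then have kt: "k - t = (k - Suc t) + Suc 0" by simp
    have "V t k = ideal_pow R m (k - Suc t + Suc 0) \<cdot> T' t"
      unfolding V_def kt[symmetric] using False by (simp add: min_def)
    also have "\<dots> = ideal_pow R m (k - Suc t) \<cdot> (ideal_pow R m (Suc 0) \<cdot> T' t)"
      unfolding ideal_pow_add[OF m] by (rule ideal_prod_assoc[OF mk mk T'])
    also have "\<dots> \<subseteq> ideal_pow R m (k - Suc t) \<cdot> T' (Suc t)" by (rule ideal_prod_mono[OF order_refl mT'])
    also have "\<dots> = V (Suc t) k" using False by (simp only: V_def min_absorb2 not_le Suc_le_eq)
    finally show ?thesis .
  qed
  have Vm: "V t k \<subseteq> ideal_pow R m k" for t k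
  proof (cases "k \<le> t")
    case True
    then show ?thesis by (auto simp: V_le T'_def)
  next
    case False
    have "V t k \<subseteq> ideal_pow R m (k - t) \<cdot> ideal_pow R m t"
      unfolding V_def using False by (intro ideal_prod_mono) (auto simp: T'_def)
    then show ?thesis using False by (simp add: ideal_pow_add[OF m, symmetric])
  qed
  have Vs: "x \<otimes> u \<in> V t (Suc k)" if "x \<in> m" "u \<in> V t k" for x u t k
  proof -
    have xu: "x \<otimes> u \<in> ideal_pow R m (Suc 0) \<cdot> V t k"
      using that unfolding ideal_pow_1[OF m] by (intro ideal_prod.prod)
    show ?thesis
    proof (cases "k < t")
      case True
      then show ?thesis using xu mT'[of k] V_le[of k t] V_le[of "Suc k" t] by auto
    next
      case False
      then have k: "Suc k - t = Suc 0 + (k - t)" "min (Suc k) t = min k t" by auto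
      have "ideal_pow R m (Suc 0) \<cdot> V t k = V t (Suc k)"
        unfolding V_def k ideal_pow_add[OF m] by (rule ideal_prod_assoc[OF mk mk T', symmetric])
      then show ?thesis using xu by simp
    qed
  qed
  define Z where "Z t r = (if supported (Suc 0) r then V t (r 0) else {\<zero>})" for t and r :: "nat \<Rightarrow> nat"
  have Zf: "family R (Z t)" for t using Vid zeroideal by (simp add: Z_def family_def)
  have "subfamily R S (\<lambda>_. {\<zero>}) W (Z t)" for t
    unfolding subfamily_def
  proof (intro conjI allI Zf)
    show "stable R S (Z t)"
      unfolding stable_def
    proof (intro allI impI)
      fix x j r u assume xj: "(x, j) \<in> set S" and u: "u \<in> Z t r"
      have j: "j = 0" and x: "x \<in> m" using S'[OF xj] by auto
      have sup: "supported (Suc 0) (bump j 1 r) \<longleftrightarrow> supported (Suc 0) r" by (simp add: j supported_def bump_def)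
      show "x \<otimes> u \<in> Z t (bump j 1 r)"
      proof (cases "supported (Suc 0) r")
        case True
        then show ?thesis using Vs[OF x, of u t "r 0"] u sup by (simp add: Z_def j bump_def)
      next
        case False
        then show ?thesis using u sup ideal_closed(8)[OF m x] by (simp add: Z_def)
      qed
    qed
    show "{\<zero>} \<subseteq> Z t r" for r using ideal_closed(2)[OF familyD[OF Zf]] by simp
    show "Z t r \<subseteq> W r" for r
      using subset_trans[OF Vm Wm] ideal_closed(2)[OF familyD[OF W(1)]] by (simp add: Z_def)
  qed
  moreover have "Z t r \<subseteq> Z (Suc t) r" for t r using Vinc by (simp add: Z_def)
  ultimately obtain c where c: "\<And>t. t \<ge> c \<Longrightarrow> Z t = Z c"
    using family_accD[OF W(4), of Z] by metis
  have "ideal_pow R m (k + c) \<inter> T \<subseteq> ideal_pow R m k \<cdot> T" for k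
  proof -
    define r where "r = (\<lambda>j::nat. if j = 0 then k + c else 0)"
    have r: "supported (Suc 0) r" by (simp add: r_def supported_def)
    have "Z (k + c) r = Z c r" using c[of "k + c"] by simp
    then have "V (k + c) (k + c) = V c (k + c)" using r by (simp add: Z_def r_def)
    then have "T' (k + c) = V c (k + c)" by (simp add: V_le)
    also have "\<dots> \<subseteq> ideal_pow R m k \<cdot> T" unfolding V_def by (simp add: ideal_prod_mono T'_def min_def)
    finally show ?thesis by (simp add: T'_def)
  qed
  then show ?thesis using that by blast
qed

section \<open>Lower bounds along chains of primes\<close>

lemma power_add_le:
  fixes a c :: real
  assumes "0 \<le> a" "0 \<le> c"
  shows "(a + c) ^ Suc d \<le> a ^ Suc d + real (Suc d) * c * (a + c) ^ d"
proof (induction d)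
  case (Suc d)
  have "(a + c) * (a + c) ^ Suc d \<le> (a + c) * (a ^ Suc d + real (Suc d) * c * (a + c) ^ d)"
    using Suc assms by (intro mult_left_mono) auto
  also have "\<dots> = a ^ Suc (Suc d) + c * a ^ Suc d + real (Suc d) * c * (a + c) ^ Suc d"
    by (simp add: algebra_simps)
  also have "c * a ^ Suc d \<le> c * (a + c) ^ Suc d"
    using assms by (intro mult_left_mono power_mono) auto
  finally show ?case by (simp add: algebra_simps)
qed simp

text \<open>Each step of length \<open>c\<close> gains a multiple of \<open>k^d\<close>, and about
  \<open>k/c\<close> steps lead to \<open>k\<close>, so the order of growth rises by one.\<close>

lemma growth_from_recursion:
  fixes h :: "nat \<Rightarrow> real"
  assumes "\<epsilon>' > 0" "c \<ge> (1::nat)" and one: "\<And>k. k \<ge> 1 \<Longrightarrow> 1 \<le> h k"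
    and rec: "\<And>k. k \<ge> 1 \<Longrightarrow> h k + \<epsilon>' * real (k + c) ^ d \<le> h (k + c)"
  shows "\<exists>\<epsilon>>0. \<forall>k\<ge>1. \<epsilon> * real k ^ Suc d \<le> h k"
proof -
  \<comment> \<open>The first bound pays for the step from \<open>l\<close> to \<open>l + c\<close>
    through \<open>power_add_le\<close>; the second covers the start \<open>k \<le> c\<close>, where
    only \<open>1 \<le> h k\<close> is available.\<close>
  define \<epsilon> where "\<epsilon> = min (\<epsilon>' / (real (Suc d) * real c)) (1 / real c ^ Suc d)"
  have e: "0 < \<epsilon>" "\<epsilon> * (real (Suc d) * real c) \<le> \<epsilon>'" "\<epsilon> * real c ^ Suc d \<le> 1"
  proof -
    have c: "0 < real (Suc d) * real c" "0 < real c ^ Suc d" using assms(2) by auto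
    then show "0 < \<epsilon>" using assms(1) by (simp add: \<epsilon>_def)
    show "\<epsilon> * (real (Suc d) * real c) \<le> \<epsilon>'" 
      by (subst pos_le_divide_eq[OF c(1), symmetric]) (simp only: \<epsilon>_def min.cobounded1)
    show "\<epsilon> * real c ^ Suc d \<le> 1" 
      by (subst pos_le_divide_eq[OF c(2), symmetric]) (simp only: \<epsilon>_def min.cobounded2)
  qed
  have "\<epsilon> * real k ^ Suc d \<le> h k" if "k \<ge> 1" for k
    using that
  proof (induction k rule: less_induct)
    case (less k)
    show ?case
    proof (cases "k \<le> c")
      case True
      have "\<epsilon> * real k ^ Suc d \<le> \<epsilon> * real c ^ Suc d"
        using True e(1) by (intro mult_left_mono power_mono) auto
      then show ?thesis using e(3) one[OF less.prems] by linarith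
    next
      case False
      define l where "l = k - c"
      have k: "k = l + c" "l \<ge> 1" "l < k" using False assms(2) by (auto simp: l_def)
      have "\<epsilon> * real k ^ Suc d \<le> \<epsilon> * (real l ^ Suc d + real (Suc d) * real c * real k ^ d)"
        using power_add_le[of "real l" "real c" d] e(1) k(1) by (intro mult_left_mono) auto
      also have "\<dots> = \<epsilon> * real l ^ Suc d + (\<epsilon> * (real (Suc d) * real c)) * real k ^ d"
        by (simp only: distrib_left mult.assoc)
      also have "\<dots> \<le> h l + \<epsilon>' * real k ^ d"
        using less.IH[OF k(3,2)] e(2) by (intro add_mono mult_right_mono) auto
      also have "\<dots> \<le> h k" using rec[OF k(2)] k(1) by simp
      finally show ?thesis .
    qed
  qed
  then show ?thesis using e(1) by blast
qed

context noetherian_local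
begin

lemma mfun_ge_1:
  assumes "ideal Q R" "Q \<subseteq> m" "k \<ge> 1"
  shows "1 \<le> mfun Q k"
proof -
  have "ideal_pow R m k \<subseteq> m" using ideal_pow_antimono[OF m_ideal assms(3)] unfolding One_nat_def ideal_pow_1[OF m_ideal] .
  then have "Q <+> ideal_pow R m k \<subseteq> m" by (rule set_add_least[OF m_ideal assms(2)])
  then have "Q <+> ideal_pow R m k \<noteq> carrier R" using one_notin_m by auto
  then have "quot_length R (carrier R) (Q <+> ideal_pow R m k) \<noteq> 0"
    using quot_length_eq_0D[OF sum_m_pow(1)[OF assms(1)] oneideal ideal_closed(1)[OF sum_m_pow(1)[OF assms(1)]]] by auto
  moreover obtain l where "quot_length R (carrier R) (Q <+> ideal_pow R m k) = enat l"
    using sum_m_pow(2)[OF assms(1), of k] by (auto simp: finite_colength_iff)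
  ultimately show ?thesis by (cases l) (auto simp: qlen_def zero_enat_def)
qed

text \<open>If \<open>x u = p + z\<close> with \<open>z\<close> in \<open>m^(k+c)\<close>, then
  \<open>z\<close> lies in \<open>xR + P\<close>, and Artin-Rees puts it into
  \<open>x m^k + P\<close>. So \<open>x (u - v)\<close> lies in \<open>P\<close> for some
  \<open>v\<close> in \<open>m^k\<close>, and primality gives \<open>u - v\<close> in
  \<open>P\<close>.\<close>

lemma colon_m_pow:
  assumes P: "primeideal P R" and x: "x \<in> carrier R" "x \<notin> P"
  obtains c where "\<And>k. colon R (P <+> ideal_pow R m (k + c)) x \<subseteq> P <+> ideal_pow R m k"
proof -
  have Pi: "ideal P R" using P by (rule primeideal.axioms(1))
  note sc = scaled_ideal[OF oneideal x(1)] and mk = ideal_pow_ideal[OF m_ideal]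
  let ?T = "scaled R x (carrier R) <+> P"
  note T = add_ideals[OF sc Pi]
  obtain c where c: "\<And>k. ideal_pow R m (k + c) \<inter> ?T \<subseteq> ideal_pow R m k \<cdot> ?T"
    by (rule artin_rees[OF m_ideal T]) blast
  have "colon R (P <+> ideal_pow R m (k + c)) x \<subseteq> P <+> ideal_pow R m k" for k
  proof
    fix u assume "u \<in> colon R (P <+> ideal_pow R m (k + c)) x"
    then have u: "u \<in> carrier R" "x \<otimes> u \<in> P <+> ideal_pow R m (k + c)" by (auto simp: colon_def)
    then obtain p z where pz: "p \<in> P" "z \<in> ideal_pow R m (k + c)" "x \<otimes> u = p \<oplus> z" by (elim set_add_memE)
    have pc: "p \<in> carrier R" "z \<in> carrier R" using ideal_closed(8)[OF Pi pz(1)] ideal_closed(8)[OF mk pz(2)] .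
    have "z = x \<otimes> u \<oplus> \<ominus> p"
    proof -
      have "x \<otimes> u \<in> carrier R" using x u by simp
      then show ?thesis using pz(3) pc by algebra
    qed
    moreover have "x \<otimes> u \<oplus> \<ominus> p \<in> ?T"
      using u(1) ideal_closed(5)[OF Pi pz(1)] by (intro set_add_memI) (auto simp: scaled_def)
    ultimately have "z \<in> ideal_pow R m k \<cdot> ?T" using c[of k] pz(2) by auto
    also have "ideal_pow R m k \<cdot> ?T \<subseteq> scaled R x (ideal_pow R m k) <+> P"
    proof (rule ideal_prod_least[OF add_ideals[OF scaled_ideal[OF mk x(1)] Pi]])
      fix a b assume a: "a \<in> ideal_pow R m k" and "b \<in> ?T"
      then obtain s q where sq: "s \<in> scaled R x (carrier R)" "q \<in> P" "b = s \<oplus> q" by (elim set_add_memE)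
      then obtain t where t: "t \<in> carrier R" "s = x \<otimes> t" by (auto simp: scaled_def)
      have cc: "a \<in> carrier R" "q \<in> carrier R" using ideal_closed(8)[OF mk a] ideal_closed(8)[OF Pi sq(2)] .
      have "a \<otimes> b = x \<otimes> (a \<otimes> t) \<oplus> a \<otimes> q" using cc t sq(3) x by (simp add: r_distr m_ac)
      moreover have "x \<otimes> (a \<otimes> t) \<in> scaled R x (ideal_pow R m k)"
        using ideal_closed(7)[OF mk a t(1)] by (auto simp: scaled_def)
      ultimately show "a \<otimes> b \<in> scaled R x (ideal_pow R m k) <+> P"
        using ideal_closed(6)[OF Pi sq(2) cc(1)] by (simp add: set_add_memI)
    qed
    finally obtain s p' where sp: "s \<in> scaled R x (ideal_pow R m k)" "p' \<in> P" "z = s \<oplus> p'" by (elim set_add_memE)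
    then obtain v where v: "v \<in> ideal_pow R m k" "s = x \<otimes> v" by (auto simp: scaled_def)
    have vc: "v \<in> carrier R" "p' \<in> carrier R" using ideal_closed(8)[OF mk v(1)] ideal_closed(8)[OF Pi sp(2)] .
    have "x \<otimes> u = p \<oplus> (x \<otimes> v \<oplus> p')" using pz(3) sp(3) v(2) by simp
    then have "x \<otimes> (u \<ominus> v) = p \<oplus> p'" using x(1) u(1) vc pc by algebra
    then have "x \<otimes> (u \<ominus> v) \<in> P" using ideal_closed(3)[OF Pi pz(1) sp(2)] by simp
    then have "u \<ominus> v \<in> P" using primeideal.I_prime[OF P x(1), of "u \<ominus> v"] x(2) u(1) vc by simp
    then have "(u \<ominus> v) \<oplus> v \<in> P <+> ideal_pow R m k" using v(1) by (rule set_add_memI)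
    moreover have "(u \<ominus> v) \<oplus> v = u" using u(1) vc by algebra
    ultimately show "u \<in> P <+> ideal_pow R m k" by simp
  qed
  then show ?thesis using that by blast
qed

text \<open>For \<open>x\<close> in \<open>C 1\<close> outside \<open>C 0\<close>, the Samuel
  function of \<open>R/C 0\<close> splits into a colon part, at least its own value a fixed number
  of steps earlier, and a cokernel part, at least the Samuel function of \<open>R/C 1\<close>. Each
  prime of the chain thus raises the order of growth by one.\<close>

theorem mfun_lower_bound:
  assumes "strict_chain {P. primeideal P R} d C"
  shows "\<exists>\<epsilon>>0. \<forall>k\<ge>1. \<epsilon> * real k ^ d \<le> mfun (C 0) k"
  using assms
proof (induction d arbitrary: C)
  case (0 C)
  then have P: "primeideal (C 0) R" by (simp add: strict_chain_def)
  then have "ideal (C 0) R" "C 0 \<subseteq> m"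
    using primeideal.axioms(1)[OF P] proper_ideal_le_m primeideal.I_notcarr[OF P] by auto
  then show ?case using mfun_ge_1 by (intro exI[of _ 1]) simp
next
  case (Suc d C)
  have P: "primeideal (C 0) R" and P1: "primeideal (C 1) R" and sub: "C 0 \<subset> C 1"
    using Suc.prems unfolding strict_chain_def by auto
  note Pi = primeideal.axioms(1)[OF P] and P1i = primeideal.axioms(1)[OF P1]
  have Pm: "C 0 \<subseteq> m" using proper_ideal_le_m[OF Pi] primeideal.I_notcarr[OF P] by simp
  have "strict_chain {P. primeideal P R} d (\<lambda>i. C (Suc i))"
    using Suc.prems unfolding strict_chain_def by auto
  from Suc.IH[OF this] obtain \<epsilon>' where e': "\<epsilon>' > 0" "\<And>k. k \<ge> 1 \<Longrightarrow> \<epsilon>' * real k ^ d \<le> mfun (C 1) k" by auto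
  obtain x where x: "x \<in> C 1" "x \<notin> C 0" using sub by blast
  have xc: "x \<in> carrier R" using ideal_closed(8)[OF P1i x(1)] .
  obtain c0 where c0: "\<And>k. colon R (C 0 <+> ideal_pow R m (k + c0)) x \<subseteq> C 0 <+> ideal_pow R m k"
    by (rule colon_m_pow[OF P xc x(2)]) blast
  \<comment> \<open>The shift is \<open>Suc c0\<close> because the recursion needs a step of
    positive length, while \<open>c0\<close> may be 0.\<close>
  have rec: "mfun (C 0) k + \<epsilon>' * real (k + Suc c0) ^ d \<le> mfun (C 0) (k + Suc c0)" if "k \<ge> 1" for k
  proof -
    let ?V = "C 0 <+> ideal_pow R m (k + Suc c0)"
    note V = sum_m_pow(1)[OF Pi, of "k + Suc c0"] and V1 = sum_m_pow(1)[OF P1i, of "k + Suc c0"]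
    note sc = scaled_ideal[OF oneideal xc]
    have "ideal_pow R m (Suc k) \<subseteq> ideal_pow R m k" by (rule ideal_pow_antimono[OF m_ideal]) simp
    then have "C 0 <+> ideal_pow R m (Suc k) \<subseteq> C 0 <+> ideal_pow R m k" by (intro set_add_mono) auto
    then have "colon R ?V x \<subseteq> C 0 <+> ideal_pow R m k" using c0[of "Suc k"] by simp
    moreover have "finite_colength R (colon R ?V x)"
      using sum_m_pow(2)[OF Pi, of "k + Suc c0"] colon_ideal[OF V xc]
      by (rule finite_colength_mono) (use ideal_closed(6,8)[OF V] xc in \<open>auto simp: colon_def\<close>)
    ultimately have 1: "mfun (C 0) k \<le> qlen R (carrier R) (colon R ?V x)"
      by (intro qlen_carrier_antimono sum_m_pow(1)[OF Pi])
    have W: "ideal (scaled R x (carrier R) <+> ?V) R" by (rule add_ideals[OF sc V])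
    have "scaled R x (carrier R) \<subseteq> C 1 <+> ideal_pow R m (k + Suc c0)"
      using sum_m_pow(3)[OF P1i, of "k + Suc c0"] ideal_closed(7)[OF P1i x(1)] by (auto simp: scaled_def)
    moreover have "?V \<subseteq> C 1 <+> ideal_pow R m (k + Suc c0)" using sub by (intro set_add_mono) auto
    ultimately have "scaled R x (carrier R) <+> ?V \<subseteq> C 1 <+> ideal_pow R m (k + Suc c0)"
      by (rule set_add_least[OF V1])
    then have "mfun (C 1) (k + Suc c0) \<le> qlen R (carrier R) (scaled R x (carrier R) <+> ?V)"
      by (rule qlen_carrier_antimono[OF finite_colength_mono[OF sum_m_pow(2)[OF Pi] W set_add_subset_r[OF sc V]] V1])
    then show ?thesis using mfun_split[OF Pi xc, of "k + Suc c0"] 1 e'(2)[of "k + Suc c0"] by simp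
  qed
  show ?case
    by (rule growth_from_recursion[OF e'(1), of "Suc c0"]) (use rec mfun_ge_1[OF Pi Pm] in auto)
qed

end

section \<open>Top coefficients under finite differences\<close>

lemma degree_pcompose_shift:
  fixes p :: "real poly"
  shows "degree (pcompose p [:1, 1:]) = degree p" "lead_coeff (pcompose p [:1, 1:]) = lead_coeff p"
  using degree_pcompose[of p "[:1, 1:]"] lead_coeff_comp[of "[:1, 1:]" p] by simp_all

lemma coeff_pcompose_shift:
  fixes p :: "real poly"
  assumes "degree p \<le> d"
  shows "coeff (pcompose p [:1, 1:]) d = coeff p d"
  using assms degree_pcompose_shift[of p] by (cases "degree p = d") (auto simp: coeff_eq_0)

lemma pdiff_pCons: "pdiff (pCons a p) = pCons 0 (pdiff p) + pcompose p [:1, 1:]"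
  by (simp add: pdiff_def pcompose_pCons)

text \<open>Induction along \<open>p = a + x q\<close>: the difference of \<open>p\<close> is
  \<open>x\<close> times that of \<open>q\<close> plus \<open>q(x+1)\<close>, and the second term
  adds one more copy of the top coefficient.\<close>

lemma pdiff_degree:
  assumes "degree p \<le> Suc d"
  shows "degree (pdiff p) \<le> d \<and> coeff (pdiff p) d = real (Suc d) * coeff p (Suc d)"
  using assms
proof (induction d arbitrary: p)
  case 0
  obtain a q where p: "p = pCons a q" by (cases p)
  have q: "degree q = 0" using 0 by (simp add: p split: if_splits)
  then obtain b where "q = [:b:]" by (rule degree_eq_zeroE)
  then show ?case by (simp add: p pdiff_def pcompose_pCons)
next
  case (Suc d)
  obtain a q where p: "p = pCons a q" by (cases p)
  have q: "degree q \<le> Suc d" using Suc.prems by (simp add: p split: if_splits)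
  note IH = Suc.IH[OF q]
  have "degree (pdiff p) \<le> Suc d"
    unfolding p pdiff_pCons using IH q degree_pcompose_shift(1)[of q]
    by (intro degree_add_le) (auto simp: degree_pCons_eq_if)
  moreover have "coeff (pdiff p) (Suc d) = real (Suc (Suc d)) * coeff p (Suc (Suc d))"
    unfolding p pdiff_pCons using IH coeff_pcompose_shift[OF q] by (simp add: algebra_simps)
  ultimately show ?case by blast
qed

lemma pdiff_funpow: "degree p \<le> d \<Longrightarrow> (pdiff ^^ d) p = [:fact d * coeff p d:]"
proof (induction d arbitrary: p)
  case 0
  then obtain a where "p = [:a:]" by (auto elim: degree_eq_zeroE)
  then show ?case by simp
next
  case (Suc d)
  have "(pdiff ^^ Suc d) p = (pdiff ^^ d) (pdiff p)" by (simp add: funpow_swap1)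
  also have "\<dots> = [:fact d * coeff (pdiff p) d:]" using pdiff_degree[OF Suc.prems] by (intro Suc.IH) simp
  finally show ?case using pdiff_degree[OF Suc.prems] by (simp add: algebra_simps)
qed

text \<open>For a function of the total degree, the difference in any variable is the difference of
  the underlying one-variable polynomial.\<close>

lemma mixed_diff_sum_degree:
  assumes "\<And>r. large n N r \<Longrightarrow> f r = poly q (real (\<Sum>j<n. r j))" "set L \<subseteq> {..<n}" "large n N r"
  shows "mixed_diff L f r = poly ((pdiff ^^ length L) q) (real (\<Sum>j<n. r j))"
  using assms(2,3)
proof (induction L arbitrary: r)
  case Nil
  then show ?case using assms(1) by simp
next
  case (Cons l L)
  have l: "l < n" using Cons.prems by simp
  have "(\<Sum>j<n. bump l 1 r j) = bump l 1 r l + (\<Sum>j\<in>{..<n} - {l}. bump l 1 r j)"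
    using l by (subst sum.remove[of _ l]) auto
  also have "(\<Sum>j\<in>{..<n} - {l}. bump l 1 r j) = (\<Sum>j\<in>{..<n} - {l}. r j)" by (rule sum.cong) (auto simp: bump_def)
  also have "bump l 1 r l + \<dots> = (\<Sum>j<n. r j) + 1"
    using l by (subst (2) sum.remove[of _ l]) (auto simp: bump_def)
  finally have s: "real (\<Sum>j<n. bump l 1 r j) = real (\<Sum>j<n. r j) + 1" by simp
  show ?case
    using Cons.IH[of r] Cons.IH[OF _ large_bump[OF Cons.prems(2) l]] Cons.prems
    by (simp only: mixed_diff.simps list.size set_simps insert_subset s) (simp add: poly_pdiff)
qed

lemma mixed_diff_minus: "mixed_diff L (\<lambda>r. f r - g r) r = mixed_diff L f r - mixed_diff L g r"
  by (induction L arbitrary: r) simp_all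

lemma mixed_diff_fix: "j \<notin> set L \<Longrightarrow> mixed_diff L (\<lambda>r. f (r(j := u))) r = mixed_diff L f (r(j := u))"
proof (induction L arbitrary: r)
  case (Cons l L)
  then have b: "(bump l 1 r)(j := u) = bump l 1 (r(j := u))" and "j \<notin> set L" by (auto simp: bump_def)
  note IH = Cons.IH[OF \<open>j \<notin> set L\<close>]
  show ?case unfolding mixed_diff.simps IH b ..
qed simp

locale local_ring_dim = noetherian_local +
  fixes n :: nat
  assumes dim: "krull_dim R = enat n"

context local_ring_dim
begin

lemma zero_sum_m_pow: "{\<zero>} <+> ideal_pow R m k = ideal_pow R m k"
proof
  show "{\<zero>} <+> ideal_pow R m k \<subseteq> ideal_pow R m k"
    using ideal_closed(2)[OF ideal_pow_ideal[OF m_ideal]] by (intro set_add_least ideal_pow_ideal[OF m_ideal]) auto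
qed (rule sum_m_pow(4)[OF zeroideal])

lemma m_pow_upper: "\<exists>C\<ge>0. \<forall>k\<ge>1. qlen R (carrier R) (ideal_pow R m k) \<le> C * real k ^ n"
proof -
  have "k \<le> n" if "strict_chain {P. primeideal P R \<and> {\<zero>} \<subseteq> P} k C" for k C
  proof -
    have "strict_chain {P. primeideal P R} k C" using that by (auto simp: strict_chain_def)
    then have "enat k \<le> krull_dim R" unfolding krull_dim_def by (rule strict_chain_le_chain_height)
    then show ?thesis using dim by simp
  qed
  then have "dim_le {\<zero>} n" by (auto simp: dim_le_def)
  from mfun_upper_bound[OF zeroideal this] show ?thesis unfolding zero_sum_m_pow .
qed

lemma m_pow_lower: "\<exists>\<epsilon>>0. \<forall>k\<ge>1. \<epsilon> * real k ^ n \<le> qlen R (carrier R) (ideal_pow R m k)"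
proof -
  have "{P. primeideal P R} \<noteq> {}" using m_prime by auto
  moreover have "enat n \<le> chain_height {P. primeideal P R}" using dim by (simp add: krull_dim_def)
  ultimately have "\<exists>C. strict_chain {P. primeideal P R} n C" by (rule strict_chain_exists_iff[THEN iffD1])
  then obtain C where C: "strict_chain {P. primeideal P R} n C" ..
  then have "primeideal (C 0) R" by (simp add: strict_chain_def)
  then have P: "ideal (C 0) R" by (rule primeideal.axioms(1))
  obtain \<epsilon> where e: "\<epsilon> > 0" "\<And>k. k \<ge> 1 \<Longrightarrow> \<epsilon> * real k ^ n \<le> mfun (C 0) k"
    using mfun_lower_bound[OF C] by blast
  have "mfun (C 0) k \<le> qlen R (carrier R) (ideal_pow R m k)" for k
    by (rule qlen_carrier_antimono[OF finite_colength_pow[OF finite_colength_m] sum_m_pow(1,4)[OF P]])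
  then show ?thesis using e by (intro exI[of _ \<epsilon>]) (meson order_trans)
qed

abbreviation hfun :: "nat \<Rightarrow> (nat \<Rightarrow> 'a set) \<Rightarrow> (nat \<Rightarrow> nat) \<Rightarrow> real" where
  "hfun l I r \<equiv> qlen R (carrier R) (mprod R l I r)"

lemma common_m_pow:
  fixes l :: nat
  assumes "\<forall>j<l. finite_colength R (I j)"
  obtains c where "c \<ge> 1" "\<And>j. j < l \<Longrightarrow> ideal_pow R m c \<subseteq> I j"
proof -
  have "\<exists>c. j < l \<longrightarrow> ideal_pow R m c \<subseteq> I j" for j
    using finite_colength_contains_m_pow[of "I j"] assms by metis
  then obtain c where c: "\<And>j. j < l \<Longrightarrow> ideal_pow R m (c j) \<subseteq> I j" by metis
  have "ideal_pow R m (Suc (\<Sum>j<l. c j)) \<subseteq> I j" if "j < l" for j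
  proof -
    have "c j \<le> (\<Sum>j<l. c j)" using that by (intro member_le_sum) auto
    then have "ideal_pow R m (Suc (\<Sum>j<l. c j)) \<subseteq> ideal_pow R m (c j)" by (intro ideal_pow_antimono m_ideal) simp
    then show ?thesis using c[OF that] by blast
  qed
  then show ?thesis using that[of "Suc (\<Sum>j<l. c j)"] by simp
qed

text \<open>Each ideal contains \<open>m^c\<close>, so the product along the diagonal contains a
  power of \<open>m\<close> with exponent linear in \<open>k\<close>. The number \<open>l\<close> of
  ideals is kept apart from the dimension: it is \<open>n\<close> for mixed and 1 for Samuel
  multiplicities.\<close>

lemma hfun_growth:
  assumes I: "\<forall>j<l. finite_colength R (I j)"
  shows "(\<lambda>k. hfun l I (diagonal l k) / real k ^ Suc n) \<longlonglongrightarrow> 0"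
proof -
  obtain c where c: "c \<ge> 1" "\<And>j. j < l \<Longrightarrow> ideal_pow R m c \<subseteq> I j" by (rule common_m_pow[OF I]) blast
  obtain C where C: "C \<ge> 0" "\<And>k. k \<ge> 1 \<Longrightarrow> qlen R (carrier R) (ideal_pow R m k) \<le> C * real k ^ n"
    using m_pow_upper by blast
  \<comment> \<open>\<open>Suc\<close> keeps the exponent \<open>D * k\<close> positive even when
    \<open>l = 0\<close>.\<close>
  define D where "D = Suc (c * l)"
  have Ii: "\<forall>j<l. ideal (I j) R" using I finite_colengthD by blast
  note mc = ideal_pow_ideal[OF m_ideal]
  have bd: "\<bar>hfun l I (diagonal l k) / real k ^ Suc n\<bar> \<le> C * real D ^ n * inverse (real k)" if "k \<ge> 1" for k
  proof -
    have "ideal_pow R m (D * k) \<subseteq> ideal_pow R m (c * (l * k))"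
      by (rule ideal_pow_antimono[OF m_ideal]) (simp add: D_def)
    also have "\<dots> = mprod R l (\<lambda>_. ideal_pow R m c) (diagonal l k)"
      using mprod_const[OF mc, of l c "diagonal l k"] ideal_pow_pow[OF m_ideal, of c "l * k"] by (simp add: diagonal_def)
    also have "\<dots> \<subseteq> mprod R l I (diagonal l k)"
      using Ii c(2) mc by (intro mprod_mono) (auto intro!: ideal_pow_mono)
    finally have "hfun l I (diagonal l k) \<le> qlen R (carrier R) (ideal_pow R m (D * k))"
      by (intro qlen_carrier_antimono finite_colength_pow finite_colength_m mprod_ideal[OF Ii])
    also have "\<dots> \<le> C * real (D * k) ^ n" using that by (intro C(2)) (simp add: D_def)
    finally have "hfun l I (diagonal l k) / real k ^ Suc n \<le> C * real (D * k) ^ n / real k ^ Suc n"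
      by (intro divide_right_mono) auto
    also have "\<dots> = C * real D ^ n * inverse (real k)"
      using that by (simp add: power_mult_distrib field_simps)
    finally show ?thesis by simp
  qed
  have "(\<lambda>k. C * real D ^ n * inverse (real k)) \<longlonglongrightarrow> C * real D ^ n * 0"
    by (intro tendsto_mult_left lim_inverse_n)
  then have "(\<lambda>k. C * real D ^ n * inverse (real k)) \<longlonglongrightarrow> 0" by simp
  then show ?thesis using bd by (rule seq_null_comparison)
qed

lemma hfun_eventual_sum:
  assumes "\<forall>j<l. finite_colength R (I j)"
  obtains N F w p where "eventual_sum l (hfun l I) N (F :: nat set) w p" "positive_sum l N F w p"
    "\<And>i. i \<in> F \<Longrightarrow> (\<Sum>j<l. degree (p i j)) \<le> n"
proof -
  obtain N F w p where 1: "eventual_sum l (hfun l I) N (F :: nat set) w p" "positive_sum l N F w p"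
    by (rule hilbert_type_eventual_sum[OF hilbert_type_colength[OF assms]]) blast
  then show ?thesis
    using that[OF 1] eventual_sum_degree_less[OF 1 hfun_growth[OF assms]] by (simp add: less_Suc_eq_le)
qed

section \<open>Mixed multiplicities\<close>

definition mm :: "(nat \<Rightarrow> 'a set) \<Rightarrow> real" where
  "mm I = mixed_mult R (map I [0..<n])"

lemma hilbert_coeffs_iff:
  assumes I: "\<forall>j<n. ideal (I j) R"
  shows "hilbert_coeffs R (map I [0..<n]) c \<longleftrightarrow>
    (\<exists>N. \<forall>r. large n N r \<longrightarrow> hfun n I r = (\<Sum>\<alpha>\<in>exponents n. c \<alpha> * (\<Prod>j<n. real (r j) ^ \<alpha> j)))"
proof -
  have 1: "real (the_enat (colength R (\<Otimes>\<^bsub>ideals_set R\<^esub>j\<in>{..<n}. ideal_pow R (map I [0..<n] ! j) (r j)))) = hfun n I r" for r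
  proof -
    have "(\<Otimes>\<^bsub>ideals_set R\<^esub>j\<in>{..<n}. ideal_pow R (map I [0..<n] ! j) (r j)) = mprod R n I r"
      unfolding mprod_def[symmetric] by (rule mprod_cong) (use I in auto)
    then show ?thesis using qlen_carrier_eq_colength[OF mprod_ideal[OF I]] by simp
  qed
  have 2: "hilbert_coeffs R (map I [0..<n]) c \<longleftrightarrow>
    (\<exists>N. \<forall>r. (\<forall>j<n. N \<le> r j) \<longrightarrow> hfun n I r = (\<Sum>\<alpha>\<in>exponents n. c \<alpha> * (\<Prod>j<n. real (r j) ^ \<alpha> j)))"
    unfolding hilbert_coeffs_def Let_def length_map length_upt minus_nat.diff_0 1 exponents_def by (rule refl)
  show ?thesis
    unfolding 2
  proof (intro ex_cong1 iffI allI impI)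
    fix N r assume H: "\<forall>r. large n N r \<longrightarrow> hfun n I r = (\<Sum>\<alpha>\<in>exponents n. c \<alpha> * (\<Prod>j<n. real (r j) ^ \<alpha> j))"
      and r: "\<forall>j<n. N \<le> r j"
    \<comment> \<open>Only the first \<open>n\<close> values enter the product; the others are reset
      to 0 to satisfy \<open>large\<close>.\<close>
    define r' where "r' = (\<lambda>j. if j < n then r j else 0)"
    have "large n N r'" using r by (simp add: large_def supported_def r'_def)
    then have "hfun n I r' = (\<Sum>\<alpha>\<in>exponents n. c \<alpha> * (\<Prod>j<n. real (r' j) ^ \<alpha> j))" using H by blast
    moreover have "mprod R n I r' = mprod R n I r" by (rule mprod_cong[OF I]) (simp add: r'_def)
    moreover have "(\<Prod>j<n. real (r' j) ^ \<alpha> j) = (\<Prod>j<n. real (r j) ^ \<alpha> j)" for \<alpha>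
      by (rule prod.cong) (auto simp: r'_def)
    ultimately show "hfun n I r = (\<Sum>\<alpha>\<in>exponents n. c \<alpha> * (\<Prod>j<n. real (r j) ^ \<alpha> j))" by simp
  qed (simp add: large_def)
qed

lemma hilbert_coeffs_exists:
  assumes I: "\<forall>j<n. finite_colength R (I j)"
  shows "\<exists>c. hilbert_coeffs R (map I [0..<n]) c"
proof -
  have Ii: "\<forall>j<n. ideal (I j) R" using I finite_colengthD by blast
  obtain N F w p where 1: "eventual_sum n (hfun n I) N (F :: nat set) w p" "\<And>i. i \<in> F \<Longrightarrow> (\<Sum>j<n. degree (p i j)) \<le> n"
    by (rule hfun_eventual_sum[OF I]) blast
  define c where "c \<alpha> = (\<Sum>i\<in>F. w i * (\<Prod>j<n. Polynomial.coeff (p i j) (\<alpha> j)))" for \<alpha>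
  have "hfun n I r = (\<Sum>\<alpha>\<in>exponents n. c \<alpha> * (\<Prod>j<n. real (r j) ^ \<alpha> j))" if "large n N r" for r
  proof -
    have "hfun n I r = (\<Sum>i\<in>F. w i * peval n (p i) r)" using 1(1) that by (simp add: eventual_sum_def)
    also have "\<dots> = (\<Sum>i\<in>F. \<Sum>\<alpha>\<in>exponents n. w i * (\<Prod>j<n. Polynomial.coeff (p i j) (\<alpha> j)) * (\<Prod>j<n. real (r j) ^ \<alpha> j))"
      by (rule sum.cong[OF refl]) (simp add: peval_monomials[OF 1(2)] sum_distrib_left mult.assoc)
    also have "\<dots> = (\<Sum>\<alpha>\<in>exponents n. c \<alpha> * (\<Prod>j<n. real (r j) ^ \<alpha> j))"
      by (subst sum.swap) (simp add: c_def sum_distrib_right)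
    finally show ?thesis .
  qed
  then show ?thesis unfolding hilbert_coeffs_iff[OF Ii] by blast
qed

lemma hilbert_coeffs_mixed_diff:
  assumes "\<forall>j<n. ideal (I j) R" "hilbert_coeffs R (map I [0..<n]) c"
  shows "\<exists>N. \<forall>r. large n N r \<longrightarrow> mixed_diff [0..<n] (hfun n I) r = c (restrict (\<lambda>_. 1) {..<n})"
  using assms(2) mixed_diff_monomials[of n _ "hfun n I" c] unfolding hilbert_coeffs_iff[OF assms(1)] by blast

text \<open>The definite description is justified because the coefficient is the eventual value of
  the \<open>n\<close>-fold difference of the Hilbert function, the same for every admissible choice
  of coefficients.\<close>

lemma mm_eq_coeff:
  assumes I: "\<forall>j<n. ideal (I j) R" and c: "hilbert_coeffs R (map I [0..<n]) c"
  shows "mm I = c (restrict (\<lambda>_. 1) {..<n})"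
proof -
  have "\<exists>c'. hilbert_coeffs R (map I [0..<n]) c' \<and> e = c' (restrict (\<lambda>_. 1) {..<n}) \<Longrightarrow> e = c (restrict (\<lambda>_. 1) {..<n})" for e
  proof -
    assume "\<exists>c'. hilbert_coeffs R (map I [0..<n]) c' \<and> e = c' (restrict (\<lambda>_. 1) {..<n})"
    then obtain c' where c': "hilbert_coeffs R (map I [0..<n]) c'" "e = c' (restrict (\<lambda>_. 1) {..<n})" by blast
    obtain N where N: "\<And>r. large n N r \<Longrightarrow> mixed_diff [0..<n] (hfun n I) r = c (restrict (\<lambda>_. 1) {..<n})"
      using hilbert_coeffs_mixed_diff[OF I c] by blast
    obtain N' where N': "\<And>r. large n N' r \<Longrightarrow> mixed_diff [0..<n] (hfun n I) r = c' (restrict (\<lambda>_. 1) {..<n})"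
      using hilbert_coeffs_mixed_diff[OF I c'(1)] by blast
    show ?thesis
      using N[OF large_diagonal[of N "max N N'"]] N'[OF large_diagonal[of N' "max N N'"]] c'(2) by simp
  qed
  then show ?thesis unfolding mm_def mixed_mult_def using c by (intro the_equality) auto
qed

lemma mm_mixed_diff:
  assumes I: "\<forall>j<n. finite_colength R (I j)"
  obtains N where "\<And>r. large n N r \<Longrightarrow> mixed_diff [0..<n] (hfun n I) r = mm I"
proof -
  have Ii: "\<forall>j<n. ideal (I j) R" using I finite_colengthD by blast
  obtain c where "hilbert_coeffs R (map I [0..<n]) c" using hilbert_coeffs_exists[OF I] by blast
  then show ?thesis using hilbert_coeffs_mixed_diff[OF Ii] mm_eq_coeff[OF Ii] that by metis
qed

text \<open>Substituting \<open>s j * r j\<close> for \<open>r j\<close> in the Hilbert polynomial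
  multiplies the coefficient of the product of all variables by every \<open>s j\<close>
  once.\<close>

lemma mm_pow:
  assumes I: "\<forall>j<n. finite_colength R (I j)" and s: "\<forall>j<n. 1 \<le> s j"
  shows "mm (\<lambda>j. ideal_pow R (I j) (s j)) = (\<Prod>j<n. real (s j)) * mm I"
proof -
  have Ii: "\<forall>j<n. ideal (I j) R" using I finite_colengthD by blast
  then have Ii': "\<forall>j<n. ideal (ideal_pow R (I j) (s j)) R" using ideal_pow_ideal by blast
  obtain c where c: "hilbert_coeffs R (map I [0..<n]) c" using hilbert_coeffs_exists[OF I] by blast
  then obtain N where N: "\<And>r. large n N r \<Longrightarrow> hfun n I r = (\<Sum>\<alpha>\<in>exponents n. c \<alpha> * (\<Prod>j<n. real (r j) ^ \<alpha> j))"
    unfolding hilbert_coeffs_iff[OF Ii] by blast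
  define c' where "c' \<alpha> = c \<alpha> * (\<Prod>j<n. real (s j) ^ \<alpha> j)" for \<alpha>
  have "hfun n (\<lambda>j. ideal_pow R (I j) (s j)) r = (\<Sum>\<alpha>\<in>exponents n. c' \<alpha> * (\<Prod>j<n. real (r j) ^ \<alpha> j))" if r: "large n N r" for r
  proof -
    have "N \<le> s j * r j" if "j < n" for j
    proof -
      have "1 * N \<le> s j * r j" using s r that by (intro mult_le_mono) (auto simp: large_def)
      then show ?thesis by simp
    qed
    then have sr: "large n N (\<lambda>j. s j * r j)" using r by (simp add: large_def supported_def)
    have "mprod R n (\<lambda>j. ideal_pow R (I j) (s j)) r = mprod R n I (\<lambda>j. s j * r j)"
      by (rule mprod_cong) (use Ii' Ii ideal_pow_pow in auto)
    then show ?thesis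
      using N[OF sr] by (simp add: c'_def power_mult_distrib prod.distrib mult.assoc)
  qed
  then have "hilbert_coeffs R (map (\<lambda>j. ideal_pow R (I j) (s j)) [0..<n]) c'"
    unfolding hilbert_coeffs_iff[OF Ii'] by blast
  from mm_eq_coeff[OF Ii' this] mm_eq_coeff[OF Ii c] show ?thesis by (simp add: c'_def)
qed

subsection \<open>Monotonicity\<close>

lemma mprod_fun_upd:
  assumes I: "\<forall>l<n. ideal (I l) R" and A: "ideal A R" and j: "j < n"
  shows "mprod R n (I(j := A)) (r(j := u)) = ideal_pow R A u \<cdot> mprod R n (I(j := carrier R)) r"
proof -
  have IA: "\<forall>l<n. ideal ((I(j := A)) l) R" using I A by simp
  have "mprod R n (I(j := A)) (bump j u (r(j := 0))) = ideal_pow R A u \<cdot> mprod R n (I(j := A)) (r(j := 0))"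
    by (subst mprod_bump[OF IA j]) (simp only: fun_upd_same)
  moreover have "bump j u (r(j := 0)) = r(j := u)" by (simp add: bump_def)
  moreover have "mprod R n (I(j := A)) (r(j := 0)) = mprod R n (I(j := carrier R)) r"
    by (rule mprod_cong[OF IA]) (simp add: ideal_pow_carrier ideals_set_simps)
  ultimately show ?thesis by simp
qed

text \<open>Differences in the other \<open>n - 1\<close> variables leave a function whose increment
  in variable \<open>j\<close> is the full \<open>n\<close>-fold difference; it is thus eventually
  affine in that variable with slope \<open>mm I\<close>.\<close>

lemma mixed_diff_slot:
  assumes I: "\<forall>l<n. finite_colength R (I l)" and j: "j < n"
    and L: "distinct L" "set L = {..<n} - {j}"
  obtains N where "\<And>r. large n N r \<Longrightarrow> mixed_diff L (hfun n I) (bump j 1 r) = mixed_diff L (hfun n I) r + mm I"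
proof -
  obtain N F w p where 1: "eventual_sum n (hfun n I) N (F :: nat set) w p"
    by (rule hfun_eventual_sum[OF I]) blast
  obtain N' where N': "\<And>r. large n N' r \<Longrightarrow> mixed_diff [0..<n] (hfun n I) r = mm I" by (rule mm_mixed_diff[OF I]) blast
  have "mixed_diff L (hfun n I) (bump j 1 r) = mixed_diff L (hfun n I) r + mm I" if r: "large n (max N N') r" for r
  proof -
    have rN: "large n N r" "large n N' r" using r by (auto intro: large_mono)
    have s: "set (j # L) = {..<n}" "set [0..<n] = {..<n}"
      using L(2) j by (simp_all add: insert_absorb atLeast0LessThan)
    have d: "distinct (j # L)" "distinct [0..<n]" using L by simp_all
    have "mixed_diff (j # L) (hfun n I) r = mixed_diff [0..<n] (hfun n I) r"
      using mixed_diff_eventual_sum[OF 1 d(1) _ rN(1)] mixed_diff_eventual_sum[OF 1 d(2) _ rN(1)]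
      unfolding s by (simp only: order_refl)
    then show ?thesis using N'[OF rN(2)] by simp
  qed
  then show ?thesis using that by blast
qed

text \<open>For fixed \<open>u\<close>, the length of \<open>B^u M / A^u M\<close> is at most the
  increment of the Hilbert function of \<open>B\<close> between the exponents \<open>u\<close> and
  \<open>c u\<close> of slot \<open>j\<close>. That increment has degree below \<open>n\<close> in
  the other variables. The quotient, being of Hilbert type, therefore has total degree below
  \<open>n\<close> and a constant nonnegative \<open>(n-1)\<close>-fold difference.\<close>

lemma mixed_diff_kernel_const:
  assumes I: "\<forall>l<n. finite_colength R (I l)" and j: "j < n"
    and A: "finite_colength R A" and B: "finite_colength R B" and AB: "A \<subseteq> B" and Bm: "B \<subseteq> m"
    and L: "distinct L" "set L = {..<n} - {j}"
  obtains N where "\<And>u. u \<ge> N \<Longrightarrow> \<exists>C\<ge>0. \<exists>M. \<forall>r. large n M r \<longrightarrow>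
    mixed_diff L (hfun n (I(j := A))) (r(j := u)) - mixed_diff L (hfun n (I(j := B))) (r(j := u)) = C"
proof -
  have Ii: "\<forall>l<n. ideal (I l) R" using I finite_colengthD by blast
  have Ai: "ideal A R" and Bi: "ideal B R" using A B finite_colengthD by blast+
  let ?M = "mprod R n (I(j := carrier R))"
  have IM: "\<forall>l<n. ideal ((I(j := carrier R)) l) R" using Ii oneideal by simp
  note M = mprod_ideal[OF IM] and pw = ideal_pow_ideal
  have IB: "\<forall>l<n. finite_colength R ((I(j := B)) l)" using I B by simp
  have IA: "\<forall>l<n. finite_colength R ((I(j := A)) l)" using I A by simp
  have fin: "quot_length R (carrier R) (mprod R n (I(j := A)) r) \<noteq> \<infinity>" "quot_length R (carrier R) (mprod R n (I(j := B)) r) \<noteq> \<infinity>" for r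
    using finite_colength_mprod[OF IA, of r] finite_colength_mprod[OF IB, of r] unfolding finite_colength_iff by blast+
  \<comment> \<open>From \<open>B \<subseteq> m\<close> and \<open>m^c \<subseteq> A\<close>; the
    exponent is raised by one to make it positive.\<close>
  obtain c where c: "c \<ge> 1" "ideal_pow R B c \<subseteq> A"
  proof -
    obtain c where c: "ideal_pow R m c \<subseteq> A" using finite_colength_contains_m_pow[OF A] by blast
    have "ideal_pow R B (Suc c) \<subseteq> ideal_pow R B c" by (rule ideal_pow_antimono[OF Bi]) simp
    also have "\<dots> \<subseteq> ideal_pow R m c" by (rule ideal_pow_mono[OF Bm])
    finally show ?thesis using that[of "Suc c"] c by simp
  qed
  obtain N F w p where 1: "eventual_sum n (hfun n (I(j := B))) N (F :: nat set) w p" "positive_sum n N F w p"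
    "\<And>i. i \<in> F \<Longrightarrow> (\<Sum>j<n. degree (p i j)) \<le> n"
    by (rule hfun_eventual_sum[OF IB]) blast
  have "\<exists>C\<ge>0. \<exists>M. \<forall>r. large n M r \<longrightarrow>
    mixed_diff L (hfun n (I(j := A))) (r(j := u)) - mixed_diff L (hfun n (I(j := B))) (r(j := u)) = C" if u: "u \<ge> N" for u
  proof -
    define K where "K r = qlen R (ideal_pow R B u \<cdot> ?M r) (ideal_pow R A u \<cdot> ?M r)" for r
    have le1: "ideal_pow R A u \<cdot> ?M r \<subseteq> ideal_pow R B u \<cdot> ?M r" for r
      by (intro ideal_prod_mono ideal_pow_mono AB order_refl)
    have Keq: "K r = hfun n (I(j := A)) (r(j := u)) - hfun n (I(j := B)) (r(j := u))" for r
    proof -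
      have "hfun n (I(j := A)) (r(j := u)) = hfun n (I(j := B)) (r(j := u)) + K r"
        using fin(1)[of "r(j := u)"] unfolding K_def mprod_fun_upd[OF Ii Ai j] mprod_fun_upd[OF Ii Bi j]
        by (intro qlen_add ideal_prod_is_ideal pw Ai Bi M oneideal le1 ideal_closed(1))
      then show ?thesis by simp
    qed
    have "hilbert_type n K"
      unfolding K_def
    proof (rule hilbert_type_prod[OF IM pw[OF Ai] pw[OF Bi] ideal_pow_mono[OF AB]])
      show "quot_length R (ideal_pow R B u \<cdot> ?M r) (ideal_pow R A u \<cdot> ?M r) \<noteq> \<infinity>" for r
        using quot_length_finite_mono[OF order_refl ideal_closed(1)[OF ideal_prod_is_ideal[OF pw[OF Bi] M]] fin(1)[of "r(j := u)"]]
        unfolding mprod_fun_upd[OF Ii Ai j] .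
    qed
    then obtain N' F' w' p' where 2: "eventual_sum n K N' (F' :: nat set) w' p'" "positive_sum n N' F' w' p'"
      by (rule hilbert_type_eventual_sum) blast
    have Kle: "K r \<le> hfun n (I(j := B)) (r(j := c * u)) - hfun n (I(j := B)) (r(j := u))" for r
    proof -
      have "ideal_pow R B (c * u) \<subseteq> ideal_pow R A u"
        unfolding ideal_pow_pow[OF Bi, symmetric] by (rule ideal_pow_mono[OF c(2)])
      then have "mprod R n (I(j := B)) (r(j := c * u)) \<subseteq> mprod R n (I(j := A)) (r(j := u))"
        unfolding mprod_fun_upd[OF Ii Ai j] mprod_fun_upd[OF Ii Bi j] by (intro ideal_prod_mono order_refl)
      then have "hfun n (I(j := A)) (r(j := u)) \<le> hfun n (I(j := B)) (r(j := c * u))"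
        by (intro qlen_carrier_antimono finite_colength_mprod IB finite_colengthD[OF finite_colength_mprod[OF IA]])
      then show ?thesis using Keq by simp
    qed
    define Q where "Q i = (\<Prod>l\<in>{..<n} - {j}. p i l)" for i
    have cu: "N \<le> c * u" using u c(1) mult_le_mono[of 1 c N u] by simp
    have Bk: "hfun n (I(j := B)) ((diagonal n k)(j := t)) = (\<Sum>i\<in>F. w i * (poly (p i j) (real t) * poly (Q i) (real k)))"
      if "k \<ge> N" "t \<ge> N" for k t
    proof -
      have "large n N ((diagonal n k)(j := t))"
        using that j by (simp add: large_def supported_def diagonal_def)
      then have "hfun n (I(j := B)) ((diagonal n k)(j := t)) = (\<Sum>i\<in>F. w i * peval n (p i) ((diagonal n k)(j := t)))"
        using 1(1) by (simp add: eventual_sum_def)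
      moreover have "peval n (p i) ((diagonal n k)(j := t)) = poly (p i j) (real t) * poly (Q i) (real k)" for i
      proof -
        have "peval n (p i) ((diagonal n k)(j := t)) = poly (p i j) (real t) * (\<Prod>l\<in>{..<n} - {j}. poly (p i l) (real (((diagonal n k)(j := t)) l)))"
          unfolding peval_def using j by (subst prod.remove[of _ j]) auto
        also have "(\<Prod>l\<in>{..<n} - {j}. poly (p i l) (real (((diagonal n k)(j := t)) l))) = poly (Q i) (real k)"
          unfolding Q_def poly_prod by (rule prod.cong) (auto simp: diagonal_def)
        finally show ?thesis .
      qed
      ultimately show ?thesis by simp
    qed
    have each: "(\<lambda>k. w i * (poly (p i j) (real (c * u)) - poly (p i j) (real u)) * (poly (Q i) (real k) / real k ^ n)) \<longlonglongrightarrow> 0"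
      if i: "i \<in> F" for i
    proof -
      have "degree (Q i) \<le> (\<Sum>l\<in>{..<n} - {j}. degree (p i l))"
        unfolding Q_def using degree_prod_sum_le[of "{..<n} - {j}" "p i"] by (simp add: o_def)
      moreover have "(\<Sum>l<n. degree (p i l)) = degree (p i j) + (\<Sum>l\<in>{..<n} - {j}. degree (p i l))"
        using j by (subst sum.remove[of _ j]) auto
      ultimately have d: "degree (p i j) + degree (Q i) \<le> n" using 1(3)[OF i] by linarith
      have "(\<lambda>k. poly (Q i) (real k) / real k ^ n) \<longlonglongrightarrow> Polynomial.coeff (Q i) n"
        using d by (intro poly_over_power_tendsto) simp
      then have "(\<lambda>k. w i * (poly (p i j) (real (c * u)) - poly (p i j) (real u)) * (poly (Q i) (real k) / real k ^ n))
          \<longlonglongrightarrow> w i * (poly (p i j) (real (c * u)) - poly (p i j) (real u)) * Polynomial.coeff (Q i) n"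
        by (intro tendsto_mult_left)
      \<comment> \<open>Either \<open>p i j\<close> is constant and its increment is 0, or it takes
        up at least one degree and \<open>Q i\<close> has degree below \<open>n\<close>.\<close>
      moreover have "w i * (poly (p i j) (real (c * u)) - poly (p i j) (real u)) * Polynomial.coeff (Q i) n = 0"
      proof (cases "degree (p i j) = 0")
        case True
        then obtain a where "p i j = [:a:]" by (rule degree_eq_zeroE)
        then show ?thesis by simp
      next
        case False
        then show ?thesis using d by (simp add: coeff_eq_0)
      qed
      ultimately show ?thesis by (simp only:)
    qed
    have "(\<lambda>k. \<Sum>i\<in>F. w i * (poly (p i j) (real (c * u)) - poly (p i j) (real u)) * (poly (Q i) (real k) / real k ^ n))
        \<longlonglongrightarrow> (\<Sum>i\<in>F. 0)"
      by (rule tendsto_sum[OF each])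
    then have lim: "(\<lambda>k. \<Sum>i\<in>F. w i * (poly (p i j) (real (c * u)) - poly (p i j) (real u)) * (poly (Q i) (real k) / real k ^ n)) \<longlonglongrightarrow> 0"
      by simp
    have "(\<lambda>k. K (diagonal n k) / real k ^ n) \<longlonglongrightarrow> 0"
    proof (rule seq_null_comparison[OF lim])
      fix k assume k: "k \<ge> N"
      have "K (diagonal n k) \<le> (\<Sum>i\<in>F. w i * (poly (p i j) (real (c * u)) * poly (Q i) (real k)))
          - (\<Sum>i\<in>F. w i * (poly (p i j) (real u) * poly (Q i) (real k)))"
        using Kle[of "diagonal n k"] unfolding Bk[OF k cu] Bk[OF k u] .
      also have "\<dots> = (\<Sum>i\<in>F. w i * (poly (p i j) (real (c * u)) - poly (p i j) (real u)) * poly (Q i) (real k))"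
        by (simp add: sum_subtractf[symmetric] algebra_simps)
      finally have "K (diagonal n k) / real k ^ n
          \<le> (\<Sum>i\<in>F. w i * (poly (p i j) (real (c * u)) - poly (p i j) (real u)) * poly (Q i) (real k)) / real k ^ n"
        by (intro divide_right_mono) auto
      moreover have "0 \<le> K (diagonal n k) / real k ^ n" by (simp add: K_def)
      ultimately show "\<bar>K (diagonal n k) / real k ^ n\<bar>
          \<le> (\<Sum>i\<in>F. w i * (poly (p i j) (real (c * u)) - poly (p i j) (real u)) * (poly (Q i) (real k) / real k ^ n))"
        by (simp add: sum_divide_distrib)
    qed
    then have deg: "(\<Sum>l<n. degree (p' i l)) < n" if "i \<in> F'" for i
      using eventual_sum_degree_less[OF 2 _ that] by blast
    have "length L = n - 1" using distinct_card[OF L(1)] L(2) j by simp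
    then have "\<exists>C\<ge>0. \<forall>r. large n N' r \<longrightarrow> mixed_diff L K r = C"
      using deg L by (intro mixed_diff_const[OF 2]) fastforce+
    then obtain C where C: "C \<ge> 0" "\<And>r. large n N' r \<Longrightarrow> mixed_diff L K r = C" by blast
    have jL: "j \<notin> set L" using L(2) by simp
    have "mixed_diff L K r = mixed_diff L (hfun n (I(j := A))) (r(j := u)) - mixed_diff L (hfun n (I(j := B))) (r(j := u))" for r
      unfolding Keq mixed_diff_fix[OF jL, symmetric] mixed_diff_minus[symmetric] ..
    then show ?thesis using C by (intro exI[of _ C]) auto
  qed
  then show ?thesis using that by blast
qed

text \<open>Two functions eventually affine in \<open>u\<close>, one for \<open>A\<close> and one
  for \<open>B\<close>, differ by a nonnegative amount for all large \<open>u\<close>, so the slope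
  for \<open>A\<close> cannot be the smaller one.\<close>

lemma mm_antimono_slot:
  assumes I: "\<forall>l<n. finite_colength R (I l)" and j: "j < n"
    and A: "finite_colength R A" and B: "finite_colength R B" and AB: "A \<subseteq> B" and Bm: "B \<subseteq> m"
  shows "mm (I(j := B)) \<le> mm (I(j := A))"
proof -
  let ?f = "\<lambda>A. hfun n (I(j := A))"
  obtain L where L: "distinct L" "set L = {..<n} - {j}"
    using finite_distinct_list[of "{..<n} - {j}"] by auto
  have IA: "\<forall>l<n. finite_colength R ((I(j := A)) l)" and IB: "\<forall>l<n. finite_colength R ((I(j := B)) l)"
    using I A B by auto
  obtain N1 where N1: "\<And>r. large n N1 r \<Longrightarrow> mixed_diff L (?f A) (bump j 1 r) = mixed_diff L (?f A) r + mm (I(j := A))"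
    by (rule mixed_diff_slot[OF IA j L]) blast
  obtain N2 where N2: "\<And>r. large n N2 r \<Longrightarrow> mixed_diff L (?f B) (bump j 1 r) = mixed_diff L (?f B) r + mm (I(j := B))"
    by (rule mixed_diff_slot[OF IB j L]) blast
  define \<psi> where "\<psi> u r = mixed_diff L (?f A) (r(j := u)) - mixed_diff L (?f B) (r(j := u))" for u r
  obtain N3 where N3: "\<And>u. u \<ge> N3 \<Longrightarrow> \<exists>C\<ge>0. \<exists>M. \<forall>r. large n M r \<longrightarrow> \<psi> u r = C"
    unfolding \<psi>_def by (rule mixed_diff_kernel_const[OF I j A B AB Bm L]) blast
  define N where "N = Max {N1, N2, N3}"
  have N: "N1 \<le> N" "N2 \<le> N" "N3 \<le> N" by (auto simp: N_def)
  define \<delta> where "\<delta> = mm (I(j := A)) - mm (I(j := B))"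
  have step: "\<psi> (N + t) r = \<psi> N r + real t * \<delta>" if r: "large n N r" for r t
  proof (induction t)
    case (Suc t)
    have "large n N (r(j := N + t))" using r j by (simp add: large_def supported_def)
    then have l: "large n N1 (r(j := N + t))" "large n N2 (r(j := N + t))" using N by (auto intro: large_mono)
    have b: "bump j 1 (r(j := N + t)) = r(j := N + Suc t)" by (simp add: bump_def)
    have "\<psi> (N + Suc t) r = \<psi> (N + t) r + \<delta>"
      using N1[OF l(1)] N2[OF l(2)] unfolding b \<psi>_def \<delta>_def by simp
    then show ?case using Suc by (simp add: algebra_simps)
  qed simp
  obtain C M where C: "\<And>r. large n M r \<Longrightarrow> \<psi> N r = C" using N3[OF N(3)] by blast
  have nonneg: "0 \<le> C + real t * \<delta>" for t
  proof -
    obtain C' M' where C': "C' \<ge> 0" "\<And>r. large n M' r \<Longrightarrow> \<psi> (N + t) r = C'" using N3[of "N + t"] N(3) by auto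
    \<comment> \<open>The threshold \<open>M'\<close> depends on \<open>t\<close>, so the
      multidegree is chosen only after \<open>t\<close>.\<close>
    define r where "r = diagonal n (Max {N, M, M'})"
    have "large n N r" "large n M r" "large n M' r" unfolding r_def by (auto intro!: large_diagonal)
    then show ?thesis using step[of r t] C C' by simp
  qed
  have "0 \<le> \<delta>"
  proof (rule ccontr)
    assume "\<not> 0 \<le> \<delta>"
    then obtain t :: nat where "C < real t * (- \<delta>)" using reals_Archimedean3[of "- \<delta>"] by auto
    then show False using nonneg[of t] by simp
  qed
  then show ?thesis by (simp add: \<delta>_def)
qed

lemma mm_cong: "(\<And>j. j < n \<Longrightarrow> I j = I' j) \<Longrightarrow> mm I = mm I'"
  unfolding mm_def by (rule arg_cong[where f = "mixed_mult R"]) auto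

theorem mm_antimono:
  assumes A: "\<forall>l<n. finite_colength R (A l)" and B: "\<forall>l<n. finite_colength R (B l)"
    and AB: "\<And>l. l < n \<Longrightarrow> A l \<subseteq> B l" and Bm: "\<And>l. l < n \<Longrightarrow> B l \<subseteq> m"
  shows "mm B \<le> mm A"
proof -
  have "mm (\<lambda>l. if l < k then B l else A l) \<le> mm A" if "k \<le> n" for k
    using that
  proof (induction k)
    case (Suc k)
    let ?I = "\<lambda>l. if l < k then B l else A l"
    have k: "k < n" using Suc.prems by simp
    have "(\<lambda>l. if l < Suc k then B l else A l) = ?I(k := B k)" by (auto simp: fun_eq_iff less_Suc_eq)
    moreover have "?I(k := A k) = ?I" by (auto simp: fun_eq_iff)
    moreover have "mm (?I(k := B k)) \<le> mm (?I(k := A k))"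
      using A B AB[OF k] Bm[OF k] k by (intro mm_antimono_slot) auto
    ultimately show ?case using Suc by simp
  qed simp
  from this[of n] show ?thesis using mm_cong[of "\<lambda>l. if l < n then B l else A l" B] by simp
qed

end

section \<open>Samuel multiplicities\<close>

context local_ring_dim
begin

lemma samuel_mult_eq_lim:
  assumes "finite_colength R J"
    and "(\<lambda>k. fact n * qlen R (carrier R) (ideal_pow R J k) / real k ^ n) \<longlonglongrightarrow> l"
  shows "samuel_mult R J = l"
proof -
  have J: "ideal (ideal_pow R J k) R" for k by (rule ideal_pow_ideal[OF finite_colengthD[OF assms(1)]])
  show ?thesis
    unfolding samuel_mult_def Let_def dim the_enat.simps qlen_carrier_eq_colength[OF J]
    by (rule limI[OF assms(2)])
qed

lemma samuel_function_poly:
  assumes J: "finite_colength R J"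
  obtains N q where "\<And>k. k \<ge> N \<Longrightarrow> qlen R (carrier R) (ideal_pow R J k) = poly q (real k)" "degree q \<le> n"
proof -
  have J': "\<forall>j<Suc 0. finite_colength R ((\<lambda>_. J) j)" using J by simp
  obtain N F w p where 1: "eventual_sum (Suc 0) (hfun (Suc 0) (\<lambda>_. J)) N (F :: nat set) w p"
    "\<And>i. i \<in> F \<Longrightarrow> (\<Sum>j<Suc 0. degree (p i j)) \<le> n"
    by (rule hfun_eventual_sum[OF J']) blast
  define q where "q = (\<Sum>i\<in>F. smult (w i) (p i 0))"
  have "qlen R (carrier R) (ideal_pow R J k) = poly q (real k)" if "k \<ge> N" for k
  proof -
    have "hfun (Suc 0) (\<lambda>_. J) (diagonal (Suc 0) k) = (\<Sum>i\<in>F. w i * peval (Suc 0) (p i) (diagonal (Suc 0) k))"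
      using 1(1) large_diagonal[OF that] by (simp add: eventual_sum_def)
    then show ?thesis
      unfolding mprod_const[OF finite_colengthD[OF J]] by (simp add: q_def poly_sum peval_def diagonal_def)
  qed
  moreover have "degree q \<le> n"
    unfolding q_def
  proof (rule degree_sum_le)
    show "finite F" using 1(1) by (simp add: eventual_sum_def)
    show "degree (smult (w i) (p i 0)) \<le> n" if "i \<in> F" for i
      using 1(2)[OF that] degree_smult_le[of "w i" "p i 0"] by simp
  qed
  ultimately show ?thesis using that by blast
qed

lemma samuel_mult_eq_coeff:
  assumes J: "finite_colength R J"
    and q: "\<And>k. k \<ge> N \<Longrightarrow> qlen R (carrier R) (ideal_pow R J k) = poly q (real k)" "degree q \<le> n"
  shows "samuel_mult R J = fact n * Polynomial.coeff q n"
    "(\<lambda>k. fact n * qlen R (carrier R) (ideal_pow R J k) / real k ^ n) \<longlonglongrightarrow> fact n * Polynomial.coeff q n"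
proof -
  have "(\<lambda>k. fact n * (poly q (real k) / real k ^ n)) \<longlonglongrightarrow> fact n * Polynomial.coeff q n"
    by (intro tendsto_mult_left poly_over_power_tendsto q(2))
  then show "(\<lambda>k. fact n * qlen R (carrier R) (ideal_pow R J k) / real k ^ n) \<longlonglongrightarrow> fact n * Polynomial.coeff q n"
    by (rule Lim_transform_eventually) (use q(1) in \<open>auto intro!: eventually_sequentiallyI[of N]\<close>)
  then show "samuel_mult R J = fact n * Polynomial.coeff q n" by (rule samuel_mult_eq_lim[OF J])
qed

text \<open>With all ideals equal, the product is a power whose exponent is the sum of the
  \<open>r j\<close>, and the \<open>n\<close>-fold difference of the Samuel polynomial is
  \<open>fact n\<close> times its coefficient of degree \<open>n\<close>.\<close>

lemma samuel_mult_eq_mm: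
  assumes J: "finite_colength R J" and "n \<ge> 1"
  shows "samuel_mult R J = mm (\<lambda>_. J)"
proof -
  have J': "\<forall>j<n. finite_colength R ((\<lambda>_. J) j)" using J by simp
  obtain N q where q: "\<And>k. k \<ge> N \<Longrightarrow> qlen R (carrier R) (ideal_pow R J k) = poly q (real k)" "degree q \<le> n"
    by (rule samuel_function_poly[OF J]) blast
  obtain N' where N': "\<And>r. large n N' r \<Longrightarrow> mixed_diff [0..<n] (hfun n (\<lambda>_. J)) r = mm (\<lambda>_. J)"
    by (rule mm_mixed_diff[OF J']) blast
  have h: "hfun n (\<lambda>_. J) r = poly q (real (\<Sum>j<n. r j))" if "large n N r" for r
  proof -
    \<comment> \<open>This is where \<open>n \<ge> 1\<close> enters: an empty sum would stay 0 and
      never pass the bound \<open>N\<close>.\<close>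
    have "r 0 \<le> (\<Sum>j<n. r j)" using assms(2) by (intro member_le_sum) auto
    moreover have "N \<le> r 0" using that assms(2) by (simp add: large_def)
    ultimately show ?thesis unfolding mprod_const[OF finite_colengthD[OF J]] by (intro q(1)) simp
  qed
  define r where "r = diagonal n (max N N')"
  have r: "large n N r" "large n N' r" unfolding r_def by (auto intro!: large_diagonal)
  have "mm (\<lambda>_. J) = poly ((pdiff ^^ length [0..<n]) q) (real (\<Sum>j<n. r j))"
    unfolding N'[OF r(2), symmetric] by (rule mixed_diff_sum_degree[OF h _ r(1)]) auto
  also have "\<dots> = fact n * Polynomial.coeff q n" using pdiff_funpow[OF q(2)] by simp
  finally show ?thesis using samuel_mult_eq_coeff(1)[OF J q] by simp
qed

lemma samuel_mult_m_pos: "0 < samuel_mult R m"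
proof -
  obtain N q where q: "\<And>k. k \<ge> N \<Longrightarrow> qlen R (carrier R) (ideal_pow R m k) = poly q (real k)" "degree q \<le> n"
    by (rule samuel_function_poly[OF finite_colength_m]) blast
  note s = samuel_mult_eq_coeff[OF finite_colength_m q]
  obtain \<epsilon> where e: "\<epsilon> > 0" "\<And>k. k \<ge> 1 \<Longrightarrow> \<epsilon> * real k ^ n \<le> qlen R (carrier R) (ideal_pow R m k)"
    using m_pow_lower by blast
  have "\<epsilon> \<le> fact n * qlen R (carrier R) (ideal_pow R m k) / real k ^ n" if "k \<ge> 1" for k
  proof -
    have k: "0 < real k ^ n" using that by simp
    have "\<epsilon> \<le> qlen R (carrier R) (ideal_pow R m k) / real k ^ n"
      using e(2)[OF that] by (simp add: pos_le_divide_eq[OF k])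
    also have "\<dots> \<le> fact n * (qlen R (carrier R) (ideal_pow R m k) / real k ^ n)"
      using mult_right_mono[of 1 "fact n" "qlen R (carrier R) (ideal_pow R m k) / real k ^ n"] by simp
    finally show ?thesis by simp
  qed
  then have "\<epsilon> \<le> fact n * Polynomial.coeff q n"
    by (intro tendsto_lowerbound[OF s(2)] eventually_sequentiallyI[of 1]) auto
  then show ?thesis using s(1) e(1) by simp
qed

text \<open>All ideals lie in \<open>m\<close>, so antimonotonicity reduces the claim to the
  multiplicity of \<open>m\<close>, which is positive by the lower growth bound.\<close>

lemma mm_pos:
  assumes "n \<ge> 1" "\<forall>j<n. finite_colength R (I j)" "\<And>j. j < n \<Longrightarrow> I j \<subseteq> m"
  shows "0 < mm I"
proof -
  have "mm (\<lambda>_. m) \<le> mm I" by (rule mm_antimono) (use assms finite_colength_m in auto)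
  then show ?thesis using samuel_mult_m_pos samuel_mult_eq_mm[OF finite_colength_m assms(1)] by simp
qed

text \<open>
  In dimension zero the lengths of \<open>R/m\<^sup>k\<close> are eventually constant, and comparing \<open>I\<close> with powers of
  \<open>m\<close> squeezes the lengths of \<open>R/I\<^sup>k\<close> to the same constant.
\<close>

lemma samuel_mult_dim_0:
  assumes "n = 0" "finite_colength R I" "I \<subseteq> m"
  shows "samuel_mult R I = samuel_mult R m"
proof -
  let ?h = "\<lambda>I k. qlen R (carrier R) (ideal_pow R I k)"
  have Ii: "ideal I R" using assms(2) by (rule finite_colengthD)
  obtain c where c: "ideal_pow R m c \<subseteq> I" using finite_colength_contains_m_pow[OF assms(2)] by blast
  obtain N q where q: "\<And>k. k \<ge> N \<Longrightarrow> ?h m k = poly q (real k)" "degree q \<le> n"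
    by (rule samuel_function_poly[OF finite_colength_m]) blast
  obtain a where a: "q = [:a:]" using q(2) assms(1) by (auto elim: degree_eq_zeroE)
  have "?h I k = a" if "k \<ge> N" for k
  proof (rule antisym)
    \<comment> \<open>\<open>Suc c\<close> instead of \<open>c\<close> keeps the exponent at least
      \<open>k\<close>, inside the range where the length is constant.\<close>
    have "ideal_pow R m (Suc c * k) \<subseteq> ideal_pow R I k"
    proof -
      have "ideal_pow R m (Suc c) \<subseteq> ideal_pow R m c" by (rule ideal_pow_antimono[OF m_ideal]) simp
      then show ?thesis
        unfolding ideal_pow_pow[OF m_ideal, symmetric] using c by (intro ideal_pow_mono) blast
    qed
    then have "?h I k \<le> ?h m (Suc c * k)"
      by (intro qlen_carrier_antimono finite_colength_pow finite_colength_m ideal_pow_ideal Ii)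
    then show "?h I k \<le> a" using q(1)[of "Suc c * k"] that by (simp add: a)
    have "?h m k \<le> ?h I k"
      by (intro qlen_carrier_antimono finite_colength_pow assms(2) ideal_pow_ideal m_ideal ideal_pow_mono assms(3))
    then show "a \<le> ?h I k" using q(1)[OF that] by (simp add: a)
  qed
  then have q': "\<And>k. k \<ge> N \<Longrightarrow> ?h I k = poly q (real k)" by (simp add: a)
  show ?thesis
    using samuel_mult_eq_coeff(1)[OF assms(2) q' q(2)] samuel_mult_eq_coeff(1)[OF finite_colength_m q] by simp
qed

section \<open>Lojasiewicz exponents\<close>

lemma mm_pair:
  assumes "i \<le> n"
  shows "mixed_mult_pair R n i I J = mm (\<lambda>j. if j < i then I else J)"
  unfolding mixed_mult_pair_def mm_def repeated_pair_def
  by (rule arg_cong[where f = "mixed_mult R"], rule nth_equalityI) (use assms in \<open>auto simp: nth_append\<close>)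

text \<open>Numbering from 0, slot \<open>i - 1\<close> is the last one holding \<open>I\<close>.
  Replacing its s-th power by \<open>J^r\<close> gives ideals contained in the sums
  \<open>T^s + J^r\<close>; comparing multiplicities and cancelling \<open>s^(n-1)\<close> leaves
  \<open>s e_i \<le> r e_(i-1)\<close>.\<close>

lemma ratio_le_lojasiewicz:
  assumes I: "finite_colength R I" "I \<subseteq> m" and J: "finite_colength R J" "J \<subseteq> m" and i: "1 \<le> i" "i \<le> n"
  shows "mixed_mult_pair R n i I J / mixed_mult_pair R n (i - 1) I J \<le> lojasiewicz_pair R n i I J"
proof -
  define T where "T j = (if j < i then I else J)" for j
  have T: "finite_colength R (T j)" "T j \<subseteq> m" "ideal (T j) R" for j
    using I J finite_colengthD by (simp_all add: T_def)
  have Ji: "ideal J R" and Ii: "ideal I R" using I J finite_colengthD by blast+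
  have e: "mixed_mult_pair R n i I J = mm T" using mm_pair[OF i(2)] by (simp add: T_def[abs_def])
  have e': "mixed_mult_pair R n (i - 1) I J = mm (T(i - 1 := J))"
    unfolding mm_pair[OF le_trans[OF diff_le_self i(2)]] by (rule mm_cong) (use i in \<open>auto simp: T_def\<close>)
  have T': "finite_colength R ((T(i - 1 := J)) j)" "(T(i - 1 := J)) j \<subseteq> m" for j
    using T J by simp_all
  have pos': "0 < mm (T(i - 1 := J))"
    using i T' by (intro mm_pos) auto
  have mmap: "mixed_mult R (map f (repeated_pair n i I J)) = mm (\<lambda>j. f (T j))" for f
    unfolding mm_def repeated_pair_def
    by (rule arg_cong[where f = "mixed_mult R"], rule nth_equalityI) (use i in \<open>auto simp: nth_append T_def\<close>)
  let ?P = "\<lambda>r s. 1 \<le> r \<and> 1 \<le> s \<and>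
    mm (\<lambda>j. ideal_pow R (T j) s) = mm (\<lambda>j. ideal_pow R (T j) s <+> ideal_pow R J r)"
  have bound: "mm T / mm (T(i - 1 := J)) \<le> real r / real s" if P: "?P r s" for r s :: nat
  proof -
    have rs: "1 \<le> r" "1 \<le> s" using P by auto
    note idT = ideal_pow_ideal[OF T(3)] and idJ = ideal_pow_ideal[OF Ji]
    define U where "U j = ideal_pow R ((T(i - 1 := J)) j) (if j = i - 1 then r else s)" for j
    have Ufc: "\<forall>j<n. finite_colength R (U j)" unfolding U_def using finite_colength_pow T'(1) by blast
    have sumfc: "\<forall>j<n. finite_colength R (ideal_pow R (T j) s <+> ideal_pow R J r)"
      using finite_colength_mono[OF finite_colength_pow[OF T(1)] add_ideals[OF idT idJ] set_add_subset_l[OF idT idJ]] by blast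
    have "mm (\<lambda>j. ideal_pow R (T j) s <+> ideal_pow R J r) \<le> mm U"
    proof (rule mm_antimono[OF Ufc sumfc])
      fix j
      show "U j \<subseteq> ideal_pow R (T j) s <+> ideal_pow R J r"
        unfolding U_def
        by (cases "j = i - 1") (simp_all add: set_add_subset_l[OF idT idJ] set_add_subset_r[OF idT idJ])
      have "ideal_pow R (T j) s \<subseteq> T j" "ideal_pow R J r \<subseteq> J"
        using ideal_pow_antimono[OF T(3) rs(2), of j] ideal_pow_antimono[OF Ji rs(1)]
        unfolding One_nat_def ideal_pow_1[OF T(3)] ideal_pow_1[OF Ji] .
      then show "ideal_pow R (T j) s <+> ideal_pow R J r \<subseteq> m"
        using T(2)[of j] J(2) by (intro set_add_least m_ideal) auto
    qed
    moreover have "mm U = (\<Prod>j<n. real (if j = i - 1 then r else s)) * mm (T(i - 1 := J))"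
      unfolding U_def by (rule mm_pow) (use T'(1) rs in auto)
    moreover have "(\<Prod>j<n. real (if j = i - 1 then r else s)) = real r * real s ^ (n - 1)"
    proof -
      have "(\<Prod>j<n. real (if j = i - 1 then r else s)) = real r * (\<Prod>j\<in>{..<n} - {i - 1}. real s)"
        using i by (subst prod.remove[of _ "i - 1"]) (auto intro!: prod.cong)
      then show ?thesis using i by simp
    qed
    moreover have "mm (\<lambda>j. ideal_pow R (T j) s) = real s ^ n * mm T"
      using mm_pow[of T "\<lambda>_. s"] T(1) rs by simp
    ultimately have "real s ^ n * mm T \<le> real r * real s ^ (n - 1) * mm (T(i - 1 := J))" using P by simp
    moreover have "real s ^ n = real s * real s ^ (n - 1)" using i by (cases n) auto
    ultimately have "real s ^ (n - 1) * (real s * mm T) \<le> real s ^ (n - 1) * (real r * mm (T(i - 1 := J)))"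
      by (simp add: mult_ac)
    then have "real s * mm T \<le> real r * mm (T(i - 1 := J))"
      using rs by (subst (asm) mult_le_cancel_left_pos) auto
    then show ?thesis using pos' rs by (simp add: field_simps)
  qed
  \<comment> \<open>A lower bound for \<open>Inf\<close> requires a nonempty set. For
    \<open>r = Suc c\<close> and \<open>s = 1\<close>, the ideal \<open>J^r\<close> lies in both
    \<open>I\<close> and \<open>J\<close>, so adding it changes none of the ideals.\<close>
  have nonempty: "\<exists>r s. ?P r s"
  proof -
    obtain c where c: "ideal_pow R m c \<subseteq> I" using finite_colength_contains_m_pow[OF I(1)] by blast
    have "ideal_pow R J (Suc c) \<subseteq> ideal_pow R J c" by (rule ideal_pow_antimono[OF Ji]) simp
    also have "\<dots> \<subseteq> ideal_pow R m c" by (rule ideal_pow_mono[OF J(2)])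
    finally have "ideal_pow R J (Suc c) \<subseteq> I" using c by blast
    moreover have "ideal_pow R J (Suc c) \<subseteq> J"
      using ideal_pow_antimono[OF Ji, of "Suc 0" "Suc c"] unfolding ideal_pow_1[OF Ji] by simp
    ultimately have sub: "ideal_pow R J (Suc c) \<subseteq> T j" for j by (simp add: T_def)
    have "ideal_pow R (T j) (Suc 0) <+> ideal_pow R J (Suc c) = ideal_pow R (T j) (Suc 0)" for j
      unfolding ideal_pow_1[OF T(3)] by (rule set_add_absorb[OF T(3) ideal_pow_ideal[OF Ji] sub])
    then have "?P (Suc c) (Suc 0)" by (simp only: le_add2 One_nat_def Suc_le_mono zero_le order_refl simp_thms)
    then show ?thesis by blast
  qed
  have "lojasiewicz_pair R n i I J = Inf {real r / real s | r s. ?P r s}"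
    unfolding lojasiewicz_pair_def lojasiewicz_def mmap ..
  moreover have "mm T / mm (T(i - 1 := J)) \<le> Inf {real r / real s | r s. ?P r s}"
    by (rule cInf_greatest) (use nonempty bound in blast)+
  ultimately show ?thesis using e e' by simp
qed

lemma mixed_mult_pair_pos:
  assumes "finite_colength R I" "I \<subseteq> m" "finite_colength R J" "J \<subseteq> m" "1 \<le> n" "i \<le> n"
  shows "0 < mixed_mult_pair R n i I J"
  unfolding mm_pair[OF assms(6)] by (rule mm_pos) (use assms in auto)

end

section \<open>Telescoping ratios and the equivalences\<close>

lemma prod_ratio_telescope:
  fixes e :: "nat \<Rightarrow> real"
  assumes "\<And>j. j \<le> i \<Longrightarrow> 0 < e j"
  shows "(\<Prod>j=1..i. e j / e (j - 1)) = e i / e 0"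
  using assms
proof (induction i)
  case (Suc i)
  then have "(\<Prod>j=1..Suc i. e j / e (j - 1)) = e i / e 0 * (e (Suc i) / e i)" by simp
  then show ?case using Suc.prems[of i] by simp
qed (use assms[of 0] in simp)

text \<open>All ratios are positive, so one strict inequality among the factors makes the full
  product strict; equality for the last product therefore forces equality factor by factor.\<close>

lemma prod_ratio_bounds:
  fixes e L :: "nat \<Rightarrow> real"
  assumes pos: "\<And>j. j \<le> n \<Longrightarrow> 0 < e j" and le: "\<And>j. 1 \<le> j \<Longrightarrow> j \<le> n \<Longrightarrow> e j / e (j - 1) \<le> L j"
  shows "(\<forall>i\<in>{1..n}. e i / e 0 \<le> (\<Prod>j=1..i. L j)) \<and>
    (e n / e 0 = (\<Prod>j=1..n. L j) \<longleftrightarrow> (\<forall>i\<in>{1..n}. L i = e i / e (i - 1))) \<and>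
    ((\<forall>i\<in>{1..n}. e i / e 0 = (\<Prod>j=1..i. L j)) \<longleftrightarrow> (\<forall>i\<in>{1..n}. L i = e i / e (i - 1)))"
proof -
  have ratio: "0 < e j / e (j - 1)" if "j \<le> n" for j using pos[of j] pos[of "j - 1"] that by simp
  have tel: "(\<Prod>j=1..i. e j / e (j - 1)) = e i / e 0" if "i \<le> n" for i
    using prod_ratio_telescope[of i e] pos that by simp
  have 1: "e i / e 0 \<le> (\<Prod>j=1..i. L j)" if "i \<le> n" for i
    unfolding tel[OF that, symmetric]
    by (rule prod_mono) (use ratio le that in \<open>auto simp: less_imp_le\<close>)
  have 2: "e i / e 0 = (\<Prod>j=1..i. L j)" if "\<forall>i\<in>{1..n}. L i = e i / e (i - 1)" "i \<le> n" for i
    unfolding tel[OF that(2), symmetric] by (rule prod.cong) (use that in auto)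
  have 3: "L i = e i / e (i - 1)" if eq: "e n / e 0 = (\<Prod>j=1..n. L j)" and i: "i \<in> {1..n}" for i
  proof (rule ccontr)
    assume "L i \<noteq> e i / e (i - 1)"
    then have lt: "e i / e (i - 1) < L i" using le[of i] i by auto
    have Li: "0 \<le> L i" using lt ratio[of i] i by auto
    have "(\<Prod>j=1..n. e j / e (j - 1)) = e i / e (i - 1) * (\<Prod>j\<in>{1..n} - {i}. e j / e (j - 1))"
      using i by (subst prod.remove[of _ i]) auto
    also have "\<dots> < L i * (\<Prod>j\<in>{1..n} - {i}. e j / e (j - 1))"
      using lt ratio by (intro mult_strict_right_mono prod_pos) auto
    also have "\<dots> \<le> L i * (\<Prod>j\<in>{1..n} - {i}. L j)"
      using Li ratio le i by (intro mult_left_mono prod_mono) (auto simp: less_imp_le)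
    also have "\<dots> = (\<Prod>j=1..n. L j)" using i by (subst (2) prod.remove[of _ i]) auto
    finally show False using eq tel[of n] by simp
  qed
  have 4: "\<forall>i\<in>{1..n}. L i = e i / e (i - 1)" if "\<forall>i\<in>{1..n}. e i / e 0 = (\<Prod>j=1..i. L j)"
  proof (cases "n = 0")
    case False
    then have "e n / e 0 = (\<Prod>j=1..n. L j)" using that by auto
    then show ?thesis using 3 by blast
  qed simp
  show ?thesis
  proof (intro conjI iffI)
    show "\<forall>i\<in>{1..n}. e i / e 0 \<le> (\<Prod>j=1..i. L j)" using 1 by (meson atLeastAtMost_iff)
    show "\<forall>i\<in>{1..n}. L i = e i / e (i - 1)" if "e n / e 0 = (\<Prod>j=1..n. L j)"
      using 3[OF that] by blast
    show "e n / e 0 = (\<Prod>j=1..n. L j)" if "\<forall>i\<in>{1..n}. L i = e i / e (i - 1)"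
      by (rule 2[OF that order_refl])
    show "\<forall>i\<in>{1..n}. e i / e 0 = (\<Prod>j=1..i. L j)" if "\<forall>i\<in>{1..n}. L i = e i / e (i - 1)"
      using 2[OF that] by (meson atLeastAtMost_iff)
  qed (rule 4)
qed

theorem corollary3p7:
  fixes R :: "('a, 'b) ring_scheme" and m I J :: "'a set" and n :: nat
  assumes "noetherian_ring R" and "local_ring R m" and "quasi_unmixed R m"
    and "krull_dim R = enat n"
    and "finite_colength R I" and "I \<noteq> carrier R"
    and "finite_colength R J" and "J \<noteq> carrier R"
  shows "(\<forall>i\<in>{1..n}. mixed_mult_pair R n i I J / samuel_mult R J
             \<le> (\<Prod>j=1..i. lojasiewicz_pair R n j I J)) \<and>
         (hickel R n I J \<longleftrightarrow>
           (\<forall>i\<in>{1..n}. mixed_mult_pair R n i I J / samuel_mult R J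
             = (\<Prod>j=1..i. lojasiewicz_pair R n j I J))) \<and>
         ((\<forall>i\<in>{1..n}. mixed_mult_pair R n i I J / samuel_mult R J
             = (\<Prod>j=1..i. lojasiewicz_pair R n j I J)) \<longleftrightarrow>
           (\<forall>i\<in>{1..n}. lojasiewicz_pair R n i I J
             = mixed_mult_pair R n i I J / mixed_mult_pair R n (i - 1) I J))"
proof -
  interpret noetherian_ring R by fact
  interpret cring R using assms(2) by (simp add: local_ring_def)
  interpret local_ring_dim R m n by unfold_locales (fact assms(2), fact assms(4))
  have I: "finite_colength R I" "I \<subseteq> m" and J: "finite_colength R J" "J \<subseteq> m"
    using assms proper_ideal_le_m finite_colengthD by auto
  show ?thesis
  proof (cases "n = 0")
    case True
    \<comment> \<open>For \<open>n = 0\<close> the ranges of \<open>i\<close> are empty; only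
      \<open>hickel\<close> has content, and it says that this quotient is the empty
      product.\<close>
    have "samuel_mult R I / samuel_mult R J = 1"
      using samuel_mult_dim_0[OF True I] samuel_mult_dim_0[OF True J] samuel_mult_m_pos by simp
    then show ?thesis using True by (simp add: hickel_def)
  next
    case False
    then have n: "1 \<le> n" by simp
    let ?e = "\<lambda>i. mixed_mult_pair R n i I J" and ?L = "\<lambda>i. lojasiewicz_pair R n i I J"
    have e0: "samuel_mult R J = ?e 0"
      using samuel_mult_eq_mm[OF J(1) n] mm_pair[of 0] by simp
    have "mm (\<lambda>_. I) = mm (\<lambda>j. if j < n then I else J)" by (rule mm_cong) simp
    then have en: "samuel_mult R I = ?e n"
      using samuel_mult_eq_mm[OF I(1) n] mm_pair[of n I J] by simp
    show ?thesis
      using prod_ratio_bounds[of n ?e ?L, OF mixed_mult_pair_pos[OF I J n] ratio_le_lojasiewicz[OF I J]]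
      unfolding hickel_def e0 en by blast
  qed
qed

end
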